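(* Let $k\ge1$ and let $\mathbf{W}$ be an admissible graphon system of order $k$. Then with probability $1-o(1)$ as $n\to\infty$, $$\delta_{\square}(\mathbf{W}, \mathbb{G}(n, \mathbf{W})) \leq \frac{10^3 \times 8^k}{\sqrt{\log n}}.$$
   Context: A graphon is a symmetric measurable $W:[0,1]^2\to[0,1]$; a graphon system of order $k$ is a tuple $\mathbf{W}=(W_I)_{I\subseteq[k]}$ of graphons with $W_\emptyset\equiv1$. Define $\overline{W}_{[k]}=W_{[k]}$ and recursively $\overline{W}_I=W_I-\sum_{J\supsetneq I}\overline{W}_J$; $\mathbf{W}$ is admissible if $\overline{W}_I\ge0$ a.e. for all $I$ (then $\sum_I\overline W_I\equiv1$). The random graph system $\mathbb{G}(n,\mathbf{W})=(G_1,\dots,G_k)$ on $[n]$: choose $x_1,\dots,x_n\in[0,1]$ independently and uniformly; then for each pair $ij$, independently choose a random set $I_{ij}\subseteq[k]$ with $\Pr(I_{ij}=I)=\overline{W}_I(x_i,x_j)$; put $ij\in E(G_t)$ iff $t\in I_{ij}$. A graph $G$ on $[n]$ is viewed as the graphon equal to $1$ on $I_i\times I_j$ if $ij\in E(G)$ and $0$ otherwise, with $I_1=[0,\frac1n),\dots,I_n=[\frac{n-1}{n},1]$; a graph system $(G_1,\dots,G_k)$ is viewed as the graphon system with $W_\emptyset\equiv1$ and $W_I$ the graphon of $\bigcap_{i\in I}G_i$. Cut norm of a tuple: $\|\mathbf{W}\|_\square=\sup_{S,T}\sum_I|\int_{S\times T}W_I|$; $\delta_\square(\mathbf{W},\mathbf{U})=\inf_\varphi\|\mathbf{W}-\mathbf{U}^\varphi\|_\square$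 over measure-preserving invertible $\varphi:[0,1]\to[0,1]$, $\mathbf{U}^\varphi=(U_I(\varphi(x),\varphi(y)))_I$. *)

theory Defs
  imports "HOL-Probability.Probability"
begin

text \<open>Measurability, measure-preservation and ``almost everywhere'' refer to Lebesgue measure
  throughout. Graphons are functions on all of \<open>real \<times> real\<close>; their values outside the unit
  square are never constrained and never used.\<close>

type_synonym graphon_family = "nat set \<Rightarrow> real \<times> real \<Rightarrow> real"

definition unit_square :: "(real \<times> real) set" where
  "unit_square = {0..1} \<times> {0..1}"

definition graphon :: "(real \<times> real \<Rightarrow> real) \<Rightarrow> bool" where
  "graphon W \<longleftrightarrow>
     W \<in> borel_measurable (lebesgue_on unit_square) \<and>
     (\<forall>p\<in>unit_square. W p \<in> {0..1}) \<and>
     (\<forall>(x, y)\<in>unit_square. W (x, y) = W (y, x))"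

definition graphon_system :: "nat \<Rightarrow> graphon_family \<Rightarrow> bool" where
  "graphon_system k W \<longleftrightarrow>
     (\<forall>I\<subseteq>{1..k}. graphon (W I)) \<and> (\<forall>p\<in>unit_square. W {} p = 1)"

text \<open>The function \<open>wbar k W I\<close> is the mathematical $\overline{W}_I$; for \<open>I = {1..k}\<close>
  the sum is empty.\<close>

function wbar :: "nat \<Rightarrow> graphon_family \<Rightarrow> nat set \<Rightarrow> real \<times> real \<Rightarrow> real" where
  "wbar k W I p = W I p - (\<Sum>J\<in>{J. I \<subset> J \<and> J \<subseteq> {1..k}}. wbar k W J p)"
  by pat_completeness auto
termination
  by (relation "Wellfounded.measure (\<lambda>(k, W, I, p). card ({1..k} - I))")
     (auto intro!: psubset_card_mono)

declare wbar.simps [simp del]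

definition admissible :: "nat \<Rightarrow> graphon_family \<Rightarrow> bool" where
  "admissible k W \<longleftrightarrow> (\<forall>I\<subseteq>{1..k}. AE p in lebesgue_on unit_square. 0 \<le> wbar k W I p)"

subsection \<open>Cut norm and cut distance\<close>

definition cut_norm :: "nat \<Rightarrow> graphon_family \<Rightarrow> real" where
  "cut_norm k W =
     (SUP (S, T)\<in>sets (lebesgue_on {0..1}) \<times> sets (lebesgue_on {0..1}).
        \<Sum>I\<in>Pow {1..k}. \<bar>LINT p:S \<times> T|lebesgue. W I p\<bar>)"

definition invertible_mp :: "(real \<Rightarrow> real) set" where
  "invertible_mp =
     {\<phi>. bij_betw \<phi> {0..1} {0..1} \<and>
          \<phi> \<in> measurable (lebesgue_on {0..1}) (lebesgue_on {0..1}) \<and>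
          the_inv_into {0..1} \<phi> \<in> measurable (lebesgue_on {0..1}) (lebesgue_on {0..1}) \<and>
          distr (lebesgue_on {0..1}) (lebesgue_on {0..1}) \<phi> = lebesgue_on {0..1}}"

definition cut_dist :: "nat \<Rightarrow> graphon_family \<Rightarrow> graphon_family \<Rightarrow> real" where
  "cut_dist k W U =
     (INF \<phi>\<in>invertible_mp. cut_norm k (\<lambda>I (x, y). W I (x, y) - U I (\<phi> x, \<phi> y)))"

subsection \<open>Graph systems as graphon systems\<close>

text \<open>A graph on \<open>{1..n}\<close> is given by its edge set, a set of two-element subsets of
  \<open>{1..n}\<close>; a graph system maps each \<open>t \<in> {1..k}\<close> to the edge set of the \<open>t\<close>-th graph.\<close>

type_synonym graph_family = "nat \<Rightarrow> nat set set"

definition vertex_part :: "nat \<Rightarrow> nat \<Rightarrow> real set" where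
  "vertex_part n i =
     (if i = n then {(real i - 1) / real n .. 1} else {(real i - 1) / real n ..< real i / real n})"

definition graph_graphon :: "nat \<Rightarrow> nat set set \<Rightarrow> real \<times> real \<Rightarrow> real" where
  "graph_graphon n E p =
     (if \<exists>i\<in>{1..n}. \<exists>j\<in>{1..n}. p \<in> vertex_part n i \<times> vertex_part n j \<and> {i, j} \<in> E
      then 1 else 0)"

definition system_graphons :: "nat \<Rightarrow> graph_family \<Rightarrow> graphon_family" where
  "system_graphons n G I = (if I = {} then (\<lambda>_. 1) else graph_graphon n (\<Inter>t\<in>I. G t))"

subsection \<open>The random graph system\<close>

text \<open>The conditional law of the label set \<open>I\<^sub>i\<^sub>j\<close> given the two sampled points. For an admissible
  system the values \<open>wbar k W I p\<close>, \<open>I \<subseteq> {1..k}\<close>, are nonnegative only almost everywhere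
  (they always sum to \<open>1\<close> on the unit square); on the exceptional null set the law is the
  point mass at the empty set.\<close>

definition label_pmf :: "nat \<Rightarrow> graphon_family \<Rightarrow> real \<times> real \<Rightarrow> nat set pmf" where
  "label_pmf k W p =
     (if \<forall>I\<subseteq>{1..k}. 0 \<le> wbar k W I p
      then embed_pmf (\<lambda>I. if I \<subseteq> {1..k} then wbar k W I p else 0)
      else return_pmf {})"

definition vertex_pairs :: "nat \<Rightarrow> (nat \<times> nat) set" where
  "vertex_pairs n = {(i, j). 1 \<le> i \<and> i < j \<and> j \<le> n}"

definition labels_to_graphs :: "nat \<Rightarrow> (nat \<times> nat \<Rightarrow> nat set) \<Rightarrow> graph_family" where
  "labels_to_graphs n L t = {{i, j} | i j. (i, j) \<in> vertex_pairs n \<and> t \<in> L (i, j)}"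

definition conditional_graphs ::
  "nat \<Rightarrow> graphon_family \<Rightarrow> nat \<Rightarrow> (nat \<Rightarrow> real) \<Rightarrow> graph_family pmf" where
  "conditional_graphs k W n x =
     map_pmf (labels_to_graphs n)
       (Pi_pmf (vertex_pairs n) {} (\<lambda>(i, j). label_pmf k W (x i, x j)))"

text \<open>The product measure of the sample points is completed because \<open>W\<close> is only
  Lebesgue measurable, so that \<open>x \<mapsto> W I (x i, x j)\<close> need not be measurable for the
  uncompleted product sigma-algebra. The result is a measure on all subsets of the discrete
  space of graph systems.\<close>

definition random_graphs :: "nat \<Rightarrow> graphon_family \<Rightarrow> nat \<Rightarrow> graph_family measure" where
  "random_graphs k W n =
     completion (\<Pi>\<^sub>M i\<in>{1..n}. lebesgue_on {0..1}) \<bind>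
       (\<lambda>x. measure_pmf (conditional_graphs k W n x))"

end

theory Submission
  imports Defs "HOL-Real_Asymp.Real_Asymp"
begin

text \<open>The functions \<open>W\<^sub>I\<close> are approximated by step functions \<open>A\<^sub>I\<close> on a fine grid of \<open>N\<close> intervals, \<open>n\<close>
  dividing \<open>N\<close>, so that the sample becomes a sequence of uniform grid cells and
  measure-preserving maps become permutations of the cells. Weak regularity writes
  \<open>A\<^sub>I = K\<^sub>I + U\<^sub>I\<close>, where \<open>K\<^sub>I\<close> depends only on the types of its arguments, the number of types being
  a small power of \<open>n\<close>, and \<open>U\<^sub>I\<close> has cut norm of order \<open>1 / sqrt (ln n)\<close>. The type frequencies of the
  sample concentrate, so a permutation of the cells matches \<open>K\<^sub>I\<close> with its sampled version. The
  cut norm of the sampled \<open>U\<^sub>I\<close> stays small: the row set maximising it is recovered from about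
  \<open>ln n / 10\<^sup>4\<close> random probes, leaving only a small power of \<open>n\<close> of candidate sets, so that second
  moments and a union bound suffice. Finally, the random graphs differ from the sampled
  \<open>W\<^sub>I\<close> by a matrix with independent centred entries, whose cut norm is controlled by the
  inner products of its rows.\<close>

section \<open>Orthogonal sums in finite product spaces\<close>

text \<open>The grid is chosen after n and without any rate, so step approximation is free: its
  error \<open>\<delta>\<close> is 1 / n^3, and with high probability all n^2 pairs of sample points
  miss the exceptional part of the square. One measure-preserving map has to serve all
  \<open>2 ^ k\<close> index sets at once. The types are therefore combined over all I, and their
  number becomes at most \<open>(4 ^ r) ^ (2 ^ k)\<close>. Keeping this a small power of n makes the
  regularity parameter \<open>e\<close> grow with \<open>2 ^ k\<close>; together with the summation
  over I this explains the powers of \<open>2 ^ k\<close> in the bound. All probabilistic input is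
  of second order: orthogonality of centred summands, followed by Markov's inequality. This suffices
  because the candidate row sets and the types number only a constant times n^(1/8), whereas each
  single deviation is of order n^(-1/2) up to logarithms. Every threshold can then be n^(-1/8),
  which is negligible against 1 / sqrt (ln n).\<close>

abbreviation E :: "'a pmf \<Rightarrow> ('a \<Rightarrow> real) \<Rightarrow> real" where
  "E \<equiv> measure_pmf.expectation"

lemma finite_set_Pi_pmf:
  assumes "finite A" "\<forall>i\<in>A. finite (set_pmf (p i))"
  shows "finite (set_pmf (Pi_pmf A d p))"
  using assms by (simp add: set_Pi_pmf finite_PiE_dflt)

lemma expectation_Pi_pmf_split:
  assumes A: "finite A" "a \<in> A" and fin: "\<forall>i\<in>A. finite (set_pmf (p i))"
  shows "E (Pi_pmf A d p) F = E (p a) (\<lambda>y. E (Pi_pmf (A - {a}) d p) (\<lambda>x. F (x(a := y))))"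
proof -
  let ?B = "A - {a}"
  have A': "Pi_pmf A d p = p a \<bind> (\<lambda>y. map_pmf (\<lambda>x. x(a := y)) (Pi_pmf ?B d p))"
    using A Pi_pmf_insert'[of ?B a d p]
    by (simp add: insert_absorb map_pmf_def)
  have fa: "finite (set_pmf (p a))" and fB: "finite (set_pmf (Pi_pmf ?B d p))"
    using A fin by (auto intro: finite_set_Pi_pmf)
  have "E (Pi_pmf A d p) F
      = (\<Sum>y\<in>set_pmf (p a). pmf (p a) y *\<^sub>R E (map_pmf (\<lambda>x. x(a := y)) (Pi_pmf ?B d p)) F)"
    unfolding A'
  proof (rule pmf_expectation_bind[OF fa _ order_refl])
    show "finite (set_pmf (map_pmf (\<lambda>x. x(a := y)) (Pi_pmf ?B d p)))" for y
      using fB by (subst set_map_pmf) (rule finite_imageI)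
  qed
  also have "\<dots> = (\<Sum>y\<in>set_pmf (p a). pmf (p a) y *\<^sub>R E (Pi_pmf ?B d p) (\<lambda>x. F (x(a := y))))"
    by simp
  also have "\<dots> = E (p a) (\<lambda>y. E (Pi_pmf ?B d p) (\<lambda>x. F (x(a := y))))"
    by (rule integral_measure_pmf[symmetric, OF fa])
  finally show ?thesis .
qed

text \<open>Plays the part of a conditional expectation given all coordinates except
  \<open>a\<close>: that coordinate is drawn anew, which leaves the product law unchanged.\<close>

lemma expectation_Pi_pmf_resample:
  assumes A: "finite A" "a \<in> A" and fin: "\<forall>i\<in>A. finite (set_pmf (p i))"
  shows "E (Pi_pmf A d p) F = E (Pi_pmf A d p) (\<lambda>x. E (p a) (\<lambda>y. F (x(a := y))))"
proof -
  let ?B = "A - {a}"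
  have fa: "finite (set_pmf (p a))" and fB: "finite (set_pmf (Pi_pmf ?B d p))"
    using A fin by (auto intro: finite_set_Pi_pmf)
  have ea: "E (p a) g = (\<Sum>y\<in>set_pmf (p a). pmf (p a) y * g y)" for g
    using integral_measure_pmf[OF fa, where M = "p a" and f = g] by simp
  have eB: "E (Pi_pmf ?B d p) g
      = (\<Sum>x\<in>set_pmf (Pi_pmf ?B d p). pmf (Pi_pmf ?B d p) x * g x)" for g
    using integral_measure_pmf[OF fB, where M = "Pi_pmf ?B d p" and f = g] by simp
  have "E (Pi_pmf A d p) (\<lambda>x. E (p a) (\<lambda>y. F (x(a := y))))
     = E (Pi_pmf ?B d p) (\<lambda>x. E (p a) (\<lambda>y. F (x(a := y))))"
    by (subst expectation_Pi_pmf_split[OF A fin]) simp_all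
  also have "\<dots> = (\<Sum>x\<in>set_pmf (Pi_pmf ?B d p). pmf (Pi_pmf ?B d p) x *
       (\<Sum>y\<in>set_pmf (p a). pmf (p a) y * F (x(a := y))))"
    unfolding ea eB ..
  also have "\<dots> = (\<Sum>y\<in>set_pmf (p a). pmf (p a) y *
      (\<Sum>x\<in>set_pmf (Pi_pmf ?B d p). pmf (Pi_pmf ?B d p) x * F (x(a := y))))"
    unfolding sum_distrib_left
    by (rule trans[OF sum.swap]) (intro sum.cong refl mult.left_commute)
  also have "\<dots> = E (Pi_pmf A d p) F"
    unfolding expectation_Pi_pmf_split[OF A fin, where d = d and F = F] ea eB ..
  finally show ?thesis by simp
qed

lemma expectation_mono_pmf:
  assumes "finite (set_pmf p)" "\<And>x. x \<in> set_pmf p \<Longrightarrow> f x \<le> g x"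
  shows "E p f \<le> E p g"
  using assms by (intro integral_mono_AE) (auto simp: AE_measure_pmf_iff integrable_measure_pmf_finite)

text \<open>This is nonnegativity of the variance of \<open>\<bar>f\<bar>\<close>. It turns second
  moments into first moments, which add up over many error terms.\<close>

lemma expectation_abs_le_sqrt:
  assumes "finite (set_pmf p)"
  shows "E p (\<lambda>x. \<bar>f x\<bar>) \<le> sqrt (E p (\<lambda>x. (f x)\<^sup>2))"
proof -
  have int: "integrable p g" for g :: "_ \<Rightarrow> real"
    using assms by (rule integrable_measure_pmf_finite)
  define c where "c = E p (\<lambda>x. \<bar>f x\<bar>)"
  have "0 \<le> E p (\<lambda>x. (\<bar>f x\<bar> - c)\<^sup>2)"
    by (rule Bochner_Integration.integral_nonneg) simp
  also have "\<dots> = E p (\<lambda>x. (f x)\<^sup>2 - 2 * c * \<bar>f x\<bar> + c\<^sup>2)"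
    by (simp add: power2_diff algebra_simps)
  also have "\<dots> = E p (\<lambda>x. (f x)\<^sup>2) - 2 * c * c + c\<^sup>2"
    unfolding c_def using int by simp
  also have "\<dots> = E p (\<lambda>x. (f x)\<^sup>2) - c\<^sup>2"
    by (simp add: power2_eq_square)
  finally have "c\<^sup>2 \<le> E p (\<lambda>x. (f x)\<^sup>2)" by simp
  then show ?thesis unfolding c_def by (rule real_le_rsqrt)
qed

text \<open>The hypotheses make the summands martingale-difference-like: averaging over the coordinate
  \<open>\<kappa> j\<close> kills the \<open>j\<close>-th summand and leaves the others unchanged, so they are orthogonal.\<close>

lemma expectation_square_sum_orthogonal:
  fixes Y :: "'j \<Rightarrow> ('i \<Rightarrow> 'b) \<Rightarrow> real"
  assumes A: "finite A" and fin: "\<forall>i\<in>A. finite (set_pmf (p i))" and J: "finite J"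
    and \<kappa>: "\<And>j. j \<in> J \<Longrightarrow> \<kappa> j \<in> A"
    and mean: "\<And>j x. j \<in> J \<Longrightarrow> x \<in> set_pmf (Pi_pmf A d p) \<Longrightarrow> E (p (\<kappa> j)) (\<lambda>y. Y j (x(\<kappa> j := y))) = 0"
    and other: "\<And>i j x y. i \<in> J \<Longrightarrow> j \<in> J \<Longrightarrow> i \<noteq> j \<Longrightarrow> Y i (x(\<kappa> j := y)) = Y i x"
  shows "E (Pi_pmf A d p) (\<lambda>x. (\<Sum>j\<in>J. Y j x)\<^sup>2) = (\<Sum>j\<in>J. E (Pi_pmf A d p) (\<lambda>x. (Y j x)\<^sup>2))"
proof -
  let ?P = "Pi_pmf A d p"
  have int: "integrable ?P f" for f :: "_ \<Rightarrow> real"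
    by (intro integrable_measure_pmf_finite finite_set_Pi_pmf A fin)
  have zero: "E ?P (\<lambda>x. Y i x * Y j x) = 0" if "i \<in> J" "j \<in> J" "i \<noteq> j" for i j
  proof -
    have "E ?P (\<lambda>x. Y i x * Y j x)
        = E ?P (\<lambda>x. E (p (\<kappa> j)) (\<lambda>y. Y i x * Y j (x(\<kappa> j := y))))"
      using expectation_Pi_pmf_resample[OF A \<kappa>[OF that(2)] fin, where d = d and F = "\<lambda>x. Y i x * Y j x"] other[OF that] by simp
    also have "\<dots> = E ?P (\<lambda>x. 0)"
      by (intro integral_cong_AE) (auto simp: AE_measure_pmf_iff mean that)
    finally show ?thesis by simp
  qed
  have "E ?P (\<lambda>x. (\<Sum>j\<in>J. Y j x)\<^sup>2) = (\<Sum>i\<in>J. \<Sum>j\<in>J. E ?P (\<lambda>x. Y i x * Y j x))"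
    by (simp add: power2_eq_square sum_product int)
  also have "\<dots> = (\<Sum>i\<in>J. \<Sum>j\<in>J. if j = i then E ?P (\<lambda>x. (Y i x)\<^sup>2) else 0)"
    by (intro sum.cong refl) (auto simp: zero power2_eq_square)
  also have "\<dots> = (\<Sum>j\<in>J. E ?P (\<lambda>x. (Y j x)\<^sup>2))"
    using J by simp
  finally show ?thesis .
qed

lemma weak_law_orthogonal:
  fixes Y :: "'j \<Rightarrow> ('i \<Rightarrow> 'b) \<Rightarrow> real"
  assumes A: "finite A" and fin: "\<forall>i\<in>A. finite (set_pmf (p i))"
    and J: "finite J" "Z \<subseteq> J"
    and \<kappa>: "\<And>j. j \<in> J - Z \<Longrightarrow> \<kappa> j \<in> A"
    and bd: "\<And>j x. j \<in> J \<Longrightarrow> x \<in> set_pmf (Pi_pmf A d p) \<Longrightarrow> \<bar>Y j x\<bar> \<le> B" and B: "0 \<le> B"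
    and mean: "\<And>j x. j \<in> J - Z \<Longrightarrow> x \<in> set_pmf (Pi_pmf A d p) \<Longrightarrow>
      E (p (\<kappa> j)) (\<lambda>y. Y j (x(\<kappa> j := y))) = 0"
    and other: "\<And>i j x y. i \<in> J - Z \<Longrightarrow> j \<in> J - Z \<Longrightarrow> i \<noteq> j \<Longrightarrow> Y i (x(\<kappa> j := y)) = Y i x"
  shows "E (Pi_pmf A d p) (\<lambda>x. \<bar>\<Sum>j\<in>J. Y j x\<bar>) \<le> B * (sqrt (card J) + card Z)"
proof -
  let ?P = "Pi_pmf A d p"
  have f: "finite (set_pmf ?P)" by (intro finite_set_Pi_pmf A fin)
  have int: "integrable ?P f" for f :: "_ \<Rightarrow> real"
    by (intro integrable_measure_pmf_finite f)
  have fZ: "finite Z" using J finite_subset by blast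
  have "E ?P (\<lambda>x. (\<Sum>j\<in>J-Z. Y j x)\<^sup>2) = (\<Sum>j\<in>J-Z. E ?P (\<lambda>x. (Y j x)\<^sup>2))"
    using J by (intro expectation_square_sum_orthogonal[OF A fin, where \<kappa> = \<kappa>]) (auto intro: \<kappa> mean other)
  also have "\<dots> \<le> (\<Sum>j\<in>J-Z. E ?P (\<lambda>x. B\<^sup>2))"
    using bd B by (intro sum_mono expectation_mono_pmf f) (auto intro!: abs_le_square_iff[THEN iffD1])
  also have "\<dots> \<le> card J * B\<^sup>2"
    using J by (auto intro!: mult_right_mono simp: card_mono)
  finally have *: "E ?P (\<lambda>x. (\<Sum>j\<in>J-Z. Y j x)\<^sup>2) \<le> card J * B\<^sup>2" .
  have "E ?P (\<lambda>x. \<bar>\<Sum>j\<in>J. Y j x\<bar>) \<le> E ?P (\<lambda>x. \<bar>\<Sum>j\<in>J-Z. Y j x\<bar> + card Z * B)"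
  proof (intro expectation_mono_pmf f)
    fix x assume x: "x \<in> set_pmf ?P"
    have "\<bar>\<Sum>j\<in>J. Y j x\<bar> \<le> \<bar>\<Sum>j\<in>J-Z. Y j x\<bar> + \<bar>\<Sum>j\<in>Z. Y j x\<bar>"
      using J by (subst sum.subset_diff[of Z J]) auto
    also have "\<bar>\<Sum>j\<in>Z. Y j x\<bar> \<le> card Z * B"
      using bd x J by (intro order_trans[OF sum_abs] sum_bounded_above) auto
    finally show "\<bar>\<Sum>j\<in>J. Y j x\<bar> \<le> \<bar>\<Sum>j\<in>J-Z. Y j x\<bar> + card Z * B" by simp
  qed
  also have "\<dots> = E ?P (\<lambda>x. \<bar>\<Sum>j\<in>J-Z. Y j x\<bar>) + card Z * B"
    using int by simp
  also have "E ?P (\<lambda>x. \<bar>\<Sum>j\<in>J-Z. Y j x\<bar>) \<le> sqrt (card J * B\<^sup>2)"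
    by (rule order_trans[OF expectation_abs_le_sqrt[OF f]]) (use * in simp)
  also have "\<dots> = B * sqrt (card J)" using B by (simp add: real_sqrt_mult)
  finally show ?thesis by (simp add: algebra_simps)
qed

section \<open>Cut norms of matrices\<close>

text \<open>An unnormalised cut norm, stated as a bound for all rectangles rather than as a maximum;
  the number of entries is absorbed into \<open>\<eta>\<close>.\<close>

definition cut_bounded :: "'a set \<Rightarrow> 'b set \<Rightarrow> ('a \<Rightarrow> 'b \<Rightarrow> real) \<Rightarrow> real \<Rightarrow> bool" where
  "cut_bounded V V' B \<eta> \<longleftrightarrow> (\<forall>S\<subseteq>V. \<forall>T\<subseteq>V'. \<bar>\<Sum>i\<in>S. \<Sum>j\<in>T. B i j\<bar> \<le> \<eta>)"

lemma cut_boundedD: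
  "cut_bounded V V' B \<eta> \<Longrightarrow> S \<subseteq> V \<Longrightarrow> T \<subseteq> V' \<Longrightarrow> \<bar>\<Sum>i\<in>S. \<Sum>j\<in>T. B i j\<bar> \<le> \<eta>"
  by (auto simp: cut_bounded_def)

lemma cut_bounded_minus: "cut_bounded V V' (\<lambda>i j. - B i j) \<eta> \<longleftrightarrow> cut_bounded V V' B \<eta>"
  by (simp add: cut_bounded_def sum_negf)

lemma weighted_sum_le_sum_pos:
  fixes f w :: "'a \<Rightarrow> real"
  assumes "finite V" "\<forall>i\<in>V. w i \<in> {0..1}"
  shows "(\<Sum>i\<in>V. w i * f i) \<le> (\<Sum>i\<in>{i\<in>V. f i > 0}. f i)"
proof -
  have "(\<Sum>i\<in>V. w i * f i) \<le> (\<Sum>i\<in>V. if f i > 0 then f i else 0)"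
    using assms(2) by (intro sum_mono)
      (auto simp: mult_le_cancel_right1 mult_nonneg_nonpos)
  also have "\<dots> = (\<Sum>i\<in>{i\<in>V. f i > 0}. f i)"
    using assms(1) by (simp add: sum.inter_filter)
  finally show ?thesis .
qed

text \<open>The form is linear in \<open>s\<close> and in \<open>t\<close> separately, so fractional
  weights can be rounded to indicator functions, first \<open>s\<close> and then \<open>t\<close>,
  without decreasing the value.\<close>

lemma cut_bounded_weighted_le:
  assumes fin: "finite V" "finite V'" and cb: "cut_bounded V V' B \<eta>"
    and s: "\<forall>i\<in>V. s i \<in> {0..1}" and t: "\<forall>j\<in>V'. t j \<in> {0..1}"
  shows "(\<Sum>i\<in>V. \<Sum>j\<in>V'. s i * t j * B i j) \<le> \<eta>"
proof -
  have "(\<Sum>i\<in>V. \<Sum>j\<in>V'. s i * t j * B i j) = (\<Sum>i\<in>V. s i * (\<Sum>j\<in>V'. t j * B i j))"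
    by (simp add: sum_distrib_left mult_ac)
  also have "\<dots> \<le> (\<Sum>i\<in>{i\<in>V. (\<Sum>j\<in>V'. t j * B i j) > 0}. \<Sum>j\<in>V'. t j * B i j)" (is "_ \<le> sum _ ?S")
    by (rule weighted_sum_le_sum_pos[OF fin(1) s])
  also have "\<dots> = (\<Sum>j\<in>V'. t j * (\<Sum>i\<in>?S. B i j))"
    by (subst sum.swap) (simp add: sum_distrib_left)
  also have "\<dots> \<le> (\<Sum>j\<in>{j\<in>V'. (\<Sum>i\<in>?S. B i j) > 0}. \<Sum>i\<in>?S. B i j)" (is "_ \<le> sum _ ?T")
    by (rule weighted_sum_le_sum_pos[OF fin(2) t])
  also have "\<dots> = (\<Sum>i\<in>?S. \<Sum>j\<in>?T. B i j)"
    by (rule sum.swap)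
  also have "\<dots> \<le> \<eta>"
    using cut_boundedD[OF cb, of ?S ?T] by auto
  finally show ?thesis .
qed

lemma cut_bounded_weighted:
  assumes "finite V" "finite V'" "cut_bounded V V' B \<eta>"
    and "\<forall>i\<in>V. s i \<in> {0..1}" "\<forall>j\<in>V'. t j \<in> {0..1}"
  shows "\<bar>\<Sum>i\<in>V. \<Sum>j\<in>V'. s i * t j * B i j\<bar> \<le> \<eta>"
  using cut_bounded_weighted_le[OF assms]
    cut_bounded_weighted_le[OF assms(1,2) iffD2[OF cut_bounded_minus assms(3)] assms(4,5)]
  by (simp add: sum_negf)

lemma cut_bounded_add:
  assumes "cut_bounded V V' B \<eta>" "cut_bounded V V' C \<theta>"
  shows "cut_bounded V V' (\<lambda>i j. B i j + C i j) (\<eta> + \<theta>)"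
  unfolding cut_bounded_def
proof (intro allI impI)
  fix S T assume "S \<subseteq> V" "T \<subseteq> V'"
  from cut_boundedD[OF assms(1) this] cut_boundedD[OF assms(2) this]
  show "\<bar>\<Sum>i\<in>S. \<Sum>j\<in>T. B i j + C i j\<bar> \<le> \<eta> + \<theta>"
    by (simp add: sum.distrib)
qed

lemma cut_bounded_mono:
  "cut_bounded V V' B \<eta> \<Longrightarrow> \<eta> \<le> \<theta> \<Longrightarrow> cut_bounded V V' B \<theta>"
  unfolding cut_bounded_def by (meson order_trans)

lemma cut_bounded_cong:
  assumes "\<And>i j. i \<in> V \<Longrightarrow> j \<in> V' \<Longrightarrow> B i j = C i j"
  shows "cut_bounded V V' B \<eta> \<longleftrightarrow> cut_bounded V V' C \<eta>"
proof -
  have "(\<Sum>i\<in>S. \<Sum>j\<in>T. B i j) = (\<Sum>i\<in>S. \<Sum>j\<in>T. C i j)" if "S \<subseteq> V" "T \<subseteq> V'" for S T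
    using that assms by (intro sum.cong refl) auto
  then show ?thesis unfolding cut_bounded_def by simp
qed

lemma cut_bounded_sum_abs:
  assumes "finite V" "finite V'" "(\<Sum>i\<in>V. \<Sum>j\<in>V'. \<bar>B i j\<bar>) \<le> \<eta>"
  shows "cut_bounded V V' B \<eta>"
  unfolding cut_bounded_def
proof (intro allI impI)
  fix S T assume ST: "S \<subseteq> V" "T \<subseteq> V'"
  have "\<bar>\<Sum>i\<in>S. \<Sum>j\<in>T. B i j\<bar> \<le> (\<Sum>i\<in>S. \<Sum>j\<in>T. \<bar>B i j\<bar>)"
    by (intro order_trans[OF sum_abs] sum_mono) auto
  also have "\<dots> \<le> (\<Sum>i\<in>V. \<Sum>j\<in>V'. \<bar>B i j\<bar>)"
    using ST assms by (intro order_trans[OF sum_mono sum_mono2] sum_mono2 sum_nonneg) auto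
  finally show "\<bar>\<Sum>i\<in>S. \<Sum>j\<in>T. B i j\<bar> \<le> \<eta>" using assms by linarith
qed

text \<open>Blow-up: when all fibres of \<open>f\<close> have \<open>m\<close> elements, the fibre averages of the
  indicator functions of two sets are weights in the unit interval.\<close>

lemma cut_bounded_blowup:
  assumes fin: "finite V" "finite V'" and f: "f \<in> V' \<rightarrow> V" and m: "m > 0"
    and fib: "\<And>v. v \<in> V \<Longrightarrow> card {i\<in>V'. f i = v} \<le> m"
    and cb: "cut_bounded V V B \<eta>"
  shows "cut_bounded V' V' (\<lambda>i j. B (f i) (f j)) (real m ^ 2 * \<eta>)"
  unfolding cut_bounded_def
proof (intro allI impI)
  fix S T assume ST: "S \<subseteq> V'" "T \<subseteq> V'"
  have fST: "finite S" "finite T" using ST fin finite_subset by auto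
  define w where "w S v = card {i\<in>S. f i = v} / m" for S v
  have w: "w S v \<in> {0..1}" if "v \<in> V" "S \<subseteq> V'" for S v
  proof -
    have "card {i\<in>S. f i = v} \<le> card {i\<in>V'. f i = v}"
      using that fin by (intro card_mono) auto
    with fib[OF that(1)] m show ?thesis by (auto simp: w_def)
  qed
  have group: "(\<Sum>i\<in>S. g (f i)) = m * (\<Sum>v\<in>V. w S v * g v)" if "S \<subseteq> V'" for S and g :: "_ \<Rightarrow> real"
  proof -
    have "finite S" using that fin finite_subset by auto
    then have "(\<Sum>i\<in>S. g (f i)) = (\<Sum>v\<in>V. \<Sum>i\<in>{i\<in>S. f i = v}. g (f i))"
      using that fin f by (intro sum.group[symmetric]) auto
    also have "\<dots> = (\<Sum>v\<in>V. card {i\<in>S. f i = v} * g v)"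
      by (intro sum.cong refl) simp
    finally show ?thesis using m by (simp add: w_def sum_distrib_left)
  qed
  have "(\<Sum>i\<in>S. \<Sum>j\<in>T. B (f i) (f j)) = m * (\<Sum>v\<in>V. w S v * (m * (\<Sum>u\<in>V. w T u * B v u)))"
    using group[OF ST(1)] group[OF ST(2)] by simp
  also have "\<dots> = real m ^ 2 * (\<Sum>v\<in>V. \<Sum>u\<in>V. w S v * w T u * B v u)"
    by (simp add: sum_distrib_left power2_eq_square mult_ac)
  finally have "\<bar>\<Sum>i\<in>S. \<Sum>j\<in>T. B (f i) (f j)\<bar> = real m ^ 2 * \<bar>\<Sum>v\<in>V. \<Sum>u\<in>V. w S v * w T u * B v u\<bar>"
    by (simp add: abs_mult)
  also have "\<dots> \<le> real m ^ 2 * \<eta>"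
    using w ST by (intro mult_left_mono cut_bounded_weighted[OF fin(1,1) cb]) auto
  finally show "\<bar>\<Sum>i\<in>S. \<Sum>j\<in>T. B (f i) (f j)\<bar> \<le> real m ^ 2 * \<eta>" .
qed

section \<open>Weak regularity\<close>

text \<open>Frieze--Kannan energy decrement: subtracting \<open>\<plusminus>\<epsilon>\<close> on a violating rectangle decreases the
  energy \<open>\<Sum>U\<^sup>2\<close> by at least \<open>\<epsilon>\<^sup>2 N\<^sup>2\<close>. After \<open>r\<close> steps the subtracted function depends only on a
  type with \<open>4^r\<close> values.\<close>

lemma energy_decrement:
  fixes U :: "nat \<Rightarrow> nat \<Rightarrow> real"
  assumes ST: "S \<subseteq> {..<N}" "T \<subseteq> {..<N}" and viol: "\<bar>\<Sum>i\<in>S. \<Sum>j\<in>T. U i j\<bar> > e * real N ^ 2" and e: "e \<ge> 0"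
  obtains c where "\<bar>c\<bar> = e"
    "(\<Sum>i<N. \<Sum>j<N. (U i j - (if i \<in> S \<and> j \<in> T then c else 0))\<^sup>2) \<le> (\<Sum>i<N. \<Sum>j<N. (U i j)\<^sup>2) - e^2 * real N ^ 2"
proof -
  define a where "a = (\<Sum>i\<in>S. \<Sum>j\<in>T. U i j)"
  define c where "c = (if a \<ge> 0 then e else - e)"
  have c: "c * a = e * \<bar>a\<bar>" "c^2 = e^2" "\<bar>c\<bar> = e" using e by (auto simp: c_def)
  have fin: "finite S" "finite T" using ST finite_subset by auto
  have ind: "(\<Sum>i<N. \<Sum>j<N. if i \<in> S \<and> j \<in> T then g i j else 0) = (\<Sum>i\<in>S. \<Sum>j\<in>T. g i j)"
    for g :: "nat \<Rightarrow> nat \<Rightarrow> real"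
  proof -
    have "(\<Sum>i<N. \<Sum>j<N. if i \<in> S \<and> j \<in> T then g i j else 0)
        = (\<Sum>i<N. if i \<in> S then (\<Sum>j<N. if j \<in> T then g i j else 0) else 0)"
      by (intro sum.cong refl) auto
    also have "\<dots> = (\<Sum>i\<in>{..<N} \<inter> S. \<Sum>j\<in>{..<N} \<inter> T. g i j)"
      by (simp add: sum.inter_restrict)
    also have "\<dots> = (\<Sum>i\<in>S. \<Sum>j\<in>T. g i j)"
      using ST by (simp add: Int_absorb1)
    finally show ?thesis .
  qed
  have "(\<Sum>i<N. \<Sum>j<N. (U i j - (if i \<in> S \<and> j \<in> T then c else 0))\<^sup>2)
      = (\<Sum>i<N. \<Sum>j<N. (U i j)\<^sup>2 + (if i \<in> S \<and> j \<in> T then c^2 - 2 * c * U i j else 0))"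
    by (intro sum.cong refl) (auto simp: power2_diff)
  also have "\<dots> = (\<Sum>i<N. \<Sum>j<N. (U i j)\<^sup>2) + (\<Sum>i\<in>S. \<Sum>j\<in>T. c^2 - 2 * c * U i j)"
    by (simp add: sum.distrib ind)
  also have "(\<Sum>i\<in>S. \<Sum>j\<in>T. c^2 - 2 * c * U i j) = card S * card T * c^2 - 2 * (c * a)"
    by (simp add: a_def sum_subtractf sum_distrib_left mult_ac)
  also have "\<dots> \<le> e^2 * real N ^ 2 - 2 * (e * (e * real N ^ 2))"
  proof -
    have "card S * card T \<le> N * N"
      using card_mono[OF _ ST(1)] card_mono[OF _ ST(2)] by (intro mult_mono) auto
    then have "real (card S * card T) * e^2 \<le> real (N * N) * e^2"
      by (intro mult_right_mono) (auto simp del: of_nat_mult)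
    moreover have "e * (e * real N ^ 2) \<le> e * \<bar>a\<bar>"
      using viol e unfolding a_def by (intro mult_left_mono) auto
    ultimately show ?thesis unfolding c by (simp add: power2_eq_square mult_ac)
  qed
  finally show thesis using c(3) that[of c] by (simp add: power2_eq_square algebra_simps)
qed

text \<open>The last disjunction lets the induction stop early: \<open>s\<close> counts the steps
  really taken, and a remainder that is already cut bounded is passed on unchanged. A further step
  is made only when \<open>s = r\<close>.\<close>

lemma weak_regularity_steps:
  fixes A :: "nat \<Rightarrow> nat \<Rightarrow> real" and e :: real
  assumes A: "\<forall>i<N. \<forall>j<N. A i j \<in> {0..1}" and e: "e > 0"
  shows "\<exists>(\<tau> :: nat \<Rightarrow> nat) K s. s \<le> r \<and> (\<forall>i. \<tau> i < 4 ^ s) \<and> (\<forall>i j. \<bar>K i j\<bar> \<le> s * e) \<and>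
    (\<Sum>i<N. \<Sum>j<N. (A i j - K (\<tau> i) (\<tau> j))\<^sup>2) \<le> real N ^ 2 * (1 - s * e^2) \<and>
    (s = r \<or> cut_bounded {..<N} {..<N} (\<lambda>i j. A i j - K (\<tau> i) (\<tau> j)) (e * real N ^ 2))"
proof (induction r)
  case 0
  have "(\<Sum>i<N. \<Sum>j<N. (A i j)\<^sup>2) \<le> (\<Sum>i<N. \<Sum>j<N. 1)"
    using A by (intro sum_mono) (auto simp: power_le_one)
  then show ?case by (intro exI[of _ "\<lambda>_. 0"] exI[of _ "\<lambda>_ _. 0"] exI[of _ 0])
      (auto simp: power2_eq_square)
next
  case (Suc r)
  from Suc.IH obtain \<tau> :: "nat \<Rightarrow> nat" and K s where
    s: "s \<le> r" and \<tau>: "\<forall>i. \<tau> i < 4 ^ s" and K: "\<forall>i j. \<bar>K i j\<bar> \<le> s * e"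
    and en: "(\<Sum>i<N. \<Sum>j<N. (A i j - K (\<tau> i) (\<tau> j))\<^sup>2) \<le> real N ^ 2 * (1 - s * e^2)"
    and or: "s = r \<or> cut_bounded {..<N} {..<N} (\<lambda>i j. A i j - K (\<tau> i) (\<tau> j)) (e * real N ^ 2)"
    by (elim exE conjE) (rule that)
  show ?case
  proof (cases "cut_bounded {..<N} {..<N} (\<lambda>i j. A i j - K (\<tau> i) (\<tau> j)) (e * real N ^ 2)")
    case True
    with s \<tau> K en show ?thesis by (intro exI[of _ \<tau>] exI[of _ K] exI[of _ s]) auto
  next
    case False
    with or have "s = r" by simp
    from False obtain S T where ST: "S \<subseteq> {..<N}" "T \<subseteq> {..<N}"
      and viol: "\<bar>\<Sum>i\<in>S. \<Sum>j\<in>T. A i j - K (\<tau> i) (\<tau> j)\<bar> > e * real N ^ 2"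
      unfolding cut_bounded_def not_all not_imp not_le by (elim exE conjE) (rule that)
    obtain c where c: "\<bar>c\<bar> = e" and
      dec: "(\<Sum>i<N. \<Sum>j<N. (A i j - K (\<tau> i) (\<tau> j) - (if i \<in> S \<and> j \<in> T then c else 0))\<^sup>2)
        \<le> (\<Sum>i<N. \<Sum>j<N. (A i j - K (\<tau> i) (\<tau> j))\<^sup>2) - e^2 * real N ^ 2"
      using energy_decrement[OF ST viol] e by auto
    \<comment> \<open>Types are written in base 4. The new last digit records membership in
      \<open>S\<close> (value 2) and in \<open>T\<close> (value 1), so division by 4 recovers the
      old type and the digits tell where the correction \<open>c\<close> applies.\<close>
    define \<tau>' where "\<tau>' i = 4 * \<tau> i + (if i \<in> S then 2 else 0) + (if i \<in> T then 1 else 0)" for i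
    define K' where "K' a b = K (a div 4) (b div 4) + (if a mod 4 \<ge> 2 \<and> odd b then c else 0)" for a b
    have div: "\<tau>' i div 4 = \<tau> i" for i by (auto simp: \<tau>'_def)
    have mod2: "\<tau>' i mod 4 \<ge> 2 \<longleftrightarrow> i \<in> S" for i
      unfolding \<tau>'_def by (cases "i \<in> S"; cases "i \<in> T"; simp; presburger)
    have odd: "odd (\<tau>' i) \<longleftrightarrow> i \<in> T" for i by (simp add: \<tau>'_def)
    have K'\<tau>': "K' (\<tau>' i) (\<tau>' j) = K (\<tau> i) (\<tau> j) + (if i \<in> S \<and> j \<in> T then c else 0)" for i j
      unfolding K'_def div mod2 odd by simp
    show ?thesis
    proof (intro exI[of _ \<tau>'] exI[of _ K'] exI[of _ "Suc r"] conjI allI)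
      show "\<tau>' i < 4 ^ Suc r" for i using \<tau>[rule_format, of i] \<open>s = r\<close> by (auto simp: \<tau>'_def)
      show "\<bar>K' i j\<bar> \<le> real (Suc r) * e" for i j
      proof -
        have "\<bar>K' i j\<bar> \<le> \<bar>K (i div 4) (j div 4)\<bar> + \<bar>c\<bar>"
          unfolding K'_def by auto
        with K[rule_format, of "i div 4" "j div 4"] c \<open>s = r\<close> show ?thesis
          by (simp add: algebra_simps)
      qed
      show "(\<Sum>i<N. \<Sum>j<N. (A i j - K' (\<tau>' i) (\<tau>' j))\<^sup>2) \<le> real N ^ 2 * (1 - real (Suc r) * e\<^sup>2)"
        using dec en \<open>s = r\<close> unfolding K'\<tau>' by (simp add: algebra_simps)
    qed simp_all
  qed
qed

text \<open>The energy is at most N^2 at the start, loses e^2 N^2 per step and stays nonnegative, so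
  fewer than \<open>r\<close> steps are made and the remainder is cut bounded. The energy bound is
  kept as a conclusion because it controls the mean square of the remainder, whose pointwise bound
  grows with \<open>r\<close>.\<close>

lemma weak_regularity:
  fixes A :: "nat \<Rightarrow> nat \<Rightarrow> real" and e :: real
  assumes A: "\<forall>i<N. \<forall>j<N. A i j \<in> {0..1}" and e: "e > 0" and N: "N > 0"
    and r: "r * e^2 > 1"
  obtains \<tau> :: "nat \<Rightarrow> nat" and K where
    "\<And>i. \<tau> i < 4 ^ r" "\<And>i j. \<bar>K i j\<bar> \<le> r * e"
    "(\<Sum>i<N. \<Sum>j<N. (A i j - K (\<tau> i) (\<tau> j))\<^sup>2) \<le> real N ^ 2"
    "cut_bounded {..<N} {..<N} (\<lambda>i j. A i j - K (\<tau> i) (\<tau> j)) (e * real N ^ 2)"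
proof -
  obtain \<tau> :: "nat \<Rightarrow> nat" and K s where
    s: "s \<le> r" and \<tau>: "\<forall>i. \<tau> i < 4 ^ s" and K: "\<forall>i j. \<bar>K i j\<bar> \<le> s * e"
    and en: "(\<Sum>i<N. \<Sum>j<N. (A i j - K (\<tau> i) (\<tau> j))\<^sup>2) \<le> real N ^ 2 * (1 - s * e^2)"
    and or: "s = r \<or> cut_bounded {..<N} {..<N} (\<lambda>i j. A i j - K (\<tau> i) (\<tau> j)) (e * real N ^ 2)"
    using weak_regularity_steps[OF A e, of r] by (elim exE conjE) (rule that)
  have "0 \<le> real N ^ 2 * (1 - s * e^2)"
    by (rule order_trans[OF _ en]) (intro sum_nonneg, simp)
  then have "s * e^2 \<le> 1" using N by (simp add: zero_le_mult_iff)
  with r or have cb: "cut_bounded {..<N} {..<N} (\<lambda>i j. A i j - K (\<tau> i) (\<tau> j)) (e * real N ^ 2)" by auto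
  show thesis
  proof (rule that[of \<tau> K])
    show "\<tau> i < 4 ^ r" for i
      using power_increasing[OF s, of "4::nat"] \<tau>[rule_format, of i] by linarith
    show "\<bar>K i j\<bar> \<le> r * e" for i j
    proof -
      have "s * e \<le> r * e" using s e by (intro mult_right_mono) auto
      with K[rule_format, of i j] show ?thesis by linarith
    qed
    show "(\<Sum>i<N. \<Sum>j<N. (A i j - K (\<tau> i) (\<tau> j))\<^sup>2) \<le> real N ^ 2"
    proof (rule order_trans[OF en])
      have "real N ^ 2 * (1 - s * e^2) \<le> real N ^ 2 * 1"
        by (intro mult_left_mono) auto
      then show "real N ^ 2 * (1 - s * e^2) \<le> real N ^ 2" by simp
    qed
  qed (rule cb)
qed

section \<open>The first sampling lemma\<close>

lemma expectation_pmf_of_set: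
  "finite A \<Longrightarrow> A \<noteq> {} \<Longrightarrow> E (pmf_of_set A) f = (\<Sum>x\<in>A. f x) / card A"
  by (rule integral_pmf_of_set)

text \<open>The conditional expectation of one term \<open>U (X v) (X w)\<close>, counted only if
  \<open>X v \<in> S\<close>, when \<open>X v\<close> is uniform on \<open>G\<close> and
  \<open>X w = l\<close>.\<close>

definition row_mean :: "'g set \<Rightarrow> ('g \<Rightarrow> 'g \<Rightarrow> real) \<Rightarrow> 'g set \<Rightarrow> 'g \<Rightarrow> real" where
  "row_mean G U S l = E (pmf_of_set G) (\<lambda>j. if j \<in> S then U j l else 0)"

text \<open>The first term measures how far the column sums over the sampled rows in
  \<open>S\<close> are from their conditional means, the second how far the average positive part of
  these means is from its expectation. Positive parts enter because the worst column set consists of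
  the columns with positive sum.\<close>

definition sampling_error ::
  "'v set \<Rightarrow> 'g set \<Rightarrow> ('g \<Rightarrow> 'g \<Rightarrow> real) \<Rightarrow> 'g set \<Rightarrow> ('v \<Rightarrow> 'g) \<Rightarrow> real" where
  "sampling_error V G U S X =
     (\<Sum>w\<in>V. \<bar>\<Sum>v\<in>V. (if X v \<in> S then U (X v) (X w) else 0) - row_mean G U S (X w)\<bar>) / real (card V) ^ 2 +
     \<bar>\<Sum>w\<in>V. max 0 (row_mean G U S (X w)) - E (pmf_of_set G) (\<lambda>l. max 0 (row_mean G U S l))\<bar> / card V"

lemma sampling_error_nonneg: "0 \<le> sampling_error V G U S X"
  unfolding sampling_error_def by (intro add_nonneg_nonneg divide_nonneg_nonneg sum_nonneg) auto

text \<open>Each column is bounded by its deviation plus the positive part of its mean, both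
  nonnegative, so the columns outside \<open>T\<close> can be added. The resulting bound is free of
  \<open>T\<close>, and no union bound over column sets occurs.\<close>

lemma sampled_sum_le:
  assumes V: "finite V" "V \<noteq> {}" and T: "T \<subseteq> V"
  shows "(\<Sum>w\<in>T. \<Sum>v\<in>V. if X v \<in> S then U (X v) (X w) else 0)
    \<le> real (card V) ^ 2 * (sampling_error V G U S X + E (pmf_of_set G) (\<lambda>l. max 0 (row_mean G U S l)))"
proof -
  let ?n = "real (card V)"
  let ?r = "\<lambda>w. row_mean G U S (X w)"
  let ?m = "E (pmf_of_set G) (\<lambda>l. max 0 (row_mean G U S l))"
  have n: "?n > 0" using V by (simp add: card_gt_0_iff)
  let ?d = "\<lambda>w. \<bar>\<Sum>v\<in>V. (if X v \<in> S then U (X v) (X w) else 0) - ?r w\<bar>"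
  let ?D1 = "\<Sum>w\<in>V. ?d w" and ?D2 = "\<bar>\<Sum>w\<in>V. max 0 (?r w) - ?m\<bar>"
  have "(\<Sum>w\<in>T. \<Sum>v\<in>V. if X v \<in> S then U (X v) (X w) else 0) \<le> (\<Sum>w\<in>T. ?d w + ?n * max 0 (?r w))"
  proof (intro sum_mono)
    fix w assume "w \<in> T"
    have "(\<Sum>v\<in>V. if X v \<in> S then U (X v) (X w) else 0)
        = (\<Sum>v\<in>V. (if X v \<in> S then U (X v) (X w) else 0) - ?r w) + ?n * ?r w"
      by (simp add: sum_subtractf)
    also have "\<dots> \<le> ?d w + ?n * max 0 (?r w)"
      by (intro add_mono mult_left_mono) auto
    finally show "(\<Sum>v\<in>V. if X v \<in> S then U (X v) (X w) else 0) \<le> ?d w + ?n * max 0 (?r w)" .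
  qed
  also have "\<dots> \<le> (\<Sum>w\<in>V. ?d w + ?n * max 0 (?r w))"
    using V T by (intro sum_mono2) auto
  also have "\<dots> = ?D1 + ?n * ((\<Sum>w\<in>V. max 0 (?r w) - ?m) + ?n * ?m)"
    by (simp add: sum.distrib sum_distrib_left[symmetric] sum_subtractf)
  also have "\<dots> \<le> ?D1 + ?n * (?D2 + ?n * ?m)"
    using n by (intro add_left_mono mult_left_mono add_right_mono) auto
  also have "\<dots> = ?n ^ 2 * (sampling_error V G U S X + ?m)"
    using n unfolding sampling_error_def by (simp add: field_simps power2_eq_square)
  finally show ?thesis .
qed

lemma abs_row_mean_le:
  assumes G: "finite G" "G \<noteq> {}" and U: "\<forall>j\<in>G. \<bar>U j l\<bar> \<le> M" and M: "0 \<le> M"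
  shows "\<bar>row_mean G U S l\<bar> \<le> M"
proof -
  have "\<bar>\<Sum>j\<in>G. if j \<in> S then U j l else 0\<bar> \<le> (\<Sum>j\<in>G. M)"
    using U M by (intro order_trans[OF sum_abs] sum_mono) auto
  also have "\<dots> = card G * M" by simp
  finally show ?thesis
    using G by (simp add: row_mean_def expectation_pmf_of_set abs_divide field_simps card_gt_0_iff)
qed

text \<open>\<open>S\<close> may depend on the sample, but not through the coordinates in
  \<open>V - Z\<close>. With the others frozen, the column sums and the average positive part are
  sums of centred terms indexed by the free coordinates, and the weak law applies to both.\<close>

lemma expectation_sampling_error:
  fixes S :: "('v \<Rightarrow> 'g) \<Rightarrow> 'g set"
  assumes V: "finite V" "V \<noteq> {}" and G: "finite G" "G \<noteq> {}"
    and U: "\<forall>i\<in>G. \<forall>j\<in>G. \<bar>U i j\<bar> \<le> M" and M: "0 \<le> M"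
    and Z: "Z \<subseteq> V" and S: "\<And>v X y. v \<in> V - Z \<Longrightarrow> S (X(v := y)) = S X"
  shows "E (Pi_pmf V d (\<lambda>_. pmf_of_set G)) (\<lambda>X. sampling_error V G U (S X) X)
    \<le> 4 * M * (sqrt (card V) + card Z + 1) / card V"
proof -
  let ?P = "Pi_pmf V d (\<lambda>_. pmf_of_set G)"
  let ?n = "real (card V)"
  have n: "?n > 0" using V by (simp add: card_gt_0_iff)
  have fin: "\<forall>i\<in>V. finite (set_pmf (pmf_of_set G))" using G by simp
  have fP: "finite (set_pmf ?P)" using V fin by (intro finite_set_Pi_pmf)
  have int: "integrable ?P f" for f :: "_ \<Rightarrow> real" by (rule integrable_measure_pmf_finite[OF fP])
  have intG: "integrable (pmf_of_set G) f" for f :: "_ \<Rightarrow> real"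
    using G by (intro integrable_measure_pmf_finite) simp
  have inG: "X v \<in> G" if "X \<in> set_pmf ?P" "v \<in> V" for X v
    using that V G by (auto simp: set_Pi_pmf PiE_dflt_def)
  have rm: "\<bar>row_mean G U S' (X w)\<bar> \<le> M" if "X \<in> set_pmf ?P" "w \<in> V" for X w S'
    using U M inG[OF that] by (intro abs_row_mean_le[OF G]) auto
  have fZ: "finite Z" using Z V finite_subset by auto
  define c where "c S' = E (pmf_of_set G) (\<lambda>l. max 0 (row_mean G U S' l))" for S'
  have c: "0 \<le> c S'" "c S' \<le> M" for S'
  proof -
    show "0 \<le> c S'" unfolding c_def by (rule Bochner_Integration.integral_nonneg) simp
    have "c S' \<le> E (pmf_of_set G) (\<lambda>_. M)"
      unfolding c_def using U M G abs_row_mean_le[OF G, of U _ M S']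
      by (intro expectation_mono_pmf) force+
    then show "c S' \<le> M" by simp
  qed
  \<comment> \<open>The column index \<open>w\<close> joins \<open>Z\<close>: the term with
    \<open>v = w\<close> contains \<open>X w\<close> twice, and resampling \<open>X w\<close> would
    change every term of the column.\<close>
  have 1: "E ?P (\<lambda>X. \<bar>\<Sum>v\<in>V. (if X v \<in> S X then U (X v) (X w) else 0) - row_mean G U (S X) (X w)\<bar>)
      \<le> 2 * M * (sqrt (card V) + card (insert w Z))" if w: "w \<in> V" for w
  proof (rule weak_law_orthogonal[OF V(1) fin V(1), where \<kappa> = "\<lambda>v. v"])
    fix v X assume v: "v \<in> V" and X: "X \<in> set_pmf ?P"
    have "\<bar>U (X v) (X w)\<bar> \<le> M" using U inG[OF X v] inG[OF X w] by auto
    with rm[OF X w, of "S X"] show "\<bar>(if X v \<in> S X then U (X v) (X w) else 0) - row_mean G U (S X) (X w)\<bar> \<le> 2 * M"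
      using M by auto
  next
    fix v X assume v: "v \<in> V - insert w Z" and X: "X \<in> set_pmf ?P"
    then have v': "v \<in> V - Z" "v \<noteq> w" by auto
    have "E (pmf_of_set G) (\<lambda>y. (if (X(v := y)) v \<in> S (X(v := y)) then U ((X(v := y)) v) ((X(v := y)) w) else 0)
        - row_mean G U (S (X(v := y))) ((X(v := y)) w))
      = E (pmf_of_set G) (\<lambda>y. (if y \<in> S X then U y (X w) else 0) - row_mean G U (S X) (X w))"
      using v' by (simp add: S[OF v'(1)] cong: if_cong)
    also have "\<dots> = 0"
      unfolding row_mean_def by (subst Bochner_Integration.integral_diff) (simp_all add: intG)
    finally show "E (pmf_of_set G) (\<lambda>y. (if (X(v := y)) v \<in> S (X(v := y)) then U ((X(v := y)) v) ((X(v := y)) w) else 0)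
        - row_mean G U (S (X(v := y))) ((X(v := y)) w)) = 0" .
  next
    fix i j X y assume "i \<in> V - insert w Z" "j \<in> V - insert w Z" "i \<noteq> j"
    then show "(if (X(j := y)) i \<in> S (X(j := y)) then U ((X(j := y)) i) ((X(j := y)) w) else 0)
        - row_mean G U (S (X(j := y))) ((X(j := y)) w)
      = (if X i \<in> S X then U (X i) (X w) else 0) - row_mean G U (S X) (X w)"
      by (auto simp: S)
  qed (use w Z M in auto)
  have 2: "E ?P (\<lambda>X. \<bar>\<Sum>w\<in>V. max 0 (row_mean G U (S X) (X w)) - c (S X)\<bar>) \<le> 2 * M * (sqrt (card V) + card Z)"
  proof (rule weak_law_orthogonal[OF V(1) fin V(1), where \<kappa> = "\<lambda>v. v"])
    fix w X assume w: "w \<in> V" and X: "X \<in> set_pmf ?P"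
    show "\<bar>max 0 (row_mean G U (S X) (X w)) - c (S X)\<bar> \<le> 2 * M"
      using rm[OF X w, of "S X"] c[of "S X"] by (auto simp: max_def)
  next
    fix v X assume v: "v \<in> V - Z" and X: "X \<in> set_pmf ?P"
    have "E (pmf_of_set G) (\<lambda>y. max 0 (row_mean G U (S (X(v := y))) ((X(v := y)) v)) - c (S (X(v := y))))
      = E (pmf_of_set G) (\<lambda>y. max 0 (row_mean G U (S X) y) - c (S X))"
      using v by (simp add: S)
    also have "\<dots> = 0"
      unfolding c_def by (subst Bochner_Integration.integral_diff) (simp_all add: intG)
    finally show "E (pmf_of_set G) (\<lambda>y. max 0 (row_mean G U (S (X(v := y))) ((X(v := y)) v)) - c (S (X(v := y)))) = 0" .
  next
    fix i j X y assume "i \<in> V - Z" "j \<in> V - Z" "i \<noteq> j"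
    then show "max 0 (row_mean G U (S (X(j := y))) ((X(j := y)) i)) - c (S (X(j := y)))
      = max 0 (row_mean G U (S X) (X i)) - c (S X)"
      by (auto simp: S)
  qed (use Z M in auto)
  have "E ?P (\<lambda>X. sampling_error V G U (S X) X)
      = (\<Sum>w\<in>V. E ?P (\<lambda>X. \<bar>\<Sum>v\<in>V. (if X v \<in> S X then U (X v) (X w) else 0) - row_mean G U (S X) (X w)\<bar>)) / ?n ^ 2
        + E ?P (\<lambda>X. \<bar>\<Sum>w\<in>V. max 0 (row_mean G U (S X) (X w)) - c (S X)\<bar>) / ?n"
    unfolding sampling_error_def c_def[symmetric] by (simp add: int)
  also have "\<dots> \<le> (\<Sum>w\<in>V. 2 * M * (sqrt ?n + (real (card Z) + 1))) / ?n ^ 2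
      + 2 * M * (sqrt ?n + (real (card Z) + 1)) / ?n"
  proof -
    have "E ?P (\<lambda>X. \<bar>\<Sum>v\<in>V. (if X v \<in> S X then U (X v) (X w) else 0) - row_mean G U (S X) (X w)\<bar>)
        \<le> 2 * M * (sqrt ?n + (real (card Z) + 1))" if w: "w \<in> V" for w
    proof -
      have "real (card (insert w Z)) \<le> real (card Z) + 1"
        using fZ by (simp add: card_insert_if)
      then have "2 * M * (sqrt ?n + card (insert w Z)) \<le> 2 * M * (sqrt ?n + (real (card Z) + 1))"
        using M by (intro mult_left_mono) auto
      with 1[OF w] show ?thesis by linarith
    qed
    moreover have "2 * M * (sqrt ?n + card Z) \<le> 2 * M * (sqrt ?n + (real (card Z) + 1))"
      using M by (intro mult_left_mono) auto
    with 2 have "E ?P (\<lambda>X. \<bar>\<Sum>w\<in>V. max 0 (row_mean G U (S X) (X w)) - c (S X)\<bar>)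
        \<le> 2 * M * (sqrt ?n + (real (card Z) + 1))"
      by linarith
    ultimately show ?thesis
      using n by (intro add_mono divide_right_mono sum_mono) simp_all
  qed
  also have "\<dots> = 4 * M * (sqrt ?n + card Z + 1) / ?n"
    using n by (simp add: power2_eq_square field_simps)
  finally show ?thesis by simp
qed

text \<open>A set of points of \<open>G\<close> rather than of sample indices. It is determined by
  the values of \<open>X\<close> at the probed indices \<open>h a\<close> alone, and can be held
  fixed while the other sample points are averaged.\<close>

definition probe_set :: "('g \<Rightarrow> 'g \<Rightarrow> real) \<Rightarrow> ('v \<Rightarrow> 'g) \<Rightarrow> (nat \<Rightarrow> 'v) \<Rightarrow> nat set \<Rightarrow> 'g set" where
  "probe_set U X h R = {j. (\<Sum>a\<in>R. U j (X (h a))) > 0}"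

definition probe_pmf :: "'v set \<Rightarrow> nat \<Rightarrow> (nat \<Rightarrow> 'v) pmf" where
  "probe_pmf V q = Pi_pmf {..<q} undefined (\<lambda>_. pmf_of_set V)"

lemma finite_probe_pmf: "finite V \<Longrightarrow> V \<noteq> {} \<Longrightarrow> finite (set_pmf (probe_pmf V q))"
  unfolding probe_pmf_def by (intro finite_set_Pi_pmf) auto

lemma probe_pmf_in: "finite V \<Longrightarrow> V \<noteq> {} \<Longrightarrow> h \<in> set_pmf (probe_pmf V q) \<Longrightarrow> a < q \<Longrightarrow> h a \<in> V"
  unfolding probe_pmf_def by (auto simp: set_Pi_pmf PiE_dflt_def)

text \<open>Monte Carlo estimation of a mean from \<open>q\<close> draws with replacement. The error
  is expressed by the mean square of \<open>u\<close> rather than its maximum, since the remainder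
  of the regularity lemma is controlled uniformly in n only in mean square.\<close>

lemma expectation_probe_deviation:
  fixes u :: "'v \<Rightarrow> real"
  assumes V: "finite V" "V \<noteq> {}" and q: "q > 0"
  shows "E (probe_pmf V q) (\<lambda>h. \<bar>(\<Sum>v\<in>V. u v) / card V - (\<Sum>a<q. u (h a)) / q\<bar>)
    \<le> sqrt ((\<Sum>v\<in>V. (u v)\<^sup>2) / card V / q)"
proof -
  let ?P = "probe_pmf V q"
  define m where "m = (\<Sum>v\<in>V. u v) / card V"
  have fin: "\<forall>i\<in>{..<q}. finite (set_pmf (pmf_of_set V))" using V by simp
  have fP: "finite (set_pmf ?P)" using finite_probe_pmf[OF V] .
  have intV: "integrable (pmf_of_set V) f" for f :: "_ \<Rightarrow> real"
    using V by (intro integrable_measure_pmf_finite) simp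
  have mV: "E (pmf_of_set V) u = m" unfolding m_def by (rule expectation_pmf_of_set[OF V])
  have var: "E (pmf_of_set V) (\<lambda>v. (m - u v)\<^sup>2) \<le> (\<Sum>v\<in>V. (u v)\<^sup>2) / card V"
  proof -
    have "E (pmf_of_set V) (\<lambda>v. (m - u v)\<^sup>2) = E (pmf_of_set V) (\<lambda>v. m\<^sup>2 + (u v)\<^sup>2 - 2 * m * u v)"
      by (simp add: power2_diff)
    also have "\<dots> = m\<^sup>2 + E (pmf_of_set V) (\<lambda>v. (u v)\<^sup>2) - 2 * m * m"
      using intV mV by simp
    also have "\<dots> = E (pmf_of_set V) (\<lambda>v. (u v)\<^sup>2) - m\<^sup>2" by (simp add: power2_eq_square)
    also have "\<dots> \<le> E (pmf_of_set V) (\<lambda>v. (u v)\<^sup>2)" by simp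
    finally show ?thesis by (simp add: expectation_pmf_of_set[OF V])
  qed
  have comp: "E ?P (\<lambda>h. f (h a)) = E (pmf_of_set V) f" if "a < q" for a and f :: "_ \<Rightarrow> real"
  proof -
    have "E ?P (\<lambda>h. f (h a)) = E (map_pmf (\<lambda>h. h a) ?P) f" by simp
    also have "map_pmf (\<lambda>h. h a) ?P = pmf_of_set V"
      using that unfolding probe_pmf_def by (subst Pi_pmf_component) auto
    finally show ?thesis .
  qed
  have "E ?P (\<lambda>h. (\<Sum>a<q. m - u (h a))\<^sup>2) = (\<Sum>a<q. E ?P (\<lambda>h. (m - u (h a))\<^sup>2))"
    unfolding probe_pmf_def
  proof (rule expectation_square_sum_orthogonal[OF _ fin, where \<kappa> = "\<lambda>a. a"])
    fix a and x :: "nat \<Rightarrow> 'v"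
    show "E (pmf_of_set V) (\<lambda>y. m - u ((x(a := y)) a)) = 0"
      using intV mV by simp
  qed auto
  also have "\<dots> = q * E (pmf_of_set V) (\<lambda>v. (m - u v)\<^sup>2)"
    by (simp add: comp[where f = "\<lambda>v. (m - u v)\<^sup>2"])
  also have "\<dots> \<le> q * ((\<Sum>v\<in>V. (u v)\<^sup>2) / card V)"
    using var by (intro mult_left_mono) auto
  finally have sq: "E ?P (\<lambda>h. (\<Sum>a<q. m - u (h a))\<^sup>2) \<le> q * ((\<Sum>v\<in>V. (u v)\<^sup>2) / card V)" .
  have "E ?P (\<lambda>h. \<bar>m - (\<Sum>a<q. u (h a)) / q\<bar>) = E ?P (\<lambda>h. \<bar>\<Sum>a<q. m - u (h a)\<bar> / q)"
  proof -
    have "\<bar>m - (\<Sum>a<q. u (h a)) / q\<bar> = \<bar>\<Sum>a<q. m - u (h a)\<bar> / q" for h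
    proof -
      have "m - (\<Sum>a<q. u (h a)) / q = (\<Sum>a<q. m - u (h a)) / q"
        using q by (simp add: sum_subtractf field_simps)
      then show ?thesis by (simp add: abs_divide)
    qed
    then show ?thesis by simp
  qed
  also have "\<dots> = E ?P (\<lambda>h. \<bar>\<Sum>a<q. m - u (h a)\<bar>) / q" by simp
  also have "\<dots> \<le> sqrt (q * ((\<Sum>v\<in>V. (u v)\<^sup>2) / card V)) / q"
    by (intro divide_right_mono order_trans[OF expectation_abs_le_sqrt[OF fP] real_sqrt_le_mono[OF sq]]) simp
  also have "\<dots> = sqrt ((\<Sum>v\<in>V. (u v)\<^sup>2) / card V / q)"
  proof -
    have "(\<Sum>v\<in>V. (u v)\<^sup>2) / card V / q = q * ((\<Sum>v\<in>V. (u v)\<^sup>2) / card V) / real q ^ 2"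
      using q by (simp add: power2_eq_square)
    then show ?thesis by (simp only: real_sqrt_divide) simp
  qed
  finally show ?thesis unfolding m_def .
qed

text \<open>First sampling lemma. Given \<open>T\<close>, the best row set \<open>S\<^sub>0\<close> is almost determined by \<open>q\<close> random
  probes of \<open>T\<close>: it may be replaced by \<open>probe_set\<close>, which depends on \<open>q\<close> sample points only and
  hence is essentially independent of the remaining ones.\<close>

lemma sampled_cut_le:
  assumes V: "finite V" "V \<noteq> {}" and G: "finite G" "G \<noteq> {}" and q: "q > 0"
    and cb: "cut_bounded G G U (e * real (card G) ^ 2)" and ST: "S0 \<subseteq> V" "T \<subseteq> V"
  shows "(\<Sum>v\<in>S0. \<Sum>w\<in>T. U (X v) (X w)) / real (card V) ^ 2
    \<le> e + sqrt ((\<Sum>v\<in>V. \<Sum>w\<in>V. (U (X v) (X w))\<^sup>2) / real (card V) ^ 2 / q)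
      + E (probe_pmf V q) (\<lambda>h. \<Sum>R\<in>Pow {..<q}. sampling_error V G U (probe_set U X h R) X)"
proof -
  let ?P = "probe_pmf V q" and ?n = "real (card V)"
  have n: "?n > 0" using V by (simp add: card_gt_0_iff)
  have fT: "finite T" "finite S0" using ST V finite_subset by auto
  have fP: "finite (set_pmf ?P)" using finite_probe_pmf[OF V] .
  have int: "integrable ?P f" for f :: "_ \<Rightarrow> real" by (rule integrable_measure_pmf_finite[OF fP])
  define u where "u v w = (if w \<in> T then U (X v) (X w) else 0)" for v w
  define m where "m v = (\<Sum>w\<in>V. u v w) / card V" for v
  define b where "b h v = (\<Sum>a<q. u v (h a)) / q" for h v
  have mT: "(\<Sum>w\<in>T. U (X v) (X w)) = ?n * m v" for v
    using V ST n unfolding m_def u_def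
    by (simp add: sum.inter_restrict[symmetric] Int_absorb1)
  \<comment> \<open>Here the cut bound of \<open>U\<close> enters: the sum of the positive row means
    is the sum of \<open>U\<close> over a single rectangle, whose columns \<open>L\<close> are those
    with positive mean.\<close>
  have rowm: "E (pmf_of_set G) (\<lambda>l. max 0 (row_mean G U S l)) \<le> e" for S
  proof -
    let ?N = "real (card G)"
    have N: "?N > 0" using G by (simp add: card_gt_0_iff)
    have rm: "row_mean G U S l = (\<Sum>j\<in>G \<inter> S. U j l) / ?N" for l
      using G by (simp add: row_mean_def expectation_pmf_of_set sum.inter_restrict)
    define L where "L = {l\<in>G. row_mean G U S l > 0}"
    have "E (pmf_of_set G) (\<lambda>l. max 0 (row_mean G U S l)) = (\<Sum>l\<in>L. row_mean G U S l) / ?N"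
    proof -
      have "max 0 x = (if x > 0 then x else 0)" for x :: real by (simp add: max_def)
      then show ?thesis
        unfolding L_def expectation_pmf_of_set[OF G] using G by (simp add: sum.inter_filter)
    qed
    also have "(\<Sum>l\<in>L. row_mean G U S l) = (\<Sum>j\<in>G \<inter> S. \<Sum>l\<in>L. U j l) / ?N"
      unfolding rm sum_divide_distrib[symmetric] by (subst sum.swap) (rule refl)
    also have "(\<Sum>j\<in>G \<inter> S. \<Sum>l\<in>L. U j l) \<le> e * ?N ^ 2"
      using cut_boundedD[OF cb, of "G \<inter> S" L] by (auto simp: L_def)
    finally show ?thesis using N by (simp add: field_simps power2_eq_square divide_right_mono)
  qed
  have main: "(\<Sum>v\<in>S0. \<Sum>w\<in>T. U (X v) (X w)) / ?n ^ 2
      \<le> e + (\<Sum>R\<in>Pow {..<q}. sampling_error V G U (probe_set U X h R) X) + (\<Sum>v\<in>V. \<bar>m v - b h v\<bar>) / ?n" for h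
  proof -
    \<comment> \<open>The probes that happen to lie in \<open>T\<close>. As \<open>T\<close> is
      arbitrary, \<open>R\<close> can be any subset of \<open>{..<q}\<close>, which is why the
      errors are summed over all subsets.\<close>
    define R where "R = {a\<in>{..<q}. h a \<in> T}"
    define S where "S = probe_set U X h R"
    have mem: "X v \<in> S \<longleftrightarrow> b h v > 0" for v
    proof -
      have "(\<Sum>a\<in>R. U (X v) (X (h a))) = (\<Sum>a<q. u v (h a))"
        unfolding R_def u_def by (subst sum.inter_filter) auto
      then show ?thesis using q by (simp add: S_def probe_set_def b_def zero_less_divide_iff)
    qed
    have "(\<Sum>v\<in>S0. \<Sum>w\<in>T. U (X v) (X w)) = (\<Sum>v\<in>S0. ?n * m v)"
      by (simp add: mT)
    also have "\<dots> = ?n * (\<Sum>v\<in>V. if v \<in> S0 then m v else 0)"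
      using V ST by (simp add: sum_distrib_left sum.inter_restrict[symmetric] Int_absorb1)
    \<comment> \<open>Row \<open>v\<close> is now selected by the sign of the estimate
      \<open>b h v\<close>. A wrong decision means that \<open>m v\<close> and \<open>b h v\<close>
      lie on different sides of 0, so it costs at most their distance.\<close>
    also have "\<dots> \<le> ?n * (\<Sum>v\<in>V. (if X v \<in> S then m v else 0) + \<bar>m v - b h v\<bar>)"
      using n by (intro mult_left_mono sum_mono) (auto simp: mem)
    also have "\<dots> = (\<Sum>v\<in>V. \<Sum>w\<in>T. if X v \<in> S then U (X v) (X w) else 0) + ?n * (\<Sum>v\<in>V. \<bar>m v - b h v\<bar>)"
    proof -
      have "(\<Sum>w\<in>T. if X v \<in> S then U (X v) (X w) else 0) = ?n * (if X v \<in> S then m v else 0)" for v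
        by (simp add: mT)
      then show ?thesis by (simp add: sum.distrib distrib_left sum_distrib_left)
    qed
    also have "(\<Sum>v\<in>V. \<Sum>w\<in>T. if X v \<in> S then U (X v) (X w) else 0)
        = (\<Sum>w\<in>T. \<Sum>v\<in>V. if X v \<in> S then U (X v) (X w) else 0)"
      by (rule sum.swap)
    also have "\<dots> \<le> ?n ^ 2 * (sampling_error V G U S X + E (pmf_of_set G) (\<lambda>l. max 0 (row_mean G U S l)))"
      by (rule sampled_sum_le[OF V ST(2)])
    also have "\<dots> \<le> ?n ^ 2 * ((\<Sum>R\<in>Pow {..<q}. sampling_error V G U (probe_set U X h R) X) + e)"
      unfolding S_def
      by (intro mult_left_mono add_mono rowm member_le_sum[where f = "\<lambda>R. sampling_error V G U (probe_set U X h R) X"])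
        (auto simp: R_def sampling_error_nonneg)
    finally have "(\<Sum>v\<in>S0. \<Sum>w\<in>T. U (X v) (X w))
      \<le> ?n ^ 2 * ((\<Sum>R\<in>Pow {..<q}. sampling_error V G U (probe_set U X h R) X) + e)
        + ?n * (\<Sum>v\<in>V. \<bar>m v - b h v\<bar>)" by simp
    with n show ?thesis by (simp add: field_simps power2_eq_square)
  qed
  \<comment> \<open>The left-hand side does not involve the probes, so the estimate may be averaged
    over them.\<close>
  let ?L = "(\<Sum>v\<in>S0. \<Sum>w\<in>T. U (X v) (X w)) / ?n ^ 2"
  have "?L = E ?P (\<lambda>h. ?L)" by simp
  also have "\<dots> \<le> E ?P (\<lambda>h. e + (\<Sum>R\<in>Pow {..<q}. sampling_error V G U (probe_set U X h R) X) + (\<Sum>v\<in>V. \<bar>m v - b h v\<bar>) / ?n)"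
    by (intro expectation_mono_pmf fP main)
  also have "\<dots> = e + E ?P (\<lambda>h. \<Sum>R\<in>Pow {..<q}. sampling_error V G U (probe_set U X h R) X)
      + (\<Sum>v\<in>V. E ?P (\<lambda>h. \<bar>m v - b h v\<bar>)) / ?n"
    using int by simp
  also have "(\<Sum>v\<in>V. E ?P (\<lambda>h. \<bar>m v - b h v\<bar>)) / ?n
      \<le> sqrt ((\<Sum>v\<in>V. \<Sum>w\<in>V. (U (X v) (X w))\<^sup>2) / ?n ^ 2 / q)"
  proof -
    define s where "s v = (\<Sum>w\<in>V. (u v w)\<^sup>2) / ?n / q" for v
    have s0: "s v \<ge> 0" for v unfolding s_def by (intro divide_nonneg_nonneg sum_nonneg) auto
    have "(\<Sum>v\<in>V. E ?P (\<lambda>h. \<bar>m v - b h v\<bar>)) / ?n \<le> (\<Sum>v\<in>V. \<bar>sqrt (s v)\<bar>) / ?n"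
      unfolding m_def b_def s_def
      by (intro divide_right_mono sum_mono order_trans[OF expectation_probe_deviation[OF V q]]) auto
    also have "\<dots> = E (pmf_of_set V) (\<lambda>v. \<bar>sqrt (s v)\<bar>)"
      by (simp add: expectation_pmf_of_set[OF V])
    also have "\<dots> \<le> sqrt (E (pmf_of_set V) (\<lambda>v. (sqrt (s v))\<^sup>2))"
      using V by (intro expectation_abs_le_sqrt) simp
    also have "\<dots> = sqrt ((\<Sum>v\<in>V. s v) / ?n)"
      using s0 by (simp add: expectation_pmf_of_set[OF V])
    also have "\<dots> \<le> sqrt ((\<Sum>v\<in>V. (\<Sum>w\<in>V. (U (X v) (X w))\<^sup>2) / ?n / q) / ?n)"
      unfolding s_def u_def
      by (intro real_sqrt_le_mono divide_right_mono sum_mono) auto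
    also have "\<dots> = sqrt ((\<Sum>v\<in>V. \<Sum>w\<in>V. (U (X v) (X w))\<^sup>2) / ?n ^ 2 / q)"
      by (simp add: sum_divide_distrib[symmetric] power2_eq_square mult_ac)
    finally show ?thesis .
  qed
  finally show ?thesis by simp
qed

section \<open>Matching types by a permutation\<close>

text \<open>Within each type as many indices as possible are matched by a bijection, and the
  leftovers are matched arbitrarily. The leftovers are counted by the excess of
  \<open>\<tau>\<close> over \<open>\<sigma>\<close> in each type.\<close>

lemma type_matching_permutation:
  fixes \<tau> \<sigma> :: "nat \<Rightarrow> 't"
  assumes TT: "finite TT" "\<And>i. i < N \<Longrightarrow> \<tau> i \<in> TT" "\<And>i. i < N \<Longrightarrow> \<sigma> i \<in> TT"
  obtains \<pi> where "bij_betw \<pi> {..<N} {..<N}"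
    "real (card {i\<in>{..<N}. \<tau> i \<noteq> \<sigma> (\<pi> i)})
      \<le> (\<Sum>t\<in>TT. \<bar>real (card {i\<in>{..<N}. \<tau> i = t}) - real (card {i\<in>{..<N}. \<sigma> i = t})\<bar>)"
proof -
  define a where "a t = {i\<in>{..<N}. \<tau> i = t}" for t
  define b where "b t = {i\<in>{..<N}. \<sigma> i = t}" for t
  have fin: "finite (a t)" "finite (b t)" for t by (auto simp: a_def b_def)
  have "\<exists>X Y g. X \<subseteq> a t \<and> Y \<subseteq> b t \<and> bij_betw g X Y \<and> card X = min (card (a t)) (card (b t))" for t
  proof -
    obtain X where X: "X \<subseteq> a t" "card X = min (card (a t)) (card (b t))"
      by (rule obtain_subset_with_card_n[of "min (card (a t)) (card (b t))" "a t"]) auto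
    obtain Y where Y: "Y \<subseteq> b t" "card Y = min (card (a t)) (card (b t))"
      by (rule obtain_subset_with_card_n[of "min (card (a t)) (card (b t))" "b t"]) auto
    have "finite X" "finite Y" using X Y fin finite_subset by blast+
    then obtain g where "bij_betw g X Y"
      using X Y finite_same_card_bij[of X Y] by auto
    with X Y show ?thesis by blast
  qed
  then obtain X Y g where X: "\<And>t. X t \<subseteq> a t" and Y: "\<And>t. Y t \<subseteq> b t"
    and g: "\<And>t. bij_betw (g t) (X t) (Y t)" and c: "\<And>t. card (X t) = min (card (a t)) (card (b t))"
    by metis
  define XX where "XX = (\<Union>t\<in>TT. X t)"
  define YY where "YY = (\<Union>t\<in>TT. Y t)"
  have sub: "XX \<subseteq> {..<N}" "YY \<subseteq> {..<N}"
    using X Y unfolding XX_def YY_def a_def b_def by blast+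
  have "bij_betw (\<lambda>i. g (\<tau> i) i) XX YY"
    unfolding XX_def YY_def
  proof (rule bij_betw_UNION_disjoint)
    show "disjoint_family_on Y TT"
      using Y unfolding disjoint_family_on_def b_def by blast
    show "bij_betw (\<lambda>i. g (\<tau> i) i) (X t) (Y t)" for t
      using g[of t] X[of t] by (subst bij_betw_cong[where g = "g t"]) (auto simp: a_def)
  qed
  moreover from this have card: "card XX = card YY" by (rule bij_betw_same_card)
  obtain h where "bij_betw h ({..<N} - XX) ({..<N} - YY)"
  proof -
    have "card ({..<N} - XX) = card ({..<N} - YY)"
      using sub card finite_subset[of XX "{..<N}"] finite_subset[of YY "{..<N}"]
      by (simp add: card_Diff_subset)
    then show thesis using that finite_same_card_bij[of "{..<N} - XX" "{..<N} - YY"] by auto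
  qed
  ultimately have bij: "bij_betw (\<lambda>i. if i \<in> XX then g (\<tau> i) i else h i) (XX \<union> ({..<N} - XX)) (YY \<union> ({..<N} - YY))"
    by (intro bij_betw_disjoint_Un) auto
  define \<pi> where "\<pi> i = (if i \<in> XX then g (\<tau> i) i else h i)" for i
  have good: "\<tau> i = \<sigma> (\<pi> i)" if "i \<in> XX" for i
  proof -
    from that obtain t where t: "t \<in> TT" "i \<in> X t" by (auto simp: XX_def)
    then have "\<tau> i = t" using X by (auto simp: a_def)
    moreover have "g t i \<in> Y t" using g[of t] t by (auto simp: bij_betw_def)
    then have "\<sigma> (g t i) = t" using Y by (auto simp: b_def)
    ultimately show ?thesis using that by (simp add: \<pi>_def)
  qed
  have disjX: "disjoint_family_on X TT"
    using X unfolding disjoint_family_on_def a_def by blast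
  have cXX: "card XX = (\<Sum>t\<in>TT. card (X t))"
    unfolding XX_def using TT(1) disjX fin X
    by (intro card_UN_disjoint ballI) (auto simp: disjoint_family_on_def intro: finite_subset[OF X])
  have cN: "N = (\<Sum>t\<in>TT. card (a t))"
  proof -
    have "{..<N} = (\<Union>t\<in>TT. a t)" using TT by (auto simp: a_def)
    then have "card {..<N} = card (\<Union>t\<in>TT. a t)" by simp
    also have "\<dots> = (\<Sum>t\<in>TT. card (a t))"
      using TT(1) by (intro card_UN_disjoint) (auto simp: a_def)
    finally show ?thesis by simp
  qed
  have "card {i\<in>{..<N}. \<tau> i \<noteq> \<sigma> (\<pi> i)} \<le> card ({..<N} - XX)"
    using good by (intro card_mono) auto
  moreover have "card ({..<N} - XX) = N - card XX"
    using sub finite_subset[of XX "{..<N}"] by (simp add: card_Diff_subset)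
  moreover have "card XX \<le> N" using card_mono[OF _ sub(1)] by simp
  ultimately have "real (card {i\<in>{..<N}. \<tau> i \<noteq> \<sigma> (\<pi> i)}) \<le> real N - real (card XX)"
    by linarith
  also have "\<dots> = (\<Sum>t\<in>TT. real (card (a t)) - real (card (X t)))"
    unfolding cXX sum_subtractf by (subst cN) simp
  also have "\<dots> \<le> (\<Sum>t\<in>TT. \<bar>real (card (a t)) - real (card (b t))\<bar>)"
    by (intro sum_mono) (auto simp: c)
  finally show thesis
    using that[of \<pi>] bij sub by (simp add: \<pi>_def[abs_def] a_def b_def Un_absorb1 Un_Diff_cancel)
qed

section \<open>Noise matrices with independent entries\<close>

text \<open>Cauchy-Schwarz over the columns turns a rectangle sum into squared column sums, which
  expand into inner products of rows. The hypothesis is free of \<open>S\<close> and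
  \<open>T\<close>, so exponentially many rectangles are treated at once by one second-moment
  quantity.\<close>

lemma cut_bounded_row_products:
  fixes B :: "'v \<Rightarrow> 'v \<Rightarrow> real"
  assumes V: "finite V"
  assumes \<Gamma>: "card V * (\<Sum>v\<in>V. \<Sum>v'\<in>V. \<bar>\<Sum>w\<in>V. B v w * B v' w\<bar>) \<le> \<eta>\<^sup>2" and \<eta>: "0 \<le> \<eta>"
  shows "cut_bounded V V B \<eta>"
  unfolding cut_bounded_def
proof (intro allI impI)
  fix S T assume ST: "S \<subseteq> V" "T \<subseteq> V"
  have fin: "finite S" "finite T" using ST V finite_subset by auto
  have "(\<Sum>v\<in>S. \<Sum>w\<in>T. B v w)\<^sup>2 = (\<Sum>w\<in>T. 1 * (\<Sum>v\<in>S. B v w))\<^sup>2"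
    by (subst sum.swap) simp
  also have "\<dots> \<le> (\<Sum>w\<in>T. 1\<^sup>2) * (\<Sum>w\<in>T. (\<Sum>v\<in>S. B v w)\<^sup>2)"
    by (rule Cauchy_Schwarz_ineq_sum)
  also have "\<dots> \<le> card V * (\<Sum>w\<in>V. (\<Sum>v\<in>S. B v w)\<^sup>2)"
    using V ST by (intro mult_mono sum_mono2) (auto intro!: sum_nonneg card_mono)
  also have "(\<Sum>w\<in>V. (\<Sum>v\<in>S. B v w)\<^sup>2) = (\<Sum>v\<in>S. \<Sum>v'\<in>S. \<Sum>w\<in>V. B v w * B v' w)"
    unfolding power2_eq_square sum_product
    by (subst sum.swap) (intro sum.cong refl sum.swap)
  also have "\<dots> \<le> (\<Sum>v\<in>S. \<Sum>v'\<in>S. \<bar>\<Sum>w\<in>V. B v w * B v' w\<bar>)"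
    by (intro sum_mono) simp
  also have "\<dots> \<le> (\<Sum>v\<in>V. \<Sum>v'\<in>V. \<bar>\<Sum>w\<in>V. B v w * B v' w\<bar>)"
    using V ST by (intro order_trans[OF sum_mono sum_mono2] sum_mono2) (auto intro!: sum_nonneg)
  finally have "(\<Sum>v\<in>S. \<Sum>w\<in>T. B v w)\<^sup>2 \<le> \<eta>\<^sup>2"
    using \<Gamma> by (simp add: mult_left_mono)
  with \<eta> show "\<bar>\<Sum>i\<in>S. \<Sum>j\<in>T. B i j\<bar> \<le> \<eta>"
    by (metis abs_le_square_iff abs_of_nonneg)
qed

text \<open>The index of the single random label shared by the entries \<open>(v, w)\<close> and
  \<open>(w, v)\<close>.\<close>

definition ordered_pair :: "nat \<Rightarrow> nat \<Rightarrow> nat \<times> nat" where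
  "ordered_pair v w = (min v w, max v w)"

lemma ordered_pair_eq_iff: "ordered_pair v w = ordered_pair v' w' \<longleftrightarrow> (v = v' \<and> w = w') \<or> (v = w' \<and> w = v')"
  unfolding ordered_pair_def by (auto simp: min_def max_def split: if_splits)

text \<open>For different rows \<open>v\<close> and \<open>v'\<close> the term of column
  \<open>w\<close> is killed by averaging over the label of the pair \<open>v\<close>,
  \<open>w\<close>, which occurs in no other term. The columns \<open>v\<close> and
  \<open>v'\<close> are exceptional, and the products of a row with itself are bounded by the number
  of columns; these two losses add up to the 3.\<close>

lemma expectation_row_products:
  fixes f :: "nat \<times> nat \<Rightarrow> 'b \<Rightarrow> real"
  assumes A: "finite A" and fin: "\<forall>e\<in>A. finite (set_pmf (p e))"
    and V: "finite V" and AV: "\<And>v w. v \<in> V \<Longrightarrow> w \<in> V \<Longrightarrow> v \<noteq> w \<Longrightarrow> ordered_pair v w \<in> A"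
    and bd: "\<And>e y. e \<in> A \<Longrightarrow> y \<in> set_pmf (p e) \<Longrightarrow> \<bar>f e y\<bar> \<le> 1"
    and mean: "\<And>e. e \<in> A \<Longrightarrow> E (p e) (f e) = 0"
    and B: "\<And>L v w. B L v w = (if v = w then 0 else f (ordered_pair v w) (L (ordered_pair v w)))"
  shows "E (Pi_pmf A d p) (\<lambda>L. \<Sum>v\<in>V. \<Sum>v'\<in>V. \<bar>\<Sum>w\<in>V. B L v w * B L v' w\<bar>)
    \<le> real (card V) ^ 2 * (sqrt (card V) + 3)"
proof -
  let ?P = "Pi_pmf A d p"
  let ?n = "real (card V)"
  have fP: "finite (set_pmf ?P)" by (rule finite_set_Pi_pmf[OF A fin])
  have int: "integrable ?P g" for g :: "_ \<Rightarrow> real" by (rule integrable_measure_pmf_finite[OF fP])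
  have B1: "\<bar>B L v w\<bar> \<le> 1" if "L \<in> set_pmf ?P" "v \<in> V" "w \<in> V" for L v w
  proof (cases "v = w")
    case False
    have "\<forall>e\<in>A. L e \<in> set_pmf (p e)"
      using that(1) A by (auto simp: set_Pi_pmf PiE_dflt_def)
    then show ?thesis using AV[OF that(2,3) False] bd False unfolding B by auto
  qed (simp add: B)
  have prod1: "\<bar>B L v w * B L v' w\<bar> \<le> 1" if "L \<in> set_pmf ?P" "v \<in> V" "w \<in> V" "v' \<in> V" for L v v' w
    using mult_mono[OF B1[OF that(1,2,3)] B1[OF that(1,4,3)]] by (simp add: abs_mult)
  have off: "E ?P (\<lambda>L. \<bar>\<Sum>w\<in>V. B L v w * B L v' w\<bar>) \<le> 1 * (sqrt (card V) + card {v, v'})"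
    if v: "v \<in> V" "v' \<in> V" "v \<noteq> v'" for v v'
  proof (rule weak_law_orthogonal[OF A fin V, where \<kappa> = "ordered_pair v"])
    fix w L assume w: "w \<in> V - {v, v'}" and L: "L \<in> set_pmf ?P"
    let ?e = "ordered_pair v w"
    have e: "?e \<in> A" using AV v w by auto
    have ne: "ordered_pair v' w \<noteq> ?e" using v w by (auto simp: ordered_pair_eq_iff)
    have "E (p ?e) (\<lambda>y. B (L(?e := y)) v w * B (L(?e := y)) v' w)
        = E (p ?e) (\<lambda>y. f ?e y * B L v' w)"
      using w ne unfolding B by (intro Bochner_Integration.integral_cong refl) auto
    also have "\<dots> = 0" using mean[OF e] by simp
    finally show "E (p ?e) (\<lambda>y. B (L(?e := y)) v w * B (L(?e := y)) v' w) = 0" .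
  next
    fix i j L y assume ij: "i \<in> V - {v, v'}" "j \<in> V - {v, v'}" "i \<noteq> j"
    have "ordered_pair v i \<noteq> ordered_pair v j" "ordered_pair v' i \<noteq> ordered_pair v j"
      using ij v by (auto simp: ordered_pair_eq_iff)
    then show "B (L(ordered_pair v j := y)) v i * B (L(ordered_pair v j := y)) v' i = B L v i * B L v' i"
      unfolding B by simp
  qed (use v prod1 AV in auto)
  have each: "E ?P (\<lambda>L. \<bar>\<Sum>w\<in>V. B L v w * B L v' w\<bar>) \<le> sqrt ?n + 2 + (if v = v' then ?n else 0)"
    if v: "v \<in> V" "v' \<in> V" for v v'
  proof (cases "v = v'")
    case True
    have "E ?P (\<lambda>L. \<bar>\<Sum>w\<in>V. B L v w * B L v' w\<bar>) \<le> E ?P (\<lambda>L. ?n)"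
    proof (rule expectation_mono_pmf[OF fP])
      fix L assume L: "L \<in> set_pmf ?P"
      have "\<bar>\<Sum>w\<in>V. B L v w * B L v' w\<bar> \<le> (\<Sum>w\<in>V. 1)"
        using prod1[OF L v(1) _ v(2)] by (intro order_trans[OF sum_abs] sum_mono) auto
      then show "\<bar>\<Sum>w\<in>V. B L v w * B L v' w\<bar> \<le> ?n" by simp
    qed
    moreover have "E ?P (\<lambda>L. ?n) = ?n" by simp
    moreover have "sqrt ?n \<ge> 0" by simp
    ultimately have "E ?P (\<lambda>L. \<bar>\<Sum>w\<in>V. B L v w * B L v' w\<bar>) \<le> sqrt ?n + 2 + ?n" by linarith
    then show ?thesis using True by simp
  next
    case False
    then show ?thesis using off[OF v False] by simp
  qed
  have "E ?P (\<lambda>L. \<Sum>v\<in>V. \<Sum>v'\<in>V. \<bar>\<Sum>w\<in>V. B L v w * B L v' w\<bar>)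
      = (\<Sum>v\<in>V. \<Sum>v'\<in>V. E ?P (\<lambda>L. \<bar>\<Sum>w\<in>V. B L v w * B L v' w\<bar>))"
    using int by simp
  also have "\<dots> \<le> (\<Sum>v\<in>V. \<Sum>v'\<in>V. sqrt ?n + 2 + (if v = v' then ?n else 0))"
    by (intro sum_mono each)
  also have "\<dots> = ?n ^ 2 * (sqrt ?n + 3)"
    using V by (simp add: sum.distrib power2_eq_square algebra_simps)
  finally show ?thesis .
qed

section \<open>Grid approximation of graphons\<close>

text \<open>The \<open>min\<close> puts the right endpoint 1 into the last cell; within the unit
  interval all other cells are half open.\<close>

definition cell :: "nat \<Rightarrow> real \<Rightarrow> nat" where
  "cell N y = min (nat \<lfloor>real N * y\<rfloor>) (N - 1)"

lemma cell_less: "N > 0 \<Longrightarrow> cell N y < N"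
  by (simp add: cell_def)

lemma cell_eq_floor: "0 \<le> y \<Longrightarrow> y < 1 \<Longrightarrow> N > 0 \<Longrightarrow> int (cell N y) = \<lfloor>real N * y\<rfloor>"
proof -
  assume y: "0 \<le> y" "y < 1" "N > 0"
  then have "real N * y < real N" by simp
  then have "\<lfloor>real N * y\<rfloor> < int N" by (simp add: floor_less_iff)
  moreover have "0 \<le> \<lfloor>real N * y\<rfloor>" using y by simp
  ultimately show ?thesis by (simp add: cell_def)
qed

lemma cell_eq_iff: "0 \<le> y \<Longrightarrow> y < 1 \<Longrightarrow> N > 0 \<Longrightarrow> cell N y = j \<longleftrightarrow> real j / N \<le> y \<and> y < (real j + 1) / N"
proof -
  assume y: "0 \<le> y" "y < 1" "N > 0"
  have "cell N y = j \<longleftrightarrow> \<lfloor>real N * y\<rfloor> = int j"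
    using cell_eq_floor[OF y] by linarith
  also have "\<dots> \<longleftrightarrow> real j \<le> real N * y \<and> real N * y < real j + 1"
    by (simp add: floor_eq_iff)
  also have "\<dots> \<longleftrightarrow> real j / N \<le> y \<and> y < (real j + 1) / N"
    using y by (simp add: field_simps)
  finally show ?thesis .
qed

lemma cell_close:
  assumes "0 \<le> y" "y \<le> 1" "N > 0"
  shows "\<bar>y - cell N y / N\<bar> \<le> 1 / N"
proof (cases "y = 1")
  case True
  then have "cell N y = N - 1" by (simp add: cell_def)
  then show ?thesis using True assms by (simp add: of_nat_diff field_simps)
next
  case False
  with assms have "real (cell N y) / N \<le> y \<and> y < (real (cell N y) + 1) / N"
    using cell_eq_iff[of y N "cell N y"] by simp
  then show ?thesis by (simp add: add_divide_distrib abs_le_iff)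
qed

lemma measurable_cell[measurable]: "cell N \<in> borel \<rightarrow>\<^sub>M count_space UNIV"
  unfolding cell_def by measurable

lemma measurable_grid[measurable]:
  "(\<lambda>p. A (cell N (fst p)) (cell N (snd p))) \<in> borel_measurable (borel :: (real \<times> real) measure)"
proof -
  have "(\<lambda>p. A (cell N (fst p)) (cell N (snd p))) \<in> borel_measurable (borel \<Otimes>\<^sub>M borel)"
    by measurable
  then show ?thesis by (simp add: borel_prod)
qed

lemma unit_square_sets[measurable, simp]: "unit_square \<in> sets borel" "unit_square \<in> sets lebesgue"
proof -
  have "unit_square = cbox (0, 0) (1, 1)"
    by (auto simp: unit_square_def cbox_Pair_eq)
  then show "unit_square \<in> sets borel" "unit_square \<in> sets lebesgue"
    by (metis sets_completionI_sets borel_closed closed_cbox sets_lborel)+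
qed

lemma compact_unit_square: "compact unit_square"
  unfolding unit_square_def by (intro compact_Times) auto

lemma emeasure_unit_square: "emeasure lborel unit_square = 1"
proof -
  have "emeasure (lborel \<Otimes>\<^sub>M lborel) ({0..1::real} \<times> {0..1::real}) = 1"
    by (subst lborel.emeasure_pair_measure_Times) auto
  then show ?thesis by (simp add: lborel_prod unit_square_def)
qed

lemma prob_space_unit_square: "prob_space (lebesgue_on unit_square)"
proof
  show "emeasure (lebesgue_on unit_square) (space (lebesgue_on unit_square)) = 1"
    by (simp add: emeasure_restrict_space emeasure_unit_square)
qed

text \<open>A measurable function is an almost everywhere limit of continuous functions, and a
  continuous function on the compact square is uniformly close to its values at grid points. The
  dependence of \<open>N0\<close> on \<open>\<delta>\<close> is uncontrolled; this is harmless
  because the grid size does not appear in the final estimate.\<close>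

lemma grid_approximation:
  fixes W :: "real \<times> real \<Rightarrow> real"
  assumes W: "W \<in> borel_measurable (lebesgue_on unit_square)" and W01: "\<And>p. p \<in> unit_square \<Longrightarrow> W p \<in> {0..1}"
    and \<delta>: "\<delta> > 0"
  obtains N0 where "\<And>N. N \<ge> N0 \<Longrightarrow> N > 0 \<Longrightarrow> \<exists>A :: nat \<Rightarrow> nat \<Rightarrow> real. (\<forall>i j. A i j \<in> {0..1}) \<and>
     measure (lebesgue_on unit_square) {p\<in>unit_square. \<bar>W p - A (cell N (fst p)) (cell N (snd p))\<bar> > \<delta>} \<le> \<delta>"
proof -
  let ?M = "lebesgue_on unit_square"
  interpret prob_space ?M by (rule prob_space_unit_square)
  obtain Z g where Z: "negligible Z" and g: "\<And>n. continuous_on UNIV (g n)"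
    and lim: "\<And>x. x \<notin> Z \<Longrightarrow> (\<lambda>n. g n x) \<longlonglongrightarrow> (if x \<in> unit_square then W x else 0)"
    using iffD2[OF measurable_on_iff_borel_measurable[OF unit_square_sets(2)] W]
    unfolding measurable_on_def by auto
  have g_meas[measurable]: "g n \<in> borel_measurable ?M" for n
    using g[of n] by (intro measurable_restrict_space1 measurable_completion) (simp add: borel_measurable_continuous_onI)
  note W[measurable]
  \<comment> \<open>Truncation at 1 supplies a constant dominating function, and convergence of this
    integral still implies convergence in measure.\<close>
  have "(\<lambda>n. \<integral>p. min 1 \<bar>W p - g n p\<bar> \<partial>?M) \<longlonglongrightarrow> (\<integral>p. 0 \<partial>?M)"
  proof (rule integral_dominated_convergence[where w = "\<lambda>_. 1"])
    have "AE p in ?M. p \<notin> Z"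
    proof (rule AE_I')
      show "Z \<inter> unit_square \<in> null_sets ?M"
        using Z by (auto simp: negligible_iff_null_sets null_sets_restrict_space intro: null_set_Int2)
    qed (auto simp: space_restrict_space)
    moreover have "AE p in ?M. p \<in> unit_square"
      by (rule AE_I2) (simp add: space_restrict_space)
    ultimately show "AE p in ?M. (\<lambda>n. min 1 \<bar>W p - g n p\<bar>) \<longlonglongrightarrow> 0"
    proof eventually_elim
      case (elim p)
      then have "(\<lambda>n. min 1 \<bar>W p - g n p\<bar>) \<longlonglongrightarrow> min 1 \<bar>W p - W p\<bar>"
        using lim[of p] by (intro tendsto_intros) auto
      then show ?case by simp
    qed
  qed (auto intro!: AE_I2)
  then have "(\<lambda>n. \<integral>p. min 1 \<bar>W p - g n p\<bar> \<partial>?M) \<longlonglongrightarrow> 0" by simp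
  \<comment> \<open>Markov's inequality at level \<open>\<gamma>\<close>, with an integral below
    \<open>\<gamma> * \<delta>\<close>, leaves an exceptional set of measure at most
    \<open>\<delta>\<close>. Off it the error is below \<open>\<delta> / 2\<close>; the other half
    is reserved for the discretisation.\<close>
  moreover define \<gamma> where "\<gamma> = min 1 (\<delta> / 2)"
  moreover have \<gamma>: "\<gamma> > 0" "\<gamma> \<le> 1" "\<gamma> \<le> \<delta> / 2" using \<delta> by (auto simp: \<gamma>_def)
  ultimately have "eventually (\<lambda>n. (\<integral>p. min 1 \<bar>W p - g n p\<bar> \<partial>?M) < \<gamma> * \<delta>) sequentially"
    using \<delta> by (intro order_tendstoD(2)) auto
  then obtain n where n: "(\<integral>p. min 1 \<bar>W p - g n p\<bar> \<partial>?M) < \<gamma> * \<delta>"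
    by (auto simp: eventually_sequentially)
  have D: "measure ?M {p\<in>space ?M. min 1 \<bar>W p - g n p\<bar> \<ge> \<gamma>} \<le> (\<integral>p. min 1 \<bar>W p - g n p\<bar> \<partial>?M) / \<gamma>"
    using \<gamma> by (intro integral_Markov_inequality_measure[where A = "{}"] integrable_const_bound[where B = 1]) auto
  \<comment> \<open>Clipping to the unit interval brings \<open>g n\<close> no further from
    \<open>W\<close>, whose values lie there.\<close>
  define c where "c p = max 0 (min 1 (g n p))" for p
  have cc: "continuous_on unit_square c"
    unfolding c_def using g[of n] by (intro continuous_intros continuous_on_subset[OF g]) auto
  then have "uniformly_continuous_on unit_square c"
    using compact_unit_square by (rule compact_uniformly_continuous)
  with \<delta> obtain \<eta> where \<eta>: "\<eta> > 0" "\<And>p q. p \<in> unit_square \<Longrightarrow> q \<in> unit_square \<Longrightarrow> dist p q < \<eta> \<Longrightarrow> dist (c p) (c q) < \<delta> / 2"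
    unfolding uniformly_continuous_on_def by (metis half_gt_zero)
  obtain N0 :: nat where N0: "real N0 > 2 / \<eta>" using reals_Archimedean2 by blast
  show thesis
  proof (rule that[of N0], goal_cases)
    case (1 N)
    define A where "A i j = c (real i / N, real j / N)" for i j :: nat
    have close: "\<bar>c p - A (cell N (fst p)) (cell N (snd p))\<bar> < \<delta> / 2" if p: "p \<in> unit_square" for p
    proof -
      obtain x y where xy: "p = (x, y)" "0 \<le> x" "x \<le> 1" "0 \<le> y" "y \<le> 1"
        using p by (auto simp: unit_square_def)
      have c01: "0 \<le> real (cell N z) / N" "real (cell N z) / N \<le> 1" for z
        using cell_less[OF 1(2), of z] 1 by (auto simp: field_simps)
      have "dist p (real (cell N x) / N, real (cell N y) / N) \<le> dist x (real (cell N x) / N) + dist y (real (cell N y) / N)"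
        unfolding xy dist_prod_def using sqrt_sum_squares_le_sum_abs[of "dist x (real (cell N x) / N)" "dist y (real (cell N y) / N)"] by simp
      also have "\<dots> \<le> 2 / N"
        using cell_close[OF xy(2,3) 1(2)] cell_close[OF xy(4,5) 1(2)] by (simp add: dist_real_def)
      also have "\<dots> < \<eta>"
      proof -
        have "2 / \<eta> < real N" using N0 1 by linarith
        then show ?thesis using \<eta> 1 by (simp add: field_simps)
      qed
      finally have "dist (c p) (c (real (cell N x) / N, real (cell N y) / N)) < \<delta> / 2"
        using p c01 by (intro \<eta>) (auto simp: unit_square_def)
      then show ?thesis by (simp add: A_def xy dist_real_def)
    qed
    have "measure ?M {p\<in>unit_square. \<bar>W p - A (cell N (fst p)) (cell N (snd p))\<bar> > \<delta>}
        \<le> measure ?M {p\<in>space ?M. min 1 \<bar>W p - g n p\<bar> \<ge> \<gamma>}"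
    proof (rule finite_measure_mono)
      show "{p\<in>unit_square. \<bar>W p - A (cell N (fst p)) (cell N (snd p))\<bar> > \<delta>} \<subseteq> {p\<in>space ?M. min 1 \<bar>W p - g n p\<bar> \<ge> \<gamma>}"
      proof safe
        fix p assume p: "p \<in> unit_square" "\<bar>W p - A (cell N (fst p)) (cell N (snd p))\<bar> > \<delta>"
        have "\<bar>W p - c p\<bar> > \<delta> / 2" using close[OF p(1)] p(2) by linarith
        moreover have "\<bar>W p - c p\<bar> \<le> \<bar>W p - g n p\<bar>" using W01[OF p(1)] by (auto simp: c_def)
        ultimately show "min 1 \<bar>W p - g n p\<bar> \<ge> \<gamma>" using \<gamma> by auto
        show "p \<in> space ?M" using p by (simp add: space_restrict_space)
      qed
    qed measurable
    also have "\<dots> \<le> \<delta>"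
      using D n \<gamma> by (smt (verit, best) divide_le_eq mult.commute)
    finally show ?case by (intro exI[of _ A]) (auto simp: A_def c_def)
  qed
qed

section \<open>The sample points\<close>

abbreviation sample_space :: "nat \<Rightarrow> (nat \<Rightarrow> real) measure" where
  "sample_space n \<equiv> \<Pi>\<^sub>M i\<in>{1..n}. lebesgue_on {0..1}"

lemma prob_space_unit_interval: "prob_space (lebesgue_on {0..1::real})"
  by standard (simp add: emeasure_restrict_space)

lemma prob_space_sample_space: "prob_space (sample_space n)"
  by (rule prob_space_PiM) (rule prob_space_unit_interval)

lemma measurable_ident_lebesgue_on: "(\<lambda>y. y) \<in> lebesgue_on S \<rightarrow>\<^sub>M borel"
  by (intro measurable_restrict_space1 measurable_completion) simp

lemma measurable_sample: "v \<in> {1..n} \<Longrightarrow> (\<lambda>x. x v) \<in> borel_measurable (sample_space n)"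
  using measurable_compose[OF measurable_component_singleton[of v "{1..n}" "\<lambda>_. lebesgue_on {0..1::real}"]
      measurable_ident_lebesgue_on] by simp

lemma measurable_sample_pair:
  assumes "v \<in> {1..n}" "w \<in> {1..n}"
  shows "(\<lambda>x. (x v, x w)) \<in> borel_measurable (sample_space n)"
  using assms by (intro borel_measurable_Pair measurable_sample)

lemma sample_in_unit: "x \<in> space (sample_space n) \<Longrightarrow> v \<in> {1..n} \<Longrightarrow> x v \<in> {0..1}"
  by (auto simp: space_PiM space_restrict_space PiE_def Pi_def)

lemma sample_pair_in_unit_square:
  "x \<in> space (sample_space n) \<Longrightarrow> v \<in> {1..n} \<Longrightarrow> w \<in> {1..n} \<Longrightarrow> (x v, x w) \<in> unit_square"
  using sample_in_unit[of x n v] sample_in_unit[of x n w] by (simp add: unit_square_def)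

text \<open>Distinct coordinates are independent, so both sides come from the square of the uniform
  law \<open>U\<close> on the Borel line. Only Borel sets are treated here; Lebesgue sets of the
  plane follow by completion.\<close>

lemma emeasure_sample_pair:
  assumes vw: "v \<in> {1..n}" "w \<in> {1..n}" "v \<noteq> w" and B: "B \<in> sets borel"
  shows "emeasure (sample_space n) {x\<in>space (sample_space n). (x v, x w) \<in> B} = emeasure lborel (B \<inter> unit_square)"
proof -
  let ?I = "lebesgue_on {0..1::real}"
  define U where "U = distr ?I borel (\<lambda>y. y)"
  have [measurable]: "(\<lambda>y. y) \<in> ?I \<rightarrow>\<^sub>M borel" by (rule measurable_ident_lebesgue_on)
  interpret U: prob_space U
    unfolding U_def by (rule prob_space.prob_space_distr[OF prob_space_unit_interval]) measurable
  have sU: "sets U = sets borel" by (simp add: U_def)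
  have eU: "emeasure U A = emeasure lborel (A \<inter> {0..1})" if "A \<in> sets borel" for A
    using that by (simp add: U_def emeasure_distr space_restrict_space emeasure_restrict_space)
  have eI: "emeasure ?I (A \<inter> {0..1}) = emeasure U A" if "A \<in> sets borel" for A
    unfolding eU[OF that] using that by (subst emeasure_restrict_space) simp_all
  have sI: "A \<inter> {0..1} \<in> sets ?I" if "A \<in> sets borel" for A
    using that by (simp add: sets_restrict_space_iff)
  have sUU: "sets (U \<Otimes>\<^sub>M U) = sets borel"
    using sets_pair_measure_cong[OF sU sU] by (simp only: borel_prod)
  have 1: "U \<Otimes>\<^sub>M U = distr (sample_space n) borel (\<lambda>x. (x v, x w))"
  proof (rule pair_measure_eqI)
    show "sigma_finite_measure U" "sigma_finite_measure U" by unfold_locales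
    fix A C assume "A \<in> sets U" "C \<in> sets U"
    then have AC: "A \<in> sets borel" "C \<in> sets borel" by (auto simp: sU)
    let ?X = "\<lambda>i. if i = v then A \<inter> {0..1} else C \<inter> {0..1}"
    have "emeasure (distr (sample_space n) borel (\<lambda>x. (x v, x w))) (A \<times> C)
        = emeasure (sample_space n) ((\<lambda>x. (x v, x w)) -` (A \<times> C) \<inter> space (sample_space n))"
      using AC vw by (intro emeasure_distr measurable_sample_pair) (auto simp: borel_prod[symmetric])
    also have "(\<lambda>x. (x v, x w)) -` (A \<times> C) \<inter> space (sample_space n)
        = prod_emb {1..n} (\<lambda>_. ?I) {v, w} (Pi\<^sub>E {v, w} ?X)"
      using vw sample_in_unit[of _ n]
      by (auto simp: prod_emb_def space_PiM PiE_def Pi_def restrict_def extensional_def space_restrict_space split: if_splits)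
    also have "emeasure (sample_space n) \<dots> = (\<Prod>i\<in>{v, w}. emeasure ?I (?X i))"
      using vw sI[OF AC(1)] sI[OF AC(2)] by (intro emeasure_PiM_emb prob_space_unit_interval) auto
    also have "\<dots> = emeasure ?I (A \<inter> {0..1}) * emeasure ?I (C \<inter> {0..1})"
      using vw(3) by simp
    also have "\<dots> = emeasure U A * emeasure U C"
      unfolding eI[OF AC(1)] eI[OF AC(2)] ..
    finally show "emeasure U A * emeasure U C = emeasure (distr (sample_space n) borel (\<lambda>x. (x v, x w))) (A \<times> C)" ..
  qed (simp add: sUU)
  have 2: "U \<Otimes>\<^sub>M U = density lborel (indicator unit_square)"
  proof (rule pair_measure_eqI)
    show "sigma_finite_measure U" "sigma_finite_measure U" by unfold_locales
    fix A C assume "A \<in> sets U" "C \<in> sets U"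
    then have AC: "A \<in> sets borel" "C \<in> sets borel" by (auto simp: sU)
    then have "A \<times> C \<in> sets (borel \<Otimes>\<^sub>M borel)" by simp
    then have AC': "A \<times> C \<in> sets borel" by (simp only: borel_prod)
    have "emeasure (density lborel (indicator unit_square)) (A \<times> C) = emeasure lborel ((A \<times> C) \<inter> unit_square)"
      using AC' by (simp add: emeasure_restricted Int_commute)
    also have "(A \<times> C) \<inter> unit_square = (A \<inter> {0..1}) \<times> (C \<inter> {0..1})"
      by (auto simp: unit_square_def)
    also have "emeasure lborel \<dots> = emeasure (lborel \<Otimes>\<^sub>M lborel) ((A \<inter> {0..1}) \<times> (C \<inter> {0..1}))"
      by (simp add: lborel_prod)
    also have "\<dots> = emeasure U A * emeasure U C"
      using AC by (subst lborel.emeasure_pair_measure_Times) (simp_all add: eU)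
    finally show "emeasure U A * emeasure U C = emeasure (density lborel (indicator unit_square)) (A \<times> C)" ..
  qed (simp add: sUU)
  have "emeasure (sample_space n) {x\<in>space (sample_space n). (x v, x w) \<in> B}
      = emeasure (distr (sample_space n) borel (\<lambda>x. (x v, x w))) B"
    using B vw by (subst emeasure_distr[OF measurable_sample_pair]) (auto intro!: arg_cong2[where f = emeasure])
  also have "\<dots> = emeasure (density lborel (indicator unit_square)) B"
    by (simp only: 1[symmetric] 2)
  also have "\<dots> = emeasure lborel (B \<inter> unit_square)"
    using B by (simp add: emeasure_restricted Int_commute)
  finally show ?thesis .
qed

text \<open>The cell is squeezed between a half-open and a closed interval of equal length, so the
  extra endpoint of the last cell needs no separate count.\<close>

lemma measure_cell:
  assumes "j < N"
  shows "{y\<in>{0..1}. cell N y = j} \<in> sets (lebesgue_on {0..1})"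
    and "measure (lebesgue_on {0..1}) {y\<in>{0..1}. cell N y = j} = 1 / N"
proof -
  let ?C = "{y\<in>{0..1}. cell N y = j}"
  have N: "N > 0" using assms by simp
  have "?C = {0..1} \<inter> (cell N -` {j} \<inter> space borel)" by auto
  also have "\<dots> \<in> sets borel"
    by (intro sets.Int measurable_sets[OF measurable_cell]) auto
  finally have bor: "?C \<in> sets borel" .
  then show "?C \<in> sets (lebesgue_on {0..1})" by (auto simp: sets_restrict_space)
  have j1: "(real j + 1) / N \<le> 1" using assms by (simp add: field_simps)
  have sub1: "{real j / N ..< (real j + 1) / N} \<subseteq> ?C"
  proof
    fix y assume y: "y \<in> {real j / N ..< (real j + 1) / N}"
    moreover have "0 \<le> real j / N" by simp
    ultimately have "0 \<le> y" "y < 1" using j1 unfolding atLeastLessThan_iff by linarith+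
    with y N show "y \<in> ?C" using cell_eq_iff[of y N j] by auto
  qed
  have sub2: "?C \<subseteq> {real j / N .. (real j + 1) / N}"
  proof
    fix y assume y: "y \<in> ?C"
    show "y \<in> {real j / N .. (real j + 1) / N}"
    proof (cases "y = 1")
      case True
      with y have "j = N - 1" by (simp add: cell_def)
      with True N show ?thesis by (simp add: of_nat_diff field_simps)
    next
      case False
      with y N show ?thesis using cell_eq_iff[of y N j] by auto
    qed
  qed
  have m: "measure (lebesgue_on {0..1}) ?C = measure lborel ?C"
    using bor by (subst measure_restrict_space) auto
  have len: "(real j + 1) / N - real j / N = 1 / N" by (simp add: diff_divide_distrib[symmetric])
  have le: "real j / N \<le> (real j + 1) / N" by (simp add: divide_right_mono)
  have fm: "?C \<in> fmeasurable lborel" "{real j / N .. (real j + 1) / N} \<in> fmeasurable lborel"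
  proof -
    show i: "{real j / N .. (real j + 1) / N} \<in> fmeasurable lborel"
      using le by (auto simp: fmeasurable_def)
    show "?C \<in> fmeasurable lborel"
      by (rule fmeasurableI2[OF i sub2]) (use bor in simp)
  qed
  have "measure lborel {real j / N ..< (real j + 1) / N} \<le> measure lborel ?C"
    by (rule measure_mono_fmeasurable[OF sub1 _ fm(1)]) simp
  moreover have "measure lborel ?C \<le> measure lborel {real j / N .. (real j + 1) / N}"
    by (rule measure_mono_fmeasurable[OF sub2 _ fm(2)]) (use bor in simp)
  ultimately show "measure (lebesgue_on {0..1}) ?C = 1 / N"
    unfolding m using le len by simp
qed

text \<open>The value 0 outside \<open>{1..n}\<close> is the default value of the
  \<open>Pi_pmf\<close> with which this sample is compared, so that both describe random total
  functions.\<close>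

definition grid_sample :: "nat \<Rightarrow> nat \<Rightarrow> (nat \<Rightarrow> real) \<Rightarrow> nat \<Rightarrow> nat" where
  "grid_sample n N x v = (if v \<in> {1..n} then cell N (x v) else 0)"

text \<open>Passage from the continuous sample to a finite product of uniform laws. Only finitely
  many grid samples occur, and each of them is a box of cells with measure \<open>1 / N\<close> per
  coordinate; hence the predicate \<open>Q\<close> can be arbitrary.\<close>

lemma measure_grid_sample:
  assumes N: "N > 0"
  shows "{x\<in>space (sample_space n). Q (grid_sample n N x)} \<in> sets (sample_space n)" (is ?sets)
    and "measure (sample_space n) {x\<in>space (sample_space n). Q (grid_sample n N x)}
      = measure (Pi_pmf {1..n} 0 (\<lambda>_. pmf_of_set {..<N})) {X. Q X}" (is ?meas)
proof -
  interpret unit_interval: product_prob_space "\<lambda>_ :: nat. lebesgue_on {0..1::real}" "{1..n}"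
    by (simp add: product_prob_spaceI prob_space_unit_interval)
  interpret unit_interval: finite_product_prob_space "\<lambda>_ :: nat. lebesgue_on {0..1::real}" "{1..n}"
    by standard simp
  let ?P = "Pi_pmf {1..n} (0::nat) (\<lambda>_. pmf_of_set {..<N})"
  define F where "F = PiE_dflt {1..n} (0::nat) (\<lambda>_. {..<N})"
  have finF: "finite F" unfolding F_def by auto
  have Ne: "{..<N} \<noteq> {}" using N by auto
  define C where "C z = {x\<in>space (sample_space n). grid_sample n N x = z}" for z
  have C: "C z = Pi\<^sub>E {1..n} (\<lambda>v. {y\<in>{0..1}. cell N y = z v})" if "z \<in> F" for z
  proof -
    have "grid_sample n N x = z \<longleftrightarrow> (\<forall>v\<in>{1..n}. cell N (x v) = z v)" for x
      using that by (force simp: fun_eq_iff grid_sample_def F_def PiE_dflt_def)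
    then show ?thesis
      by (auto simp: C_def space_PiM PiE_def Pi_def space_restrict_space)
  qed
  have zN: "z v < N" if "z \<in> F" "v \<in> {1..n}" for z v using that by (auto simp: F_def PiE_dflt_def)
  have C_sets: "C z \<in> sets (sample_space n)" if "z \<in> F" for z
    unfolding C[OF that] using zN[OF that] by (intro sets_PiM_I_finite measure_cell) auto
  have C_meas: "measure (sample_space n) (C z) = pmf ?P z" if "z \<in> F" for z
  proof -
    have "measure (sample_space n) (C z) = (\<Prod>v\<in>{1..n}. measure (lebesgue_on {0..1}) {y\<in>{0..1}. cell N y = z v})"
      unfolding C[OF that] using zN[OF that]
      by (intro unit_interval.finite_measure_PiM_emb measure_cell) auto
    also have "\<dots> = (\<Prod>v\<in>{1..n}. pmf (pmf_of_set {..<N}) (z v))"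
    proof (intro prod.cong refl)
      fix v assume "v \<in> {1..n}"
      then have v: "z v < N" by (rule zN[OF that])
      have "pmf (pmf_of_set {..<N}) (z v) = 1 / N" using v Ne by (simp add: pmf_of_set)
      then show "measure (lebesgue_on {0..1}) {y\<in>{0..1}. cell N y = z v} = pmf (pmf_of_set {..<N}) (z v)"
        unfolding measure_cell(2)[OF v] by simp
    qed
    also have "\<dots> = pmf ?P z"
      using that by (subst pmf_Pi') (auto simp: F_def PiE_dflt_def)
    finally show ?thesis .
  qed
  have gF: "grid_sample n N x \<in> F" for x
    using cell_less[OF N] by (auto simp: grid_sample_def F_def PiE_dflt_def)
  have eq: "{x\<in>space (sample_space n). Q (grid_sample n N x)} = (\<Union>z\<in>{z\<in>F. Q z}. C z)"
    using gF by (auto simp: C_def)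
  show ?sets unfolding eq using finF C_sets by (intro sets.finite_UN) auto
  have "measure (sample_space n) (\<Union>z\<in>{z\<in>F. Q z}. C z) = (\<Sum>z\<in>{z\<in>F. Q z}. measure (sample_space n) (C z))"
    using finF C_sets by (intro unit_interval.P.finite_measure_finite_Union) (auto simp: disjoint_family_on_def C_def)
  also have "\<dots> = (\<Sum>z\<in>{z\<in>F. Q z}. pmf ?P z)"
    by (intro sum.cong refl C_meas) auto
  also have "\<dots> = measure ?P {z\<in>F. Q z}"
    using finF by (subst measure_measure_pmf_finite) auto
  also have "\<dots> = measure ?P {X. Q X}"
  proof -
    have "set_pmf ?P = F" using Ne by (simp add: set_Pi_pmf F_def comp_def)
    then have "{z\<in>F. Q z} = {X. Q X} \<inter> set_pmf ?P" by auto
    then show ?thesis by (simp add: measure_Int_set_pmf)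
  qed
  finally show ?meas unfolding eq .
qed

section \<open>The law of the random graph system\<close>

text \<open>Borel null sets of the plane have null preimages, which allows completing both sides.
  Distinctness of the indices matters: a pair \<open>(x v, x v)\<close> always lies on the diagonal,
  a null set.\<close>

lemma measurable_sample_pair_lebesgue:
  assumes vw: "v \<in> {1..n}" "w \<in> {1..n}" "v \<noteq> w"
  shows "(\<lambda>x. (x v, x w)) \<in> completion (sample_space n) \<rightarrow>\<^sub>M lebesgue_on unit_square"
proof -
  let ?f = "\<lambda>x. (x v, x w)"
  have f: "?f \<in> sample_space n \<rightarrow>\<^sub>M lborel"
    using measurable_sample_pair[OF vw(1,2)] by simp
  have "?f \<in> completion (sample_space n) \<rightarrow>\<^sub>M completion lborel"
  proof (rule completion.measurable_completion2)
    show "?f \<in> completion (sample_space n) \<rightarrow>\<^sub>M lborel" by (rule measurable_completion[OF f])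
    show "null_sets lborel \<subseteq> null_sets (distr (completion (sample_space n)) lborel ?f)"
    proof
      fix B assume B: "B \<in> null_sets (lborel :: (real \<times> real) measure)"
      have "emeasure (distr (completion (sample_space n)) lborel ?f) B = emeasure (distr (sample_space n) lborel ?f) B"
          unfolding distr_completion[OF f] ..
      also have "\<dots> = emeasure (sample_space n) {x\<in>space (sample_space n). ?f x \<in> B}"
        using B by (subst emeasure_distr[OF f]) (auto intro!: arg_cong2[where f = emeasure])
      also have "\<dots> = emeasure lborel (B \<inter> unit_square)"
        using B by (intro emeasure_sample_pair[OF vw]) auto
      also have "\<dots> = 0" using B null_set_Int2[OF B, of unit_square] by (auto simp: Int_commute)
      finally show "B \<in> null_sets (distr (completion (sample_space n)) lborel ?f)"
        using B by (auto simp: null_sets_def)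
    qed
  qed
  then show ?thesis
    by (rule measurable_restrict_space2[rotated])
      (use sample_pair_in_unit_square[OF _ vw(1,2)] in auto)
qed

text \<open>A Lebesgue set is a Borel set up to a null set, and a pair of sample points misses that
  null set almost surely.\<close>

lemma prob_sample_pair_exceptional:
  assumes vw: "v \<in> {1..n}" "w \<in> {1..n}" "v \<noteq> w" and D: "D \<in> sets (lebesgue_on unit_square)"
  shows "{x\<in>space (sample_space n). (x v, x w) \<in> D} \<in> sets (completion (sample_space n))"
    and "measure (completion (sample_space n)) {x\<in>space (sample_space n). (x v, x w) \<in> D}
      = measure (lebesgue_on unit_square) D"
proof -
  let ?f = "\<lambda>x. (x v, x w)" and ?S = "completion (sample_space n)"
  have f: "?f \<in> sample_space n \<rightarrow>\<^sub>M borel" by (rule measurable_sample_pair[OF vw(1,2)])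
  have eq: "{x\<in>space (sample_space n). ?f x \<in> D} = ?f -` D \<inter> space ?S" by auto
  show S: "{x\<in>space (sample_space n). ?f x \<in> D} \<in> sets ?S"
    unfolding eq by (rule measurable_sets[OF measurable_sample_pair_lebesgue[OF vw] D])
  have Dl: "D \<in> sets lebesgue" "D \<subseteq> unit_square"
    using D by (auto simp: sets_restrict_space_iff)
  then obtain B N N' where B: "D = B \<union> N" "N \<subseteq> N'" "N' \<in> null_sets lborel" "B \<in> sets lborel"
    by (elim sets_completionE) blast
  have "emeasure ?S {x\<in>space (sample_space n). ?f x \<in> D} = emeasure ?S {x\<in>space (sample_space n). ?f x \<in> B}"
  proof (rule emeasure_eq_AE)
    have "emeasure (sample_space n) {x\<in>space (sample_space n). ?f x \<in> N'} = emeasure lborel (N' \<inter> unit_square)"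
      using B by (intro emeasure_sample_pair[OF vw]) auto
    also have "\<dots> = 0" using null_set_Int2[OF B(3), of unit_square] by (auto simp: Int_commute)
    finally have "{x\<in>space (sample_space n). ?f x \<in> N'} \<in> null_sets (sample_space n)"
      using measurable_sets[OF f, of N'] B(3) by (auto simp: null_sets_def vimage_def Int_def conj_commute)
    then have "AE x in sample_space n. x \<notin> {x\<in>space (sample_space n). ?f x \<in> N'}"
      by (rule AE_not_in)
    then have "AE x in ?S. x \<notin> {x\<in>space (sample_space n). ?f x \<in> N'}"
      by (rule AE_completion)
    then show "AE x in ?S. (x \<in> {x\<in>space (sample_space n). ?f x \<in> D}) = (x \<in> {x\<in>space (sample_space n). ?f x \<in> B})"
      by eventually_elim (use B in auto)
    show "{x\<in>space (sample_space n). ?f x \<in> B} \<in> sets ?S"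
      using measurable_sets[OF f, of B] B(4) by (auto simp: vimage_def Int_def conj_commute)
  qed (rule S)
  also have "\<dots> = emeasure (sample_space n) {x\<in>space (sample_space n). ?f x \<in> B}"
    using measurable_sets[OF f, of B] B(4) by (subst emeasure_completion) (auto simp: vimage_def Int_def conj_commute)
  also have "\<dots> = emeasure lborel (B \<inter> unit_square)"
    using B by (intro emeasure_sample_pair[OF vw]) auto
  also have "B \<inter> unit_square = B" using B Dl by auto
  also have "emeasure lborel B = emeasure lebesgue D"
  proof -
    have "emeasure lebesgue D = emeasure lebesgue B"
    proof (rule emeasure_eq_AE)
      have "AE x in lborel. x \<notin> N'" by (rule AE_not_in[OF B(3)])
      then have "AE x in lebesgue. x \<notin> N'" by (rule AE_completion)
      then show "AE x in lebesgue. (x \<in> D) = (x \<in> B)"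
        by eventually_elim (use B in auto)
    qed (use B Dl in auto)
    then show ?thesis using B by simp
  qed
  also have "\<dots> = emeasure (lebesgue_on unit_square) D"
    using Dl by (subst emeasure_restrict_space) auto
  finally show "measure ?S {x\<in>space (sample_space n). ?f x \<in> D} = measure (lebesgue_on unit_square) D"
    by (simp add: measure_def)
qed

section \<open>The law of a single label\<close>

lemma graphon_measurable: "graphon W \<Longrightarrow> W \<in> borel_measurable (lebesgue_on unit_square)"
  by (simp add: graphon_def)

lemma measurable_wbar:
  assumes "graphon_system k W" "I \<subseteq> {1..k}"
  shows "wbar k W I \<in> borel_measurable (lebesgue_on unit_square)"
  using assms(2)
proof (induction "card ({1..k} - I)" arbitrary: I rule: less_induct)
  case less
  have "wbar k W I = (\<lambda>p. W I p - (\<Sum>J\<in>{J. I \<subset> J \<and> J \<subseteq> {1..k}}. wbar k W J p))"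
    by (rule ext) (subst wbar.simps, rule refl)
  moreover have "(\<lambda>p. W I p - (\<Sum>J\<in>{J. I \<subset> J \<and> J \<subseteq> {1..k}}. wbar k W J p)) \<in> borel_measurable (lebesgue_on unit_square)"
  proof (intro borel_measurable_diff borel_measurable_sum)
    show "W I \<in> borel_measurable (lebesgue_on unit_square)"
      using assms(1) less.prems by (intro graphon_measurable) (auto simp: graphon_system_def)
    fix J assume J: "J \<in> {J. I \<subset> J \<and> J \<subseteq> {1..k}}"
    then have "{1..k} - J \<subset> {1..k} - I" using less.prems by auto
    then have "card ({1..k} - J) < card ({1..k} - I)" by (intro psubset_card_mono) auto
    with J show "wbar k W J \<in> borel_measurable (lebesgue_on unit_square)"
      by (intro less.hyps) auto
  qed
  ultimately show ?case by simp
qed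

text \<open>The recursion for \<open>wbar\<close> is Moebius inversion over supersets, so one
  unfolding at \<open>I\<close> returns \<open>W I\<close>. For \<open>I = {}\<close> this gives
  total mass 1, and in general the probability that a label contains \<open>I\<close>.\<close>

lemma sum_wbar:
  assumes "I \<subseteq> {1..k}"
  shows "(\<Sum>J\<in>{J. I \<subseteq> J \<and> J \<subseteq> {1..k}}. wbar k W J p) = W I p"
proof -
  have fin: "finite {J. I \<subset> J \<and> J \<subseteq> {1..k}}" by (rule finite_subset[of _ "Pow {1..k}"]) auto
  have "{J. I \<subseteq> J \<and> J \<subseteq> {1..k}} = insert I {J. I \<subset> J \<and> J \<subseteq> {1..k}}"
    using assms by auto
  then have "(\<Sum>J\<in>{J. I \<subseteq> J \<and> J \<subseteq> {1..k}}. wbar k W J p)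
      = wbar k W I p + (\<Sum>J\<in>{J. I \<subset> J \<and> J \<subseteq> {1..k}}. wbar k W J p)"
    using fin by simp
  then show ?thesis by (subst (asm) (2) wbar.simps) simp
qed

definition regular_point :: "nat \<Rightarrow> graphon_family \<Rightarrow> real \<times> real \<Rightarrow> bool" where
  "regular_point k W p \<longleftrightarrow> (\<forall>I\<subseteq>{1..k}. 0 \<le> wbar k W I p)"

lemma pmf_label_pmf:
  assumes W: "graphon_system k W" and p: "p \<in> unit_square" "regular_point k W p"
  shows "pmf (label_pmf k W p) I = (if I \<subseteq> {1..k} then wbar k W I p else 0)"
proof -
  let ?f = "\<lambda>I. if I \<subseteq> {1..k} then wbar k W I p else 0"
  have nn: "0 \<le> ?f I" for I using p by (auto simp: regular_point_def)
  have "(\<integral>\<^sup>+I. ennreal (?f I) \<partial>count_space UNIV) = (\<Sum>I\<in>Pow {1..k}. ennreal (?f I))"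
    by (intro nn_integral_count_space') auto
  also have "\<dots> = ennreal (\<Sum>I\<in>Pow {1..k}. ?f I)"
    by (intro sum_ennreal nn)
  also have "(\<Sum>I\<in>Pow {1..k}. ?f I) = (\<Sum>J\<in>{J. {} \<subseteq> J \<and> J \<subseteq> {1..k}}. wbar k W J p)"
    by (intro sum.cong) auto
  also have "\<dots> = 1" using sum_wbar[of "{}" k W p] W p by (simp add: graphon_system_def)
  finally have "(\<integral>\<^sup>+I. ennreal (?f I) \<partial>count_space UNIV) = 1" by simp
  then have "pmf (embed_pmf ?f) I = ?f I" by (intro pmf_embed_pmf nn)
  then show ?thesis using p(2) by (simp add: label_pmf_def regular_point_def)
qed

lemma set_label_pmf:
  assumes "graphon_system k W" "p \<in> unit_square"
  shows "set_pmf (label_pmf k W p) \<subseteq> Pow {1..k}"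
proof (cases "regular_point k W p")
  case True
  then show ?thesis using pmf_label_pmf[OF assms True] by (auto simp: set_pmf_eq split: if_splits)
next
  case False
  then have "label_pmf k W p = return_pmf {}" unfolding label_pmf_def regular_point_def by (rule if_not_P)
  then show ?thesis by simp
qed

lemma measurable_pmf_label_pmf:
  assumes W: "graphon_system k W"
  shows "(\<lambda>p. pmf (label_pmf k W p) I) \<in> borel_measurable (lebesgue_on unit_square)"
proof -
  have [measurable]: "wbar k W J \<in> borel_measurable (lebesgue_on unit_square)" if "J \<in> Pow {1..k}" for J
    using measurable_wbar[OF W] that by auto
  have "Measurable.pred (lebesgue_on unit_square) (\<lambda>p. \<forall>J\<in>Pow {1..k}. 0 \<le> wbar k W J p)"
    by (rule pred_intros_finite) (simp, measurable)
  then have reg[measurable]: "Measurable.pred (lebesgue_on unit_square) (regular_point k W)"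
    by (simp add: regular_point_def[abs_def] Ball_def)
  have "(\<lambda>p. if regular_point k W p then (if I \<subseteq> {1..k} then wbar k W I p else 0) else indicator {{}} I)
      \<in> borel_measurable (lebesgue_on unit_square)"
  proof -
    have meas: "(\<lambda>p. if regular_point k W p then g p else c) \<in> borel_measurable (lebesgue_on unit_square)"
      if [measurable]: "g \<in> borel_measurable (lebesgue_on unit_square)" for g and c :: real
      by measurable
    show ?thesis
    proof (cases "I \<subseteq> {1..k}")
      case True
      show ?thesis unfolding if_P[OF True] by (rule meas[OF measurable_wbar[OF W True]])
    next
      case False
      show ?thesis unfolding if_not_P[OF False] by (rule meas) simp
    qed
  qed
  then show ?thesis
  proof (rule measurable_cong[THEN iffD1, rotated])
    fix p assume "p \<in> space (lebesgue_on unit_square)"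
    then have p: "p \<in> unit_square" by (simp add: space_restrict_space)
    show "(if regular_point k W p then (if I \<subseteq> {1..k} then wbar k W I p else 0) else indicator {{}} I) = pmf (label_pmf k W p) I"
    proof (cases "regular_point k W p")
      case True
      then show ?thesis using pmf_label_pmf[OF W p True] by simp
    next
      case False
      then have "label_pmf k W p = return_pmf {}" unfolding label_pmf_def regular_point_def by (rule if_not_P)
      then show ?thesis using False by (simp add: pmf_return indicator_def)
    qed
  qed
qed

section \<open>The random graph system as a mixture over the sample points\<close>

lemma finite_vertex_pairs: "finite (vertex_pairs n)"
  by (rule finite_subset[of _ "{1..n} \<times> {1..n}"]) (auto simp: vertex_pairs_def)

lemma vertex_pairsD: "(i, j) \<in> vertex_pairs n \<Longrightarrow> i \<in> {1..n} \<and> j \<in> {1..n} \<and> i \<noteq> j"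
  by (auto simp: vertex_pairs_def)

lemma measurable_conditional_graphs:
  assumes W: "graphon_system k W"
  shows "(\<lambda>x. measure_pmf (conditional_graphs k W n x))
    \<in> completion (sample_space n) \<rightarrow>\<^sub>M subprob_algebra (count_space UNIV)"
proof (rule measurable_subprob_algebra)
  fix x show "subprob_space (measure_pmf (conditional_graphs k W n x))"
    by (rule prob_space_imp_subprob_space) (rule measure_pmf.prob_space_axioms)
  show "sets (measure_pmf (conditional_graphs k W n x)) = sets (count_space UNIV)" by simp
next
  fix A :: "graph_family set"
  \<comment> \<open>A finite set of labellings that contains the support for every sample
    \<open>x\<close>. It reduces the probability of an arbitrary set of graph systems to a finite
    sum of products of measurable functions.\<close>
  define F where "F = PiE_dflt (vertex_pairs n) ({} :: nat set) (\<lambda>_. Pow {1..k})"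
  have finF: "finite F" unfolding F_def using finite_vertex_pairs by (intro finite_PiE_dflt) auto
  define L where "L = (\<lambda>x. Pi_pmf (vertex_pairs n) ({} :: nat set) (\<lambda>(i, j). label_pmf k W (x i, x j)))"
  have pmf_eq: "measure (measure_pmf (conditional_graphs k W n x)) A
      = (\<Sum>l\<in>{l\<in>F. labels_to_graphs n l \<in> A}. \<Prod>e\<in>vertex_pairs n. pmf (label_pmf k W (x (fst e), x (snd e))) (l e))"
    if x: "x \<in> space (sample_space n)" for x
  proof -
    have LF: "set_pmf (L x) \<subseteq> F"
    proof -
      have "set_pmf (label_pmf k W (x i, x j)) \<subseteq> Pow {1..k}" if "(i, j) \<in> vertex_pairs n" for i j
        using that vertex_pairsD[OF that] x by (intro set_label_pmf[OF W] sample_pair_in_unit_square) auto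
      then show ?thesis unfolding L_def F_def
        by (subst set_Pi_pmf[OF finite_vertex_pairs]) (fastforce simp: PiE_dflt_def)
    qed
    have "measure (measure_pmf (conditional_graphs k W n x)) A = measure (L x) {l. labels_to_graphs n l \<in> A}"
      by (simp add: conditional_graphs_def L_def measure_map_pmf vimage_def)
    also have "\<dots> = measure (L x) ({l. labels_to_graphs n l \<in> A} \<inter> set_pmf (L x))"
      by (simp add: measure_Int_set_pmf)
    also have "{l. labels_to_graphs n l \<in> A} \<inter> set_pmf (L x) = {l\<in>F. labels_to_graphs n l \<in> A} \<inter> set_pmf (L x)"
      using LF by auto
    also have "measure (L x) \<dots> = measure (L x) {l\<in>F. labels_to_graphs n l \<in> A}"
      by (rule measure_Int_set_pmf)
    also have "\<dots> = (\<Sum>l\<in>{l\<in>F. labels_to_graphs n l \<in> A}. pmf (L x) l)"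
      using finF by (intro measure_measure_pmf_finite) auto
    also have "\<dots> = (\<Sum>l\<in>{l\<in>F. labels_to_graphs n l \<in> A}. \<Prod>e\<in>vertex_pairs n. pmf (label_pmf k W (x (fst e), x (snd e))) (l e))"
      unfolding L_def
      by (intro sum.cong refl, subst pmf_Pi'[OF finite_vertex_pairs]) (auto simp: F_def PiE_dflt_def split_beta)
    finally show ?thesis .
  qed
  have "(\<lambda>x. \<Sum>l\<in>{l\<in>F. labels_to_graphs n l \<in> A}. \<Prod>e\<in>vertex_pairs n. pmf (label_pmf k W (x (fst e), x (snd e))) (l e))
      \<in> borel_measurable (completion (sample_space n))"
  proof (intro borel_measurable_sum borel_measurable_prod)
    fix l e assume "e \<in> vertex_pairs n"
    then have "(fst e, snd e) \<in> vertex_pairs n" by simp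
    from vertex_pairsD[OF this]
    show "(\<lambda>x. pmf (label_pmf k W (x (fst e), x (snd e))) (l e)) \<in> borel_measurable (completion (sample_space n))"
      by (intro measurable_compose[OF measurable_sample_pair_lebesgue measurable_pmf_label_pmf[OF W]]) auto
  qed
  then have "(\<lambda>x. measure (measure_pmf (conditional_graphs k W n x)) A) \<in> borel_measurable (completion (sample_space n))"
    by (rule measurable_cong[THEN iffD1, rotated]) (simp add: pmf_eq)
  then show "(\<lambda>x. emeasure (measure_pmf (conditional_graphs k W n x)) A) \<in> borel_measurable (completion (sample_space n))"
    by (simp add: measure_pmf.emeasure_eq_measure)
qed

lemma measure_random_graphs:
  assumes W: "graphon_system k W"
  shows "measure (random_graphs k W n) A
    = (\<integral>x. measure (measure_pmf (conditional_graphs k W n x)) A \<partial>completion (sample_space n))"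
proof -
  interpret prob_space "completion (sample_space n)"
    by (rule prob_space.prob_space_completion[OF prob_space_sample_space])
  show ?thesis unfolding random_graphs_def
    by (rule measure_bind[OF measurable_conditional_graphs[OF W]]) simp
qed

text \<open>The integrand is at least \<open>indicator X x - a\<close> everywhere: by assumption on
  \<open>X\<close>, and outside \<open>X\<close> because that quantity is not positive.\<close>

lemma measure_random_graphs_ge:
  assumes W: "graphon_system k W" and X: "X \<in> sets (completion (sample_space n))"
    and good: "\<And>x. x \<in> X \<Longrightarrow> measure (measure_pmf (conditional_graphs k W n x)) A \<ge> 1 - a"
    and mX: "measure (completion (sample_space n)) X \<ge> 1 - b" and a: "0 \<le> a"
  shows "measure (random_graphs k W n) A \<ge> 1 - a - b"
proof -
  let ?S = "completion (sample_space n)"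
  interpret prob_space ?S
    by (rule prob_space.prob_space_completion[OF prob_space_sample_space])
  have meas: "(\<lambda>x. measure (measure_pmf (conditional_graphs k W n x)) A) \<in> borel_measurable ?S"
  proof -
    have "(\<lambda>x. emeasure (measure_pmf (conditional_graphs k W n x)) A) \<in> borel_measurable ?S"
      by (rule measurable_emeasure_kernel[OF measurable_conditional_graphs[OF W]]) simp
    then show ?thesis by (simp add: measure_def)
  qed
  have iX: "integrable ?S (indicator X :: _ \<Rightarrow> real)"
    using X by (intro integrable_const_bound[where B = 1]) auto
  have "1 - a - b \<le> measure ?S X - a" using mX by simp
  also have "\<dots> = (\<integral>x. indicator X x - a \<partial>?S)"
    unfolding Bochner_Integration.integral_diff[OF iX integrable_const] integral_indicator
      lebesgue_integral_const prob_space
    using sets.sets_into_space[OF X] by (simp add: Int_absorb2)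
  also have "\<dots> \<le> (\<integral>x. measure (measure_pmf (conditional_graphs k W n x)) A \<partial>?S)"
  proof (rule integral_mono)
    show "integrable ?S (\<lambda>x. measure (measure_pmf (conditional_graphs k W n x)) A)"
      using meas by (intro integrable_const_bound[where B = 1]) auto
    show "integrable ?S (\<lambda>x. indicator X x - a)"
      by (intro Bochner_Integration.integrable_diff iX integrable_const)
    fix x show "indicator X x - a \<le> measure (measure_pmf (conditional_graphs k W n x)) A"
    proof (cases "x \<in> X")
      case True
      then show ?thesis using good[OF True] by simp
    next
      case False
      then have "indicator X x = (0::real)" by simp
      with a measure_nonneg[of "measure_pmf (conditional_graphs k W n x)" A] show ?thesis by linarith
    qed
  qed
  finally show ?thesis by (simp add: measure_random_graphs[OF W])
qed

section \<open>Interval exchanges\<close>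

text \<open>Both factors are Borel up to null sets, and the error lies in two strips over null sets,
  which are null in the plane.\<close>

lemma lebesgue_Times:
  fixes S T :: "real set"
  assumes "S \<in> sets lebesgue" "T \<in> sets lebesgue"
  shows "S \<times> T \<in> sets lebesgue"
    and "emeasure lebesgue (S \<times> T) = emeasure lebesgue S * emeasure lebesgue T"
proof -
  obtain B N N' where B: "S = B \<union> N" "N \<subseteq> N'" "N' \<in> null_sets lborel" "B \<in> sets lborel"
    using assms(1) by (elim sets_completionE) blast
  obtain C M M' where C: "T = C \<union> M" "M \<subseteq> M'" "M' \<in> null_sets lborel" "C \<in> sets lborel"
    using assms(2) by (elim sets_completionE) blast
  have prod: "X \<times> Y \<in> sets lborel" "emeasure lborel (X \<times> Y) = emeasure lborel X * emeasure lborel Y"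
    if "X \<in> sets lborel" "Y \<in> sets lborel" for X Y :: "real set"
  proof -
    have "X \<times> Y \<in> sets (lborel \<Otimes>\<^sub>M lborel)" using that by (rule pair_measureI)
    then show "X \<times> Y \<in> sets lborel" by (simp only: lborel_prod)
    have "emeasure (lborel \<Otimes>\<^sub>M lborel) (X \<times> Y) = emeasure lborel X * emeasure lborel Y"
      using that by (rule lborel.emeasure_pair_measure_Times)
    then show "emeasure lborel (X \<times> Y) = emeasure lborel X * emeasure lborel Y"
      by (simp only: lborel_prod)
  qed
  define Z where "Z = N' \<times> UNIV \<union> UNIV \<times> M'"
  have Z: "Z \<in> null_sets lborel"
  proof -
    have "N' \<times> (UNIV :: real set) \<in> null_sets lborel" "(UNIV :: real set) \<times> M' \<in> null_sets lborel"
      using B(3) C(3) prod[of N' UNIV] prod[of UNIV M'] by (auto simp: null_sets_def)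
    then show ?thesis unfolding Z_def by blast
  qed
  have eq: "S \<times> T = (B \<times> C) \<union> ((S \<times> T) \<inter> Z)" using B C by (auto simp: Z_def)
  show S: "S \<times> T \<in> sets lebesgue"
    by (rule sets_completionI[OF eq _ Z prod(1)[OF B(4) C(4)]]) auto
  have AE: "AE p in lebesgue. p \<notin> Z" by (rule AE_completion[OF AE_not_in[OF Z]])
  have "emeasure lebesgue (S \<times> T) = emeasure lebesgue (B \<times> C)"
  proof (rule emeasure_eq_AE)
    show "AE p in lebesgue. (p \<in> S \<times> T) = (p \<in> B \<times> C)"
      using AE by eventually_elim (use B C in \<open>auto simp: Z_def\<close>)
  qed (use S prod(1)[OF B(4) C(4)] in auto)
  also have "\<dots> = emeasure lborel B * emeasure lborel C"
    using prod[OF B(4) C(4)] by simp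
  also have "emeasure lborel B = emeasure lebesgue S"
  proof -
    have "AE p in lebesgue. p \<notin> N'" by (rule AE_completion[OF AE_not_in[OF B(3)]])
    then have "emeasure lebesgue S = emeasure lebesgue B"
    proof (intro emeasure_eq_AE)
      assume "AE p in lebesgue. p \<notin> N'"
      then show "AE p in lebesgue. (p \<in> S) = (p \<in> B)" by eventually_elim (use B in auto)
    qed (use B assms(1) in auto)
    then show ?thesis using B(4) by simp
  qed
  also have "emeasure lborel C = emeasure lebesgue T"
  proof -
    have "AE p in lebesgue. p \<notin> M'" by (rule AE_completion[OF AE_not_in[OF C(3)]])
    then have "emeasure lebesgue T = emeasure lebesgue C"
    proof (intro emeasure_eq_AE)
      assume "AE p in lebesgue. p \<notin> M'"
      then show "AE p in lebesgue. (p \<in> T) = (p \<in> C)" by eventually_elim (use C in auto)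
    qed (use C assms(2) in auto)
    then show ?thesis using C(4) by simp
  qed
  finally show "emeasure lebesgue (S \<times> T) = emeasure lebesgue S * emeasure lebesgue T" .
qed

text \<open>Half-open cells are translated as prescribed by \<open>\<pi>\<close>. The point 1 stays
  fixed although it belongs to the last cell, since moving it along would in general destroy
  bijectivity.\<close>

definition interval_exchange :: "nat \<Rightarrow> (nat \<Rightarrow> nat) \<Rightarrow> real \<Rightarrow> real" where
  "interval_exchange N \<pi> y =
     (if y \<in> {0..<1} then (real (\<pi> (cell N y)) - real (cell N y)) / N + y else y)"

lemma interval_exchange_cell:
  assumes N: "N > 0" and \<pi>: "\<pi> ` {..<N} \<subseteq> {..<N}" and y: "y \<in> {0..<1}"
  shows "interval_exchange N \<pi> y \<in> {0..<1}" "cell N (interval_exchange N \<pi> y) = \<pi> (cell N y)"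
proof -
  let ?z = "interval_exchange N \<pi> y" and ?j = "cell N y"
  have j: "?j < N" "\<pi> ?j < N" using cell_less[OF N, of y] \<pi> by auto
  have *: "real ?j / N \<le> y" "y < (real ?j + 1) / N" using cell_eq_iff[of y N ?j] y N by auto
  have z: "?z = y + real (\<pi> ?j) / N - real ?j / N"
    using y by (simp add: interval_exchange_def diff_divide_distrib)
  have b: "real (\<pi> ?j) / N \<le> ?z" "?z < (real (\<pi> ?j) + 1) / N"
    using * unfolding z by (auto simp: add_divide_distrib)
  have "0 \<le> real (\<pi> ?j) / N" by simp
  moreover have "(real (\<pi> ?j) + 1) / N \<le> 1" using j by (simp add: field_simps)
  ultimately show z01: "?z \<in> {0..<1}" using b unfolding atLeastLessThan_iff by linarith
  then show "cell N ?z = \<pi> ?j" using cell_eq_iff[of ?z N "\<pi> ?j"] N b by auto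
qed

lemma interval_exchange_inverse:
  assumes N: "N > 0" and \<pi>: "\<pi> ` {..<N} \<subseteq> {..<N}" and inv: "\<And>j. j < N \<Longrightarrow> \<rho> (\<pi> j) = j"
  shows "interval_exchange N \<rho> (interval_exchange N \<pi> y) = y"
proof (cases "y \<in> {0..<1}")
  case True
  let ?z = "interval_exchange N \<pi> y"
  note z = interval_exchange_cell[OF N \<pi> True]
  have "interval_exchange N \<rho> ?z = (real (cell N y) - real (\<pi> (cell N y))) / N + ?z"
    unfolding interval_exchange_def[of N \<rho>] if_P[OF z(1)] z(2) inv[OF cell_less[OF N]] ..
  moreover have "?z = (real (\<pi> (cell N y)) - real (cell N y)) / N + y"
    unfolding interval_exchange_def if_P[OF True] ..
  ultimately have "interval_exchange N \<rho> ?z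
      = (real (cell N y) - real (\<pi> (cell N y))) / N + ((real (\<pi> (cell N y)) - real (cell N y)) / N + y)"
    by metis
  also have "\<dots> = y" by (simp add: diff_divide_distrib)
  finally show ?thesis .
qed (auto simp: interval_exchange_def)

text \<open>Apart from the null point 1, the preimage is a disjoint union of translates of the
  pieces of \<open>B\<close> in the cells; as \<open>\<pi>\<close> is a permutation, the pieces are
  merely reordered.\<close>

lemma interval_exchange_preimage:
  assumes N: "N > 0" and \<pi>: "bij_betw \<pi> {..<N} {..<N}" and B: "B \<in> sets lebesgue" "B \<subseteq> {0..1}"
  shows "interval_exchange N \<pi> -` B \<inter> {0..1} \<in> sets lebesgue"
    and "emeasure lebesgue (interval_exchange N \<pi> -` B \<inter> {0..1}) = emeasure lebesgue B"
proof -
  let ?\<phi> = "interval_exchange N \<pi>"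
  define C where "C j = {real j / N ..< (real j + 1) / N}" for j :: nat
  define d where "d j = (real (\<pi> j) - real j) / N" for j
  define P where "P j = (\<lambda>x. - d j + x) ` (B \<inter> C (\<pi> j))" for j
  have \<pi>': "\<pi> ` {..<N} \<subseteq> {..<N}" using \<pi> by (auto simp: bij_betw_def)
  have C01: "C j \<subseteq> {0..<1}" if "j < N" for j
  proof -
    have "(real j + 1) / N \<le> 1" "0 \<le> real j / N" using that by (auto simp: field_simps)
    then show ?thesis unfolding C_def by auto
  qed
  have cellC: "cell N y = j" if "y \<in> C j" "j < N" for y j
  proof -
    have "0 \<le> y" "y < 1" using that C01[OF that(2)] by auto
    with that N show ?thesis using cell_eq_iff[of y N j] by (auto simp: C_def)
  qed
  have inC: "y \<in> C (cell N y)" if "y \<in> {0..<1}" for y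
    using that N cell_eq_iff[of y N "cell N y"] by (auto simp: C_def)
  have P: "P j \<in> sets lebesgue" "emeasure lebesgue (P j) = emeasure lebesgue (B \<inter> C (\<pi> j))" for j
  proof -
    have BC: "B \<inter> C (\<pi> j) \<in> sets lebesgue" using B by (auto simp: C_def)
    then show "P j \<in> sets lebesgue" unfolding P_def by (rule lebesgue_sets_translation)
    show "emeasure lebesgue (P j) = emeasure lebesgue (B \<inter> C (\<pi> j))"
      using emeasure_lebesgue_affine[of 1 "- d j" "B \<inter> C (\<pi> j)"] unfolding P_def by (simp add: add.commute)
  qed
  have PC: "P j \<subseteq> C j" if "j < N" for j
  proof -
    have "- d j = real j / N - real (\<pi> j) / N" by (simp add: d_def diff_divide_distrib)
    then show ?thesis unfolding P_def by (auto simp: C_def add_divide_distrib)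
  qed
  have eq: "?\<phi> -` B \<inter> {0..1} = (B \<inter> {1}) \<union> (\<Union>j<N. P j)"
  proof (intro equalityI subsetI)
    fix y assume y: "y \<in> ?\<phi> -` B \<inter> {0..1}"
    show "y \<in> (B \<inter> {1}) \<union> (\<Union>j<N. P j)"
    proof (cases "y = 1")
      case True
      with y show ?thesis by (auto simp: interval_exchange_def)
    next
      case False
      with y have y': "y \<in> {0..<1}" by auto
      note z = interval_exchange_cell[OF N \<pi>' y']
      have "?\<phi> y \<in> B \<inter> C (\<pi> (cell N y))" using y inC[OF z(1)] z(2) by auto
      moreover have "y = - d (cell N y) + ?\<phi> y" using y' by (simp add: interval_exchange_def d_def)
      ultimately have "y \<in> P (cell N y)" unfolding P_def by blast
      then show ?thesis using cell_less[OF N] by blast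
    qed
  next
    fix y assume "y \<in> (B \<inter> {1}) \<union> (\<Union>j<N. P j)"
    then consider "y \<in> B \<inter> {1}" | j where "j < N" "y \<in> P j" by auto
    then show "y \<in> ?\<phi> -` B \<inter> {0..1}"
    proof cases
      case 1
      then show ?thesis by (auto simp: interval_exchange_def)
    next
      case 2
      then have yC: "y \<in> C j" using PC by auto
      then have y01: "y \<in> {0..<1}" using C01[OF 2(1)] by blast
      have "?\<phi> y = d j + y" using y01 cellC[OF yC 2(1)] by (simp add: interval_exchange_def d_def)
      moreover have "d j + y \<in> B" using 2 by (auto simp: P_def)
      ultimately show ?thesis using y01 by auto
    qed
  qed
  have sP: "(\<Union>j<N. P j) \<in> sets lebesgue" using P by auto
  have s1: "B \<inter> {1} \<in> sets lebesgue" using B by auto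
  show "?\<phi> -` B \<inter> {0..1} \<in> sets lebesgue" unfolding eq using sP s1 by (rule sets.Un[rotated])
  have disjC: "disjoint_family_on C {..<N}"
    unfolding disjoint_family_on_def using cellC by blast
  have null1: "B \<inter> {1} \<in> null_sets lebesgue"
  proof -
    have "{1::real} \<in> null_sets lebesgue"
      by (intro null_sets_completionI finite_imp_null_set_lborel) simp
    then show ?thesis using B by (intro null_set_Int1)
  qed
  have "emeasure lebesgue (?\<phi> -` B \<inter> {0..1}) = emeasure lebesgue (\<Union>j<N. P j)"
    unfolding eq Un_commute[of "B \<inter> {1}"] by (rule emeasure_Un_null_set[OF sP null1])
  also have "\<dots> = (\<Sum>j<N. emeasure lebesgue (P j))"
  proof (rule sum_emeasure[symmetric])
    show "disjoint_family_on P {..<N}"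
      unfolding disjoint_family_on_def
    proof (intro ballI impI)
      fix i j assume ij: "i \<in> {..<N}" "j \<in> {..<N}" "i \<noteq> j"
      then have "C i \<inter> C j = {}" using disjC by (auto simp: disjoint_family_on_def)
      with PC[of i] PC[of j] ij show "P i \<inter> P j = {}" by auto
    qed
  qed (use P in auto)
  also have "\<dots> = (\<Sum>j<N. emeasure lebesgue (B \<inter> C (\<pi> j)))" by (simp only: P)
  also have "\<dots> = (\<Sum>j<N. emeasure lebesgue (B \<inter> C j))"
    by (rule sum.reindex_bij_betw[OF \<pi>])
  also have "\<dots> = emeasure lebesgue (\<Union>j<N. B \<inter> C j)"
  proof (rule sum_emeasure)
    show "disjoint_family_on (\<lambda>j. B \<inter> C j) {..<N}"
      using disjC by (auto simp: disjoint_family_on_def)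
  qed (use B in \<open>auto simp: C_def\<close>)
  also have "\<dots> = emeasure lebesgue ((\<Union>j<N. B \<inter> C j) \<union> (B \<inter> {1}))"
    by (rule emeasure_Un_null_set[OF _ null1, symmetric]) (use B in \<open>auto simp: C_def\<close>)
  also have "(\<Union>j<N. B \<inter> C j) \<union> (B \<inter> {1}) = B"
  proof (intro equalityI subsetI)
    fix y assume y: "y \<in> B"
    show "y \<in> (\<Union>j<N. B \<inter> C j) \<union> (B \<inter> {1})"
    proof (cases "y = 1")
      case False
      with y B have "y \<in> {0..<1}" by force
      with inC[OF this] cell_less[OF N, of y] y show ?thesis by blast
    qed (use y in auto)
  qed auto
  finally show "emeasure lebesgue (?\<phi> -` B \<inter> {0..1}) = emeasure lebesgue B" .
qed

lemma interval_exchange_measurable: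
  assumes N: "N > 0" and \<pi>: "bij_betw \<pi> {..<N} {..<N}"
  shows "interval_exchange N \<pi> \<in> lebesgue_on {0..1} \<rightarrow>\<^sub>M lebesgue_on {0..1}"
proof (rule measurableI)
  have \<pi>': "\<pi> ` {..<N} \<subseteq> {..<N}" using \<pi> by (auto simp: bij_betw_def)
  fix y :: real assume "y \<in> space (lebesgue_on {0..1})"
  then have y: "y \<in> {0..1}" by (simp add: space_restrict_space)
  show "interval_exchange N \<pi> y \<in> space (lebesgue_on {0..1})"
  proof (cases "y \<in> {0..<1}")
    case True
    from interval_exchange_cell(1)[OF N \<pi>' True] show ?thesis by (auto simp: space_restrict_space)
  qed (use y in \<open>auto simp: space_restrict_space interval_exchange_def\<close>)
next
  fix B :: "real set" assume "B \<in> sets (lebesgue_on {0..1})"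
  then have "B \<in> sets lebesgue" "B \<subseteq> {0..1}" by (auto simp: sets_restrict_space_iff)
  from interval_exchange_preimage(1)[OF N \<pi> this]
  show "interval_exchange N \<pi> -` B \<inter> space (lebesgue_on {0..1}) \<in> sets (lebesgue_on {0..1})"
    by (simp add: space_restrict_space sets_restrict_space_iff)
qed

lemma interval_exchange_invertible_mp:
  assumes N: "N > 0" and \<pi>: "bij_betw \<pi> {..<N} {..<N}"
  shows "interval_exchange N \<pi> \<in> invertible_mp"
proof -
  let ?\<phi> = "interval_exchange N \<pi>"
  define \<rho> where "\<rho> = the_inv_into {..<N} \<pi>"
  have \<rho>: "bij_betw \<rho> {..<N} {..<N}" unfolding \<rho>_def by (rule bij_betw_the_inv_into[OF \<pi>])
  have \<pi>': "\<pi> ` {..<N} \<subseteq> {..<N}" and \<rho>': "\<rho> ` {..<N} \<subseteq> {..<N}"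
    using \<pi> \<rho> by (auto simp: bij_betw_def)
  have inv1: "\<rho> (\<pi> j) = j" if "j < N" for j
    unfolding \<rho>_def using that \<pi> by (intro the_inv_into_f_f) (auto simp: bij_betw_def)
  have inv2: "\<pi> (\<rho> j) = j" if "j < N" for j
    unfolding \<rho>_def using that \<pi> by (intro f_the_inv_into_f) (auto simp: bij_betw_def)
  have \<rho>\<phi>: "interval_exchange N \<rho> (?\<phi> y) = y" for y by (rule interval_exchange_inverse[OF N \<pi>' inv1])
  have \<phi>\<rho>: "?\<phi> (interval_exchange N \<rho> y) = y" for y by (rule interval_exchange_inverse[OF N \<rho>' inv2])
  have m\<phi>: "?\<phi> \<in> lebesgue_on {0..1} \<rightarrow>\<^sub>M lebesgue_on {0..1}" by (rule interval_exchange_measurable[OF N \<pi>])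
  have m\<rho>: "interval_exchange N \<rho> \<in> lebesgue_on {0..1} \<rightarrow>\<^sub>M lebesgue_on {0..1}"
    by (rule interval_exchange_measurable[OF N \<rho>])
  have sp: "?\<phi> y \<in> {0..1}" "interval_exchange N \<rho> y \<in> {0..1}" if "y \<in> {0..1}" for y
    using measurable_space[OF m\<phi>, of y] measurable_space[OF m\<rho>, of y] that
    by (simp_all add: space_restrict_space)
  have bij: "bij_betw ?\<phi> {0..1} {0..1}"
    by (rule bij_betw_byWitness[where f' = "interval_exchange N \<rho>"]) (use \<rho>\<phi> \<phi>\<rho> sp in auto)
  have "the_inv_into {0..1} ?\<phi> y = interval_exchange N \<rho> y" if "y \<in> {0..1}" for y
    using bij sp(2)[OF that] \<phi>\<rho> by (intro the_inv_into_f_eq) (auto simp: bij_betw_def)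
  then have minv: "the_inv_into {0..1} ?\<phi> \<in> lebesgue_on {0..1} \<rightarrow>\<^sub>M lebesgue_on {0..1}"
    using m\<rho> by (subst measurable_lebesgue_cong[where g = "interval_exchange N \<rho>"]) auto
  have "distr (lebesgue_on {0..1}) (lebesgue_on {0..1}) ?\<phi> = lebesgue_on {0..1}"
  proof (rule measure_eqI)
    fix B assume "B \<in> sets (distr (lebesgue_on {0..1}) (lebesgue_on {0..1}) ?\<phi>)"
    then have B: "B \<in> sets (lebesgue_on {0..1})" by simp
    then have B': "B \<in> sets lebesgue" "B \<subseteq> {0..1}" by (auto simp: sets_restrict_space_iff)
    have "emeasure (distr (lebesgue_on {0..1}) (lebesgue_on {0..1}) ?\<phi>) B
        = emeasure (lebesgue_on {0..1}) (?\<phi> -` B \<inter> {0..1})"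
      by (subst emeasure_distr[OF m\<phi> B]) (simp add: space_restrict_space)
    also have "\<dots> = emeasure lebesgue (?\<phi> -` B \<inter> {0..1})"
      by (rule emeasure_restrict_space) auto
    also have "\<dots> = emeasure lebesgue B" by (rule interval_exchange_preimage(2)[OF N \<pi> B'])
    also have "\<dots> = emeasure (lebesgue_on {0..1}) B"
      by (rule emeasure_restrict_space[symmetric]) (use B' in auto)
    finally show "emeasure (distr (lebesgue_on {0..1}) (lebesgue_on {0..1}) ?\<phi>) B = emeasure (lebesgue_on {0..1}) B" .
  qed simp
  then show ?thesis using bij m\<phi> minv unfolding invertible_mp_def by simp
qed

section \<open>Bounds for the cut distance\<close>

lemma vertex_part_iff:
  assumes n: "n > 0" and y: "y \<in> {0..<1}" and i: "i \<in> {1..n}"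
  shows "y \<in> vertex_part n i \<longleftrightarrow> i = cell n y + 1"
proof -
  obtain j where j: "i = Suc j" using i by (cases i) auto
  have "i = cell n y + 1 \<longleftrightarrow> cell n y = j" unfolding j by auto
  also have "\<dots> \<longleftrightarrow> (real i - 1) / n \<le> y \<and> y < real i / n"
    using cell_eq_iff[of y n j] y n by (simp add: j add.commute)
  also have "\<dots> \<longleftrightarrow> y \<in> vertex_part n i"
    using y n by (auto simp: vertex_part_def)
  finally show ?thesis by simp
qed

text \<open>The reason for taking \<open>N\<close> to be a multiple of \<open>n\<close>: the fine
  cells refine the vertex parts, and division by \<open>m\<close> finds the part.\<close>

lemma cell_div:
  assumes n: "n > 0" and m: "m > 0" and y: "y \<in> {0..<1}"
  shows "cell (n * m) y div m = cell n y"
proof -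
  let ?c = "cell (n * m) y"
  define j where "j = ?c div m"
  have c: "real ?c / (real n * real m) \<le> y" "y < (real ?c + 1) / (real n * real m)"
    using cell_eq_iff[of y "n * m" ?c] y n m by auto
  have j1: "real j * m \<le> real ?c" unfolding j_def by (metis of_nat_le_iff of_nat_mult div_times_less_eq_dividend)
  have "?c < (j + 1) * m" unfolding j_def using m by (simp add: dividend_less_div_times add.commute)
  then have "real (?c + 1) \<le> real ((j + 1) * m)" by (simp only: of_nat_le_iff)
  then have j2: "real ?c + 1 \<le> (real j + 1) * m" by (simp add: algebra_simps)
  have "real j / n = real j * m / (real n * real m)" using m by simp
  also have "\<dots> \<le> real ?c / (real n * real m)" using j1 by (intro divide_right_mono) auto
  finally have 1: "real j / n \<le> y" using c by linarith
  have "(real ?c + 1) / (real n * real m) \<le> (real j + 1) * m / (real n * real m)"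
    using j2 by (intro divide_right_mono) auto
  also have "\<dots> = (real j + 1) / n" using m by simp
  finally have 2: "y < (real j + 1) / n" using c by linarith
  show ?thesis using cell_eq_iff[of y n j] y n 1 2 by (simp add: j_def)
qed

definition adjacency :: "graph_family \<Rightarrow> nat set \<Rightarrow> nat \<Rightarrow> nat \<Rightarrow> real" where
  "adjacency G I v w = (if {v, w} \<in> (\<Inter>t\<in>I. G t) then 1 else 0)"

lemma adjacency_01: "adjacency G I v w \<in> {0..1}"
  by (simp add: adjacency_def)

lemma graph_graphon_eq:
  assumes n: "n > 0" and xy: "x \<in> {0..<1}" "y \<in> {0..<1}"
  shows "graph_graphon n F (x, y) = (if {cell n x + 1, cell n y + 1} \<in> F then 1 else 0)"
proof -
  have "cell n x + 1 \<in> {1..n}" "cell n y + 1 \<in> {1..n}"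
    using cell_less[OF n, of x] cell_less[OF n, of y] by auto
  then have "(\<exists>i\<in>{1..n}. \<exists>j\<in>{1..n}. (x, y) \<in> vertex_part n i \<times> vertex_part n j \<and> {i, j} \<in> F)
      \<longleftrightarrow> {cell n x + 1, cell n y + 1} \<in> F"
    by (auto simp: vertex_part_iff[OF n xy(1)] vertex_part_iff[OF n xy(2)])
  then show ?thesis by (simp add: graph_graphon_def)
qed

lemma system_graphons_01: "system_graphons n G I p \<in> {0..1}"
  by (simp add: system_graphons_def graph_graphon_def)

text \<open>Functions that are not integrable are covered too, their integral being 0 by convention.
  This keeps the suprema in cut norms bounded for arbitrary rearrangements.\<close>

lemma set_integral_unit_square_le:
  fixes f :: "real \<times> real \<Rightarrow> real"
  assumes "S \<times> T \<subseteq> unit_square" and f: "\<And>p. p \<in> unit_square \<Longrightarrow> \<bar>f p\<bar> \<le> 1"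
  shows "\<bar>LINT p:S \<times> T|lebesgue. f p\<bar> \<le> 1"
proof (cases "set_integrable lebesgue (S \<times> T) f")
  case True
  then have i: "integrable lebesgue (\<lambda>p. indicator (S \<times> T) p *\<^sub>R f p)" by (simp add: set_integrable_def)
  have u: "integrable lebesgue (indicator unit_square :: _ \<Rightarrow> real)"
    by (simp add: emeasure_unit_square)
  have "\<bar>LINT p:S \<times> T|lebesgue. f p\<bar> \<le> (\<integral>p. \<bar>indicator (S \<times> T) p *\<^sub>R f p\<bar> \<partial>lebesgue)"
    unfolding set_lebesgue_integral_def by (rule integral_abs_bound)
  also have "\<dots> \<le> (\<integral>p. indicator unit_square p \<partial>lebesgue)"
  proof (rule integral_mono[OF integrable_abs[OF i] u])
    fix p :: "real \<times> real"
    show "\<bar>indicator (S \<times> T) p *\<^sub>R f p\<bar> \<le> indicator unit_square p"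
      using assms(1) f[of p] by (auto simp: indicator_def)
  qed
  also have "\<dots> = 1" by (simp add: measure_def emeasure_unit_square)
  finally show ?thesis .
next
  case False
  then show ?thesis by (simp add: set_lebesgue_integral_def set_integrable_def not_integrable_integral_eq)
qed

text \<open>Summing over the \<open>2 ^ k\<close> index sets costs one of the three factors
  \<open>2 ^ k\<close> that make up \<open>8 ^ k\<close>.\<close>

lemma cut_norm_le:
  assumes "\<And>I S T. I \<subseteq> {1..k} \<Longrightarrow> S \<in> sets (lebesgue_on {0..1}) \<Longrightarrow> T \<in> sets (lebesgue_on {0..1}) \<Longrightarrow>
    \<bar>LINT p:S \<times> T|lebesgue. D I p\<bar> \<le> c"
  shows "cut_norm k D \<le> 2 ^ k * c"
  unfolding cut_norm_def
proof (rule cSUP_least)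
  fix ST assume ST: "ST \<in> sets (lebesgue_on {0..1::real}) \<times> sets (lebesgue_on {0..1::real})"
  obtain S T where [simp]: "ST = (S, T)" by (cases ST)
  have "(\<Sum>I\<in>Pow {1..k}. \<bar>LINT p:S \<times> T|lebesgue. D I p\<bar>) \<le> (\<Sum>I\<in>Pow {1..k}. c)"
    using ST assms by (intro sum_mono) auto
  then show "(case ST of (S, T) \<Rightarrow> \<Sum>I\<in>Pow {1..k}. \<bar>LINT p:S \<times> T|lebesgue. D I p\<bar>) \<le> 2 ^ k * c"
    by (simp add: card_Pow)
qed auto

lemma cut_norm_nonneg:
  assumes D: "\<And>I p. I \<subseteq> {1..k} \<Longrightarrow> p \<in> unit_square \<Longrightarrow> \<bar>D I p\<bar> \<le> 1"
  shows "0 \<le> cut_norm k D"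
proof -
  let ?X = "sets (lebesgue_on {0..1::real}) \<times> sets (lebesgue_on {0..1::real})"
  let ?f = "\<lambda>(S, T). \<Sum>I\<in>Pow {1..k}. \<bar>LINT p:S \<times> T|lebesgue. D I p\<bar>"
  have "bdd_above (?f ` ?X)"
  proof (rule bdd_aboveI2)
    fix ST assume "ST \<in> ?X"
    then obtain S T where [simp]: "ST = (S, T)" and "S \<subseteq> {0..1}" "T \<subseteq> {0..1}"
      by (cases ST) (auto dest!: sets.sets_into_space simp: space_restrict_space)
    then have "S \<times> T \<subseteq> unit_square" by (auto simp: unit_square_def)
    then show "?f ST \<le> (\<Sum>I\<in>Pow {1..k}. 1)"
      using D by (simp only: \<open>ST = (S, T)\<close> prod.case)
        (intro sum_mono set_integral_unit_square_le, auto)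
  qed
  then have "?f ({}, {}) \<le> cut_norm k D"
    unfolding cut_norm_def by (intro cSUP_upper) auto
  then show ?thesis by (simp add: set_lebesgue_integral_def)
qed

text \<open>An infimum of reals lies below its members only if they are bounded below; nonnegativity
  of the cut norms provides this.\<close>

lemma cut_dist_le:
  assumes W: "\<And>I p. I \<subseteq> {1..k} \<Longrightarrow> p \<in> unit_square \<Longrightarrow> W I p \<in> {0..1}"
    and U: "\<And>I p. U I p \<in> {0..1}" and \<phi>: "\<phi> \<in> invertible_mp"
    and c: "cut_norm k (\<lambda>I (x, y). W I (x, y) - U I (\<phi> x, \<phi> y)) \<le> c"
  shows "cut_dist k W U \<le> c"
proof -
  have "cut_dist k W U \<le> cut_norm k (\<lambda>I (x, y). W I (x, y) - U I (\<phi> x, \<phi> y))"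
    unfolding cut_dist_def
  proof (rule cINF_lower[OF _ \<phi>])
    show "bdd_below ((\<lambda>\<phi>. cut_norm k (\<lambda>I (x, y). W I (x, y) - U I (\<phi> x, \<phi> y))) ` invertible_mp)"
    proof (rule bdd_belowI2)
      fix \<psi> :: "real \<Rightarrow> real"
      show "0 \<le> cut_norm k (\<lambda>I (x, y). W I (x, y) - U I (\<psi> x, \<psi> y))"
      proof (rule cut_norm_nonneg)
        fix I p assume "I \<subseteq> {1..k}" "p \<in> unit_square"
        then show "\<bar>case p of (x, y) \<Rightarrow> W I (x, y) - U I (\<psi> x, \<psi> y)\<bar> \<le> 1"
          using W[of I p] U[of I "(\<psi> (fst p), \<psi> (snd p))"] by (auto simp: split_beta)
      qed
    qed
  qed
  with c show ?thesis by linarith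
qed

text \<open>The difference is split into \<open>W - A\<close> and \<open>A - H\<close>. The first
  part is at most \<open>\<delta>\<close> off a set of measure \<open>\<delta>\<close> and at most 1
  on it. In the second part \<open>S\<close> and \<open>T\<close> act only through the fractions of
  the cells that they cover, and fractional weights obey the cut bound of the matrix.\<close>

lemma set_integral_approx_grid:
  fixes W :: "real \<times> real \<Rightarrow> real"
  assumes N: "N > 0" and W: "W \<in> borel_measurable (lebesgue_on unit_square)"
    and W01: "\<And>p. p \<in> unit_square \<Longrightarrow> W p \<in> {0..1}"
    and A01: "\<And>i j. A i j \<in> {0..1}" and \<delta>: "\<delta> \<ge> 0"
    and approx: "measure (lebesgue_on unit_square)
      {p\<in>unit_square. \<bar>W p - A (cell N (fst p)) (cell N (snd p))\<bar> > \<delta>} \<le> \<delta>"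
    and cb: "cut_bounded {..<N} {..<N} (\<lambda>i j. A i j - H i j) (\<theta> * real N ^ 2)"
    and U: "\<And>x y. x \<in> {0..<1} \<Longrightarrow> y \<in> {0..<1} \<Longrightarrow> U (x, y) = H (cell N x) (cell N y)"
    and S: "S \<in> sets (lebesgue_on {0..1})" and T: "T \<in> sets (lebesgue_on {0..1})"
  shows "\<bar>LINT p:S \<times> T|lebesgue. W p - U p\<bar> \<le> 2 * \<delta> + \<theta>"
proof -
  let ?A = "\<lambda>p. A (cell N (fst p)) (cell N (snd p))"
  let ?B = "\<lambda>p. A (cell N (fst p)) (cell N (snd p)) - H (cell N (fst p)) (cell N (snd p))"
  have S': "S \<in> sets lebesgue" "S \<subseteq> {0..1}" and T': "T \<in> sets lebesgue" "T \<subseteq> {0..1}"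
    using S T by (auto simp: sets_restrict_space_iff)
  have ST: "S \<times> T \<in> sets lebesgue" by (rule lebesgue_Times(1)[OF S'(1) T'(1)])
  have STu: "S \<times> T \<subseteq> unit_square" using S' T' by (auto simp: unit_square_def)
  define D where "D = {p\<in>unit_square. \<bar>W p - ?A p\<bar> > \<delta>}"
  have Am: "?A \<in> borel_measurable lebesgue" by (intro measurable_completion) simp
  have Wm: "(\<lambda>p. if p \<in> unit_square then W p else 0) \<in> borel_measurable lebesgue"
    by (rule borel_measurable_if_I[OF W unit_square_sets(2)])
  have Dsub: "D \<subseteq> unit_square" unfolding D_def by (rule Collect_subset)
  have Dm: "D \<in> sets (lebesgue_on unit_square)"
  proof -
    have [measurable]: "W \<in> borel_measurable (lebesgue_on unit_square)" "?A \<in> borel_measurable (lebesgue_on unit_square)"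
      using W Am by (auto intro: measurable_restrict_space1)
    have "{p\<in>space (lebesgue_on unit_square). \<bar>W p - ?A p\<bar> > \<delta>} \<in> sets (lebesgue_on unit_square)"
      by measurable
    moreover have "space (lebesgue_on unit_square) = unit_square" by (simp add: space_restrict_space)
    ultimately show ?thesis unfolding D_def by (simp only:)
  qed
  then have Dl: "D \<in> sets lebesgue" by (subst (asm) sets_restrict_space_iff) simp_all
  have mD: "measure lebesgue D \<le> \<delta>"
  proof -
    have "measure (lebesgue_on unit_square) D = measure lebesgue D"
      by (rule measure_restrict_space) (simp_all add: Dsub)
    then show ?thesis using approx unfolding D_def by (simp only:)
  qed
  have fin: "emeasure lebesgue X < \<infinity>" if "X \<in> sets lebesgue" "X \<subseteq> unit_square" for X
  proof -
    have "emeasure lebesgue X \<le> emeasure lebesgue unit_square" by (intro emeasure_mono that) auto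
    then show ?thesis by (simp add: emeasure_unit_square less_le_trans order_le_less_trans)
  qed
  have iu: "integrable lebesgue (indicator X :: _ \<Rightarrow> real)" if "X \<in> sets lebesgue" "X \<subseteq> unit_square" for X
    using that fin[OF that] by (simp add: integrable_indicator_iff)
  have int1: "integrable lebesgue (\<lambda>p. indicator (S \<times> T) p * (W p - ?A p))"
  proof (rule Bochner_Integration.integrable_bound[OF iu[OF ST STu]])
    have "(\<lambda>p. indicator (S \<times> T) p * ((if p \<in> unit_square then W p else 0) - ?A p)) \<in> borel_measurable lebesgue"
      using ST by (intro borel_measurable_times borel_measurable_diff Wm Am borel_measurable_indicator)
    also have "(\<lambda>p. indicator (S \<times> T) p * ((if p \<in> unit_square then W p else 0) - ?A p))
        = (\<lambda>p. indicator (S \<times> T) p * (W p - ?A p))"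
      using STu by (auto simp: fun_eq_iff indicator_def)
    finally show "(\<lambda>p. indicator (S \<times> T) p * (W p - ?A p)) \<in> borel_measurable lebesgue" .
    show "AE p in lebesgue. norm (indicator (S \<times> T) p * (W p - ?A p)) \<le> norm (indicator (S \<times> T) p :: real)"
    proof (rule AE_I2)
      fix p
      show "norm (indicator (S \<times> T) p * (W p - ?A p)) \<le> norm (indicator (S \<times> T) p :: real)"
      proof (cases "p \<in> S \<times> T")
        case True
        then have "p \<in> unit_square" using STu by blast
        from W01[OF this] A01[of "cell N (fst p)" "cell N (snd p)"] have "\<bar>W p - ?A p\<bar> \<le> 1"
          by (simp add: abs_le_iff)
        then show ?thesis using True by simp
      qed simp
    qed
  qed
  have bound1: "\<bar>\<integral>p. indicator (S \<times> T) p * (W p - ?A p) \<partial>lebesgue\<bar> \<le> 2 * \<delta>"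
  proof -
    have "\<bar>\<integral>p. indicator (S \<times> T) p * (W p - ?A p) \<partial>lebesgue\<bar> \<le> (\<integral>p. \<bar>indicator (S \<times> T) p * (W p - ?A p)\<bar> \<partial>lebesgue)"
      by (rule integral_abs_bound)
    also have "\<dots> \<le> (\<integral>p. \<delta> * indicator unit_square p + indicator D p \<partial>lebesgue)"
    proof (rule integral_mono[OF integrable_abs[OF int1]])
      show "integrable lebesgue (\<lambda>p. \<delta> * indicator unit_square p + indicator D p)"
        using Dl Dsub by (intro Bochner_Integration.integrable_add integrable_mult_right iu) simp_all
      fix p :: "real \<times> real"
      show "\<bar>indicator (S \<times> T) p * (W p - ?A p)\<bar> \<le> \<delta> * indicator unit_square p + indicator D p"
      proof (cases "p \<in> S \<times> T")
        case True
        then have p: "p \<in> unit_square" using STu by blast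
        show ?thesis
        proof (cases "p \<in> D")
          case True
          from W01[OF p] A01[of "cell N (fst p)" "cell N (snd p)"] have "\<bar>W p - ?A p\<bar> \<le> 1"
            by (simp add: abs_le_iff)
          then show ?thesis using True p \<open>p \<in> S \<times> T\<close> \<delta> by simp
        next
          case False
          then have "\<bar>W p - ?A p\<bar> \<le> \<delta>" using p by (simp add: D_def)
          then show ?thesis using False p \<open>p \<in> S \<times> T\<close> by simp
        qed
      next
        case False
        then show ?thesis using \<delta> by simp
      qed
    qed
    also have "\<dots> = \<delta> * measure lebesgue unit_square + measure lebesgue D"
      using Dl Dsub by (subst Bochner_Integration.integral_add) (simp_all add: iu)
    also have "\<dots> \<le> 2 * \<delta>" using mD by (simp add: measure_def emeasure_unit_square)
    finally show ?thesis .
  qed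
  define C where "C X j = {y\<in>X. cell N y = j}" for X :: "real set" and j
  have C: "C X j \<in> sets lebesgue" if "X \<in> sets lebesgue" for X j
  proof -
    have "cell N -` {j} \<inter> space borel \<in> sets borel" by (rule measurable_sets[OF measurable_cell]) simp
    then have "X \<inter> (cell N -` {j}) \<in> sets lebesgue" using that by auto
    also have "X \<inter> (cell N -` {j}) = C X j" by (auto simp: C_def)
    finally show ?thesis .
  qed
  have mC: "measure lebesgue (C X j) \<le> 1 / N" "emeasure lebesgue (C X j) = ennreal (measure lebesgue (C X j))"
    if X: "X \<in> sets lebesgue" "X \<subseteq> {0..1}" and j: "j < N" for X j
  proof -
    have 1: "measure lebesgue (C {0..1} j) = 1 / N"
      using measure_cell[OF j] by (subst (asm) measure_restrict_space) (auto simp: C_def)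
    have f: "C {0..1} j \<in> lmeasurable"
    proof (rule fmeasurableI2)
      show "{0..1::real} \<in> lmeasurable" by (simp add: fmeasurable_def)
      show "C {0..1} j \<subseteq> {0..1}" unfolding C_def by (rule Collect_subset)
      show "C {0..1} j \<in> sets lebesgue" by (rule C) simp
    qed
    have f': "C X j \<in> lmeasurable"
      by (rule fmeasurableI2[OF f _ C[OF X(1)]]) (use X in \<open>auto simp: C_def\<close>)
    show "measure lebesgue (C X j) \<le> 1 / N"
      unfolding 1[symmetric] by (rule measure_mono_fmeasurable[OF _ C[OF X(1)] f]) (use X in \<open>auto simp: C_def\<close>)
    show "emeasure lebesgue (C X j) = ennreal (measure lebesgue (C X j))"
      using f' by (simp add: emeasure_eq_measure2)
  qed
  have expand: "indicator (S \<times> T) p * ?B p = (\<Sum>i<N. \<Sum>j<N. (A i j - H i j) * indicator (C S i \<times> C T j) p)" for p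
  proof -
    obtain x y where p: "p = (x, y)" by (cases p)
    have "(\<Sum>i<N. \<Sum>j<N. (A i j - H i j) * indicator (C S i \<times> C T j) p)
      = (\<Sum>i<N. \<Sum>j<N. if i = cell N x then (if j = cell N y then (A i j - H i j) * indicator (S \<times> T) p else 0) else 0)"
      by (intro sum.cong refl) (auto simp: p C_def indicator_def)
    also have "\<dots> = (\<Sum>i<N. if i = cell N x then (\<Sum>j<N. if j = cell N y then (A i j - H i j) * indicator (S \<times> T) p else 0) else 0)"
      by (intro sum.cong refl) auto
    also have "\<dots> = ?B p * indicator (S \<times> T) p"
      using cell_less[OF N, of x] cell_less[OF N, of y] by (simp add: p)
    finally show ?thesis by simp
  qed
  have CC: "C S i \<times> C T j \<in> sets lebesgue" "C S i \<times> C T j \<subseteq> unit_square" for i j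
    using lebesgue_Times(1)[OF C[OF S'(1)] C[OF T'(1)]] STu by (auto simp: C_def)
  have intB: "integrable lebesgue (\<lambda>p. indicator (S \<times> T) p * ?B p)"
    unfolding expand by (intro Bochner_Integration.integrable_sum integrable_mult_right iu CC)
  have "(\<integral>p. indicator (S \<times> T) p * ?B p \<partial>lebesgue)
      = (\<Sum>i<N. \<Sum>j<N. (A i j - H i j) * measure lebesgue (C S i \<times> C T j))"
  proof -
    have "(\<integral>p. indicator (S \<times> T) p * ?B p \<partial>lebesgue)
      = (\<integral>p. (\<Sum>i<N. \<Sum>j<N. (A i j - H i j) * indicator (C S i \<times> C T j) p) \<partial>lebesgue)"
      by (simp only: expand)
    also have "\<dots> = (\<Sum>i<N. \<Sum>j<N. \<integral>p. (A i j - H i j) * indicator (C S i \<times> C T j) p \<partial>lebesgue)"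
      by (subst Bochner_Integration.integral_sum;
        (intro sum.cong refl Bochner_Integration.integral_sum Bochner_Integration.integrable_sum integrable_mult_right iu CC)?)
    also have "\<dots> = (\<Sum>i<N. \<Sum>j<N. (A i j - H i j) * measure lebesgue (C S i \<times> C T j))"
      by simp
    finally show ?thesis .
  qed
  also have "\<dots> = (\<Sum>i<N. \<Sum>j<N. (real N * measure lebesgue (C S i)) * (real N * measure lebesgue (C T j)) * (A i j - H i j)) / real N ^ 2"
  proof -
    have m: "measure lebesgue (C S i \<times> C T j) = measure lebesgue (C S i) * measure lebesgue (C T j)" for i j
      unfolding measure_def using lebesgue_Times(2)[OF C[OF S'(1)] C[OF T'(1)], of i j] by (simp add: enn2real_mult)
    show ?thesis unfolding m sum_divide_distrib
      using N by (intro sum.cong refl) (simp add: power2_eq_square)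
  qed
  finally have intBeq: "(\<integral>p. indicator (S \<times> T) p * ?B p \<partial>lebesgue)
    = (\<Sum>i<N. \<Sum>j<N. (real N * measure lebesgue (C S i)) * (real N * measure lebesgue (C T j)) * (A i j - H i j)) / real N ^ 2" .
  have w: "\<forall>i\<in>{..<N}. real N * measure lebesgue (C X i) \<in> {0..1}" if "X \<in> sets lebesgue" "X \<subseteq> {0..1}" for X
  proof
    fix i assume "i \<in> {..<N}"
    then show "real N * measure lebesgue (C X i) \<in> {0..1}"
      using mC(1)[OF that, of i] N by (simp add: field_simps)
  qed
  have bound2: "\<bar>\<integral>p. indicator (S \<times> T) p * ?B p \<partial>lebesgue\<bar> \<le> \<theta>"
  proof -
    show ?thesis
      unfolding intBeq abs_divide using cut_bounded_weighted[OF _ _ cb w[OF S'] w[OF T']] N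
      by (simp add: divide_le_eq)
  qed
  have "(LINT p:S \<times> T|lebesgue. W p - U p)
      = (\<integral>p. indicator (S \<times> T) p * (W p - ?A p) + indicator (S \<times> T) p * ?B p \<partial>lebesgue)"
    unfolding set_lebesgue_integral_def
  proof (rule integral_cong_AE)
    \<comment> \<open>\<open>U\<close> is known on the half-open square only; the two lines through
      the endpoint 1 are null.\<close>
    define Z where "Z = ({1} \<times> UNIV \<union> UNIV \<times> {1} :: (real \<times> real) set)"
    have Z: "Z \<in> null_sets lebesgue"
    proof -
      have s: "{1::real} \<in> sets lebesgue" "(UNIV :: real set) \<in> sets lebesgue"
        by (intro sets_completionI_sets; simp)+
      note lebesgue_Times(1)[OF s(1,2)] lebesgue_Times(1)[OF s(2,1)]
      moreover have "emeasure lebesgue ({1::real} \<times> (UNIV :: real set)) = 0" "emeasure lebesgue ((UNIV :: real set) \<times> {1::real}) = 0"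
        by (simp_all add: lebesgue_Times(2)[OF s(1,2)] lebesgue_Times(2)[OF s(2,1)])
      ultimately show ?thesis unfolding Z_def by (intro null_sets.Un) (auto simp: null_sets_def)
    qed
    have eq: "indicator (S \<times> T) p *\<^sub>R (W p - U p) = indicator (S \<times> T) p * (W p - ?A p) + indicator (S \<times> T) p * ?B p"
      if "p \<notin> Z" for p
    proof (cases "p \<in> S \<times> T")
      case True
      obtain x y where p: "p = (x, y)" by (cases p)
      have "x \<in> {0..1}" "y \<in> {0..1}" "x \<noteq> 1" "y \<noteq> 1" using True that S' T' by (auto simp: p Z_def)
      then have "U p = H (cell N x) (cell N y)" unfolding p by (intro U) auto
      with True show ?thesis by (simp add: p)
    qed simp
    show AE: "AE p in lebesgue. indicator (S \<times> T) p *\<^sub>R (W p - U p)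
        = indicator (S \<times> T) p * (W p - ?A p) + indicator (S \<times> T) p * ?B p"
      using AE_not_in[OF Z] by eventually_elim (rule eq)
    show m: "(\<lambda>p. indicator (S \<times> T) p * (W p - ?A p) + indicator (S \<times> T) p * ?B p) \<in> borel_measurable lebesgue"
      using int1 intB by (intro borel_measurable_add borel_measurable_integrable)
    show "(\<lambda>p. indicator (S \<times> T) p *\<^sub>R (W p - U p)) \<in> borel_measurable lebesgue"
      by (rule borel_measurable_AE[OF m]) (use AE in eventually_elim, rule sym)
  qed
  also have "\<dots> = (\<integral>p. indicator (S \<times> T) p * (W p - ?A p) \<partial>lebesgue) + (\<integral>p. indicator (S \<times> T) p * ?B p \<partial>lebesgue)"
    by (rule Bochner_Integration.integral_add[OF int1 intB])
  finally show ?thesis using bound1 bound2 by linarith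
qed

section \<open>Noise of the random graph system\<close>

lemma mem_labels_to_graphs:
  assumes "v \<in> {1..n}" "w \<in> {1..n}"
  shows "{v, w} \<in> labels_to_graphs n L t \<longleftrightarrow> v \<noteq> w \<and> t \<in> L (ordered_pair v w)"
proof
  assume "{v, w} \<in> labels_to_graphs n L t"
  then obtain i j where ij: "{v, w} = {i, j}" "(i, j) \<in> vertex_pairs n" "t \<in> L (i, j)"
    by (auto simp: labels_to_graphs_def)
  then have "i < j" by (simp add: vertex_pairs_def)
  with ij have "v \<noteq> w" "ordered_pair v w = (i, j)"
    by (auto simp: doubleton_eq_iff ordered_pair_def)
  with ij show "v \<noteq> w \<and> t \<in> L (ordered_pair v w)" by simp
next
  assume a: "v \<noteq> w \<and> t \<in> L (ordered_pair v w)"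
  have "{v, w} = {min v w, max v w}" by (auto simp: min_def max_def)
  moreover have "(min v w, max v w) \<in> vertex_pairs n"
    using assms a by (auto simp: vertex_pairs_def min_def max_def)
  ultimately show "{v, w} \<in> labels_to_graphs n L t"
    using a unfolding labels_to_graphs_def ordered_pair_def by blast
qed

lemma adjacency_labels_to_graphs:
  assumes "v \<in> {1..n}" "w \<in> {1..n}" "I \<noteq> {}"
  shows "adjacency (labels_to_graphs n L) I v w
    = (if v \<noteq> w \<and> I \<subseteq> L (ordered_pair v w) then 1 else 0)"
  using assms(3) unfolding adjacency_def by (auto simp: mem_labels_to_graphs[OF assms(1,2)])

lemma ordered_pair_in: "v \<in> {1..n} \<Longrightarrow> w \<in> {1..n} \<Longrightarrow> v \<noteq> w \<Longrightarrow> ordered_pair v w \<in> vertex_pairs n"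
  by (auto simp: ordered_pair_def vertex_pairs_def min_def max_def)

lemma finite_label_pmf:
  "graphon_system k W \<Longrightarrow> p \<in> unit_square \<Longrightarrow> finite (set_pmf (label_pmf k W p))"
  using set_label_pmf[of k W p] finite_subset by fastforce

lemma expectation_label_superset:
  assumes W: "graphon_system k W" and p: "p \<in> unit_square" "regular_point k W p" and I: "I \<subseteq> {1..k}"
  shows "E (label_pmf k W p) (\<lambda>S. if I \<subseteq> S then 1 else 0) = W I p"
proof -
  have "E (label_pmf k W p) (\<lambda>S. if I \<subseteq> S then 1 else 0)
      = (\<Sum>S\<in>Pow {1..k}. pmf (label_pmf k W p) S * (if I \<subseteq> S then 1 else 0))"
    using set_label_pmf[OF W p(1)] by (subst integral_measure_pmf[of "Pow {1..k}"]) auto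
  also have "\<dots> = (\<Sum>S\<in>Pow {1..k}. if I \<subseteq> S then wbar k W S p else 0)"
    by (intro sum.cong refl) (auto simp: pmf_label_pmf[OF W p])
  also have "\<dots> = (\<Sum>S\<in>{S\<in>Pow {1..k}. I \<subseteq> S}. wbar k W S p)"
    by (rule sum.inter_filter[symmetric]) simp
  also have "{S\<in>Pow {1..k}. I \<subseteq> S} = {S. I \<subseteq> S \<and> S \<subseteq> {1..k}}" by auto
  also have "(\<Sum>S\<in>\<dots>. wbar k W S p) = W I p" by (rule sum_wbar[OF I])
  finally show ?thesis .
qed

lemma graphon_system_01: "graphon_system k W \<Longrightarrow> I \<subseteq> {1..k} \<Longrightarrow> p \<in> unit_square \<Longrightarrow> W I p \<in> {0..1}"
  unfolding graphon_system_def graphon_def by blast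

lemma graphon_system_sym:
  "graphon_system k W \<Longrightarrow> I \<subseteq> {1..k} \<Longrightarrow> (x, y) \<in> unit_square \<Longrightarrow> W I (x, y) = W I (y, x)"
proof -
  assume W: "graphon_system k W" "I \<subseteq> {1..k}" and p: "(x, y) \<in> unit_square"
  then have "\<forall>(x, y)\<in>unit_square. W I (x, y) = W I (y, x)"
    unfolding graphon_system_def graphon_def by blast
  from bspec[OF this p] show ?thesis by simp
qed

text \<open>Zero on the diagonal, where no label is drawn and the graphs have no loops. The diagonal
  is accounted for separately, at the cost of \<open>1 / n\<close>.\<close>

definition noise :: "nat \<Rightarrow> graphon_family \<Rightarrow> (nat \<Rightarrow> real) \<Rightarrow> nat set \<Rightarrow> graph_family \<Rightarrow> nat \<Rightarrow> nat \<Rightarrow> real" where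
  "noise n W x I G v w = (if v = w then 0 else W I (x v, x w) - adjacency G I v w)"

text \<open>Given the sample, the off-diagonal entries are functions of independent labels, and they
  are centred because at a regular point a label contains \<open>I\<close> with probability
  \<open>W I\<close>. Markov's inequality is applied to the sum of the absolute row
  products.\<close>

lemma prob_noise_one:
  assumes W: "graphon_system k W" and x: "x \<in> space (sample_space n)" and n: "n > 0"
    and reg: "\<And>v w. v \<in> {1..n} \<Longrightarrow> w \<in> {1..n} \<Longrightarrow> v \<noteq> w \<Longrightarrow> regular_point k W (x v, x w)"
    and I: "I \<subseteq> {1..k}" "I \<noteq> {}" and \<xi>: "\<xi> > 0"
  shows "measure (measure_pmf (conditional_graphs k W n x))
      {G. \<not> cut_bounded {1..n} {1..n} (noise n W x I G) (\<xi> * real n ^ 2)} \<le> (sqrt n + 3) / (\<xi>\<^sup>2 * n)"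
proof -
  let ?V = "{1..n}"
  define p where "p = (\<lambda>(i, j). label_pmf k W (x i, x j))"
  let ?P = "Pi_pmf (vertex_pairs n) {} p"
  define f :: "nat \<times> nat \<Rightarrow> nat set \<Rightarrow> real"
    where "f e S = W I (x (fst e), x (snd e)) - (if I \<subseteq> S then 1 else 0)" for e S
  define B where "B L v w = (if v = w then 0 else f (ordered_pair v w) (L (ordered_pair v w)))"
    for L :: "nat \<times> nat \<Rightarrow> nat set" and v w
  have sq: "(x (fst e), x (snd e)) \<in> unit_square" "regular_point k W (x (fst e), x (snd e))"
    if "e \<in> vertex_pairs n" for e
  proof -
    from that have "(fst e, snd e) \<in> vertex_pairs n" by simp
    from vertex_pairsD[OF this] have m: "fst e \<in> {1..n}" "snd e \<in> {1..n}" "fst e \<noteq> snd e" by auto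
    show "(x (fst e), x (snd e)) \<in> unit_square" by (rule sample_pair_in_unit_square[OF x m(1,2)])
    show "regular_point k W (x (fst e), x (snd e))" by (rule reg[OF m])
  qed
  have p_eq: "p e = label_pmf k W (x (fst e), x (snd e))" for e by (simp add: p_def split_beta)
  have fin: "\<forall>e\<in>vertex_pairs n. finite (set_pmf (p e))"
    using finite_label_pmf[OF W sq(1)] by (simp add: p_eq)
  have fP: "finite (set_pmf ?P)" by (rule finite_set_Pi_pmf[OF finite_vertex_pairs fin])
  define \<Gamma> where "\<Gamma> L = (\<Sum>v\<in>?V. \<Sum>v'\<in>?V. \<bar>\<Sum>w\<in>?V. B L v w * B L v' w\<bar>)" for L
  have E\<Gamma>: "E ?P \<Gamma> \<le> real (card ?V) ^ 2 * (sqrt (card ?V) + 3)"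
    unfolding \<Gamma>_def
  proof (rule expectation_row_products[OF finite_vertex_pairs fin, where f = f])
    fix e S assume e: "e \<in> vertex_pairs n"
    show "\<bar>f e S\<bar> \<le> 1" using graphon_system_01[OF W I(1) sq(1)[OF e]] by (auto simp: f_def)
  next
    fix e assume e: "e \<in> vertex_pairs n"
    have "E (p e) (f e) = E (p e) (\<lambda>_. W I (x (fst e), x (snd e))) - E (p e) (\<lambda>S. if I \<subseteq> S then 1 else 0)"
      unfolding f_def using fin e
      by (intro Bochner_Integration.integral_diff integrable_measure_pmf_finite) auto
    also have "\<dots> = 0"
      using expectation_label_superset[OF W sq[OF e] I(1)] by (simp add: p_eq)
    finally show "E (p e) (f e) = 0" .
  qed (auto simp: B_def intro: ordered_pair_in)
  have B_noise: "noise n W x I (labels_to_graphs n L) v w = B L v w" if "v \<in> ?V" "w \<in> ?V" for L v w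
  proof (cases "v = w")
    case False
    have "W I (x v, x w) = W I (x (fst (ordered_pair v w)), x (snd (ordered_pair v w)))"
      using graphon_system_sym[OF W I(1) sample_pair_in_unit_square[OF x that]]
      by (auto simp: ordered_pair_def min_def max_def)
    then show ?thesis
      using False adjacency_labels_to_graphs[OF that I(2), of L] by (simp add: noise_def B_def f_def)
  qed (simp add: noise_def B_def)
  \<comment> \<open>The threshold makes \<open>n * \<Gamma> L\<close> comparable with the square of
    \<open>\<xi> * n ^ 2\<close>, that is, \<open>\<Gamma> L\<close> with
    \<open>\<xi> ^ 2 * n ^ 3\<close>, while the mean of \<open>\<Gamma>\<close> is only of order
    n^(5/2).\<close>
  have bad: "\<Gamma> L \<ge> \<xi>\<^sup>2 * real n ^ 3"
    if "\<not> cut_bounded ?V ?V (noise n W x I (labels_to_graphs n L)) (\<xi> * real n ^ 2)" for L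
  proof (rule ccontr)
    assume "\<not> \<Gamma> L \<ge> \<xi>\<^sup>2 * real n ^ 3"
    then have "card ?V * \<Gamma> L \<le> n * (\<xi>\<^sup>2 * real n ^ 3)" by (simp add: mult_left_mono)
    also have "\<dots> = (\<xi> * real n ^ 2)\<^sup>2" by (simp add: power_mult_distrib eval_nat_numeral)
    finally have "cut_bounded ?V ?V (B L) (\<xi> * real n ^ 2)"
      unfolding \<Gamma>_def using \<xi> by (intro cut_bounded_row_products) auto
    then have "cut_bounded ?V ?V (noise n W x I (labels_to_graphs n L)) (\<xi> * real n ^ 2)"
      using cut_bounded_cong[of ?V ?V "noise n W x I (labels_to_graphs n L)" "B L"] B_noise by blast
    with that show False by simp
  qed
  have "measure (measure_pmf (conditional_graphs k W n x))
      {G. \<not> cut_bounded ?V ?V (noise n W x I G) (\<xi> * real n ^ 2)}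
      = measure ?P {L. \<not> cut_bounded ?V ?V (noise n W x I (labels_to_graphs n L)) (\<xi> * real n ^ 2)}"
    by (simp add: conditional_graphs_def p_def measure_map_pmf vimage_def)
  also have "\<dots> \<le> measure ?P {L\<in>space ?P. \<Gamma> L \<ge> \<xi>\<^sup>2 * real n ^ 3}"
    using bad by (intro measure_pmf.finite_measure_mono) auto
  also have "\<dots> \<le> E ?P \<Gamma> / (\<xi>\<^sup>2 * real n ^ 3)"
    using \<xi> n
    by (intro integral_Markov_inequality_measure[where A = "{}"] integrable_measure_pmf_finite fP)
      (auto simp: \<Gamma>_def intro!: AE_I2 sum_nonneg)
  also have "\<dots> \<le> (real n ^ 2 * (sqrt n + 3)) / (\<xi>\<^sup>2 * real n ^ 3)"
    using E\<Gamma> \<xi> by (intro divide_right_mono) auto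
  also have "\<dots> = (sqrt n + 3) / (\<xi>\<^sup>2 * n)"
    using n \<xi> by (simp add: field_simps eval_nat_numeral)
  finally show ?thesis .
qed

lemma prob_noise:
  assumes W: "graphon_system k W" and x: "x \<in> space (sample_space n)" and n: "n > 0"
    and reg: "\<And>v w. v \<in> {1..n} \<Longrightarrow> w \<in> {1..n} \<Longrightarrow> v \<noteq> w \<Longrightarrow> regular_point k W (x v, x w)"
    and \<xi>: "\<xi> > 0"
  shows "measure (measure_pmf (conditional_graphs k W n x))
      {G. \<forall>I\<in>Pow {1..k} - {{}}. cut_bounded {1..n} {1..n} (noise n W x I G) (\<xi> * real n ^ 2)}
    \<ge> 1 - 2 ^ k * ((sqrt n + 3) / (\<xi>\<^sup>2 * n))"
proof -
  let ?P = "measure_pmf (conditional_graphs k W n x)"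
  let ?bad = "\<lambda>I. {G. \<not> cut_bounded {1..n} {1..n} (noise n W x I G) (\<xi> * real n ^ 2)}"
  let ?good = "{G. \<forall>I\<in>Pow {1..k} - {{}}. cut_bounded {1..n} {1..n} (noise n W x I G) (\<xi> * real n ^ 2)}"
  have "measure ?P (\<Union>I\<in>Pow {1..k} - {{}}. ?bad I) \<le> (\<Sum>I\<in>Pow {1..k} - {{}}. measure ?P (?bad I))"
    by (rule measure_pmf.finite_measure_subadditive_finite) auto
  also have "\<dots> \<le> (\<Sum>I\<in>Pow {1..k} - {{}}. (sqrt n + 3) / (\<xi>\<^sup>2 * n))"
    by (intro sum_mono prob_noise_one[OF W x n reg _ _ \<xi>]) auto
  also have "\<dots> \<le> (\<Sum>I\<in>Pow {1..k}. (sqrt n + 3) / (\<xi>\<^sup>2 * n))"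
    using \<xi> by (intro sum_mono2) auto
  also have "\<dots> = 2 ^ k * ((sqrt n + 3) / (\<xi>\<^sup>2 * n))"
    by (simp add: card_Pow)
  finally have "measure ?P (\<Union>I\<in>Pow {1..k} - {{}}. ?bad I) \<le> 2 ^ k * ((sqrt n + 3) / (\<xi>\<^sup>2 * n))" .
  moreover have "?good = - (\<Union>I\<in>Pow {1..k} - {{}}. ?bad I)" by auto
  then have "measure ?P ?good = 1 - measure ?P (\<Union>I\<in>Pow {1..k} - {{}}. ?bad I)"
    using measure_pmf.prob_compl[of "\<Union>I\<in>Pow {1..k} - {{}}. ?bad I" "conditional_graphs k W n x"]
    by (simp add: Compl_eq_Diff_UNIV)
  ultimately show ?thesis by linarith
qed

text \<open>Cell \<open>i\<close> is carried to cell \<open>\<pi> i\<close>, which lies in the part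
  of vertex \<open>\<pi> i div m + 1\<close>; the 1 is added because cells are numbered from 0 and
  vertices from 1. For \<open>I = {}\<close> both graphons are constantly 1 on the square.\<close>

lemma cut_dist_graphs_le:
  assumes W: "graphon_system k W" and n: "n > 0" and m: "m > 0" and N: "N = n * m"
    and \<pi>: "bij_betw \<pi> {..<N} {..<N}" and \<delta>: "\<delta> \<ge> 0" and \<theta>: "\<theta> \<ge> 0"
    and A: "\<And>I i j. I \<in> Pow {1..k} - {{}} \<Longrightarrow> A I i j \<in> {0..1 :: real}"
    and approx: "\<And>I. I \<in> Pow {1..k} - {{}} \<Longrightarrow> measure (lebesgue_on unit_square)
      {p\<in>unit_square. \<bar>W I p - A I (cell N (fst p)) (cell N (snd p))\<bar> > \<delta>} \<le> \<delta>"
    and cb: "\<And>I. I \<in> Pow {1..k} - {{}} \<Longrightarrow> cut_bounded {..<N} {..<N}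
      (\<lambda>i j. A I i j - adjacency G I (\<pi> i div m + 1) (\<pi> j div m + 1)) (\<theta> * real N ^ 2)"
  shows "cut_dist k W (system_graphons n G) \<le> 2 ^ k * (2 * \<delta> + \<theta>)"
proof (rule cut_dist_le)
  have N0: "N > 0" using N n m by simp
  show "interval_exchange N \<pi> \<in> invertible_mp" by (rule interval_exchange_invertible_mp[OF N0 \<pi>])
  show "W I p \<in> {0..1}" if "I \<subseteq> {1..k}" "p \<in> unit_square" for I p
    by (rule graphon_system_01[OF W that])
  show "system_graphons n G I p \<in> {0..1}" for I p by (rule system_graphons_01)
  let ?\<phi> = "interval_exchange N \<pi>"
  show "cut_norm k (\<lambda>I (x, y). W I (x, y) - system_graphons n G I (?\<phi> x, ?\<phi> y)) \<le> 2 ^ k * (2 * \<delta> + \<theta>)"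
  proof (rule cut_norm_le)
    fix I :: "nat set" and S T
    assume I: "I \<subseteq> {1..k}" and S: "S \<in> sets (lebesgue_on {0..1::real})" and T: "T \<in> sets (lebesgue_on {0..1::real})"
    define U where "U p = system_graphons n G I (?\<phi> (fst p), ?\<phi> (snd p))" for p
    have eq: "(\<lambda>p. case p of (x, y) \<Rightarrow> W I (x, y) - system_graphons n G I (?\<phi> x, ?\<phi> y)) = (\<lambda>p. W I p - U p)"
      by (auto simp: U_def fun_eq_iff)
    show "\<bar>LINT p:S \<times> T|lebesgue. case p of (x, y) \<Rightarrow> W I (x, y) - system_graphons n G I (?\<phi> x, ?\<phi> y)\<bar> \<le> 2 * \<delta> + \<theta>"
    proof (cases "I = {}")
      case True
      have "S \<subseteq> {0..1}" "T \<subseteq> {0..1}" using S T by (auto simp: sets_restrict_space_iff)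
      then have sub: "S \<times> T \<subseteq> unit_square" by (auto simp: unit_square_def)
      have "indicator (S \<times> T) p *\<^sub>R (W I p - U p) = 0" for p
      proof (cases "p \<in> S \<times> T")
        case p: True
        have "\<forall>p\<in>unit_square. W {} p = 1" using W by (simp add: graphon_system_def)
        then have "W I p = 1" using subsetD[OF sub p] True by simp
        then show ?thesis using True by (simp add: U_def system_graphons_def)
      qed simp
      then have "(LINT p:S \<times> T|lebesgue. W I p - U p) = 0"
        unfolding set_lebesgue_integral_def by (simp only: integral_zero)
      then show ?thesis using \<delta> \<theta> by (simp add: eq)
    next
      case False
      with I have I': "I \<in> Pow {1..k} - {{}}" by auto
      have \<pi>': "\<pi> ` {..<N} \<subseteq> {..<N}" using \<pi> by (auto simp: bij_betw_def)
      have Ueq: "U (x, y) = adjacency G I (\<pi> (cell N x) div m + 1) (\<pi> (cell N y) div m + 1)"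
        if xy: "x \<in> {0..<1}" "y \<in> {0..<1}" for x y
      proof -
        have c: "cell n (?\<phi> z) = \<pi> (cell N z) div m" if "z \<in> {0..<1}" for z
          using interval_exchange_cell[OF N0 \<pi>' that] cell_div[OF n m, of "?\<phi> z"] N by simp
        have "U (x, y) = graph_graphon n (\<Inter>t\<in>I. G t) (?\<phi> x, ?\<phi> y)"
          using False by (simp add: U_def system_graphons_def)
        then show ?thesis
          unfolding adjacency_def c[OF xy(1), symmetric] c[OF xy(2), symmetric]
          using graph_graphon_eq[OF n interval_exchange_cell(1)[OF N0 \<pi>' xy(1)] interval_exchange_cell(1)[OF N0 \<pi>' xy(2)]]
          by simp
      qed
      show ?thesis unfolding eq
        by (rule set_integral_approx_grid[OF N0 _ _ A[OF I'] \<delta> approx[OF I'] cb[OF I'] Ueq S T])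
          (use graphon_system_01[OF W I] W I in \<open>auto simp: graphon_system_def intro: graphon_measurable\<close>)
    qed
  qed
qed

section \<open>Error terms of the sample\<close>

text \<open>The probing errors of \<open>U\<close> and \<open>-U\<close> handle the two signs in the cut norm; the first summand of
  \<open>cut_sampling_error\<close> controls the empirical \<open>L\<^sup>2\<close> norm, as \<open>U\<close> is not bounded uniformly in \<open>n\<close>.\<close>

definition probing_error :: "'v set \<Rightarrow> 'g set \<Rightarrow> nat \<Rightarrow> ('g \<Rightarrow> 'g \<Rightarrow> real) \<Rightarrow> ('v \<Rightarrow> 'g) \<Rightarrow> real" where
  "probing_error V G q U X =
     E (probe_pmf V q) (\<lambda>h. \<Sum>R\<in>Pow {..<q}. sampling_error V G U (probe_set U X h R) X)"

definition cut_sampling_error :: "'v set \<Rightarrow> 'g set \<Rightarrow> nat \<Rightarrow> ('g \<Rightarrow> 'g \<Rightarrow> real) \<Rightarrow> ('v \<Rightarrow> 'g) \<Rightarrow> real" where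
  "cut_sampling_error V G q U X = sampling_error V G (\<lambda>i j. (U i j)\<^sup>2) UNIV X
     + probing_error V G q U X + probing_error V G q (\<lambda>i j. - U i j) X"

lemma probing_error_nonneg: "0 \<le> probing_error V G q U X"
  unfolding probing_error_def
  by (intro Bochner_Integration.integral_nonneg sum_nonneg sampling_error_nonneg)

lemma cut_sampling_error_nonneg: "0 \<le> cut_sampling_error V G q U X"
  unfolding cut_sampling_error_def
  by (intro add_nonneg_nonneg probing_error_nonneg sampling_error_nonneg)

text \<open>The expectations over sample and probes are interchanged. For fixed \<open>h\<close> and
  \<open>R\<close> the probed set depends on at most \<open>q\<close> sample points, so its sampling
  error is small; \<open>2 ^ q\<close> counts the subsets \<open>R\<close>.\<close>

lemma expectation_probing_error:
  fixes V :: "'v set" and G :: "'g set"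
  assumes V: "finite V" "V \<noteq> {}" and G: "finite G" "G \<noteq> {}"
    and U: "\<forall>i\<in>G. \<forall>j\<in>G. \<bar>U i j\<bar> \<le> M" and M: "0 \<le> M"
  shows "E (Pi_pmf V d (\<lambda>_. pmf_of_set G)) (probing_error V G q U)
    \<le> 2 ^ q * (4 * M * (sqrt (card V) + q + 1) / card V)"
proof -
  let ?P = "Pi_pmf V d (\<lambda>_. pmf_of_set G)" and ?H = "probe_pmf V q"
  let ?c = "4 * M * (sqrt (card V) + q + 1) / card V"
  have fP: "finite (set_pmf ?P)" using V G by (intro finite_set_Pi_pmf) auto
  have fH: "finite (set_pmf ?H)" by (rule finite_probe_pmf[OF V])
  have int: "integrable ?P f" for f :: "_ \<Rightarrow> real" by (rule integrable_measure_pmf_finite[OF fP])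
  have eH: "E ?H f = (\<Sum>h\<in>set_pmf ?H. pmf ?H h * f h)" for f
    using integral_measure_pmf[OF fH, where M = ?H and f = f] by simp
  have "E ?P (probing_error V G q U)
      = E ?H (\<lambda>h. \<Sum>R\<in>Pow {..<q}. E ?P (\<lambda>X. sampling_error V G U (probe_set U X h R) X))"
    unfolding probing_error_def[abs_def] eH using int by simp
  also have "\<dots> \<le> E ?H (\<lambda>h. \<Sum>R\<in>Pow {..<q}. ?c)"
  proof (intro expectation_mono_pmf fH sum_mono)
    fix h R assume h: "h \<in> set_pmf ?H" and R: "R \<in> Pow {..<q}"
    have fR: "finite R" using R finite_subset by auto
    have Z: "h ` R \<subseteq> V" using probe_pmf_in[OF V h] R by auto
    have "E ?P (\<lambda>X. sampling_error V G U (probe_set U X h R) X)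
        \<le> 4 * M * (sqrt (card V) + card (h ` R) + 1) / card V"
    proof (rule expectation_sampling_error[OF V G U M Z])
      fix v and X :: "'v \<Rightarrow> 'g" and y assume "v \<in> V - h ` R"
      then have "(X(v := y)) (h a) = X (h a)" if "a \<in> R" for a using that by auto
      then show "probe_set U (X(v := y)) h R = probe_set U X h R"
        unfolding probe_set_def by (simp cong: sum.cong)
    qed
    also have "\<dots> \<le> ?c"
    proof -
      have "card (h ` R) \<le> card {..<q}"
        using card_image_le[OF fR, of h] card_mono[of "{..<q}" R] R by auto
      then show ?thesis using M by (intro divide_right_mono mult_left_mono) auto
    qed
    finally show "E ?P (\<lambda>X. sampling_error V G U (probe_set U X h R) X) \<le> ?c" .
  qed
  also have "\<dots> = 2 ^ q * ?c" by (simp add: card_Pow)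
  finally show ?thesis .
qed

lemma expectation_cut_sampling_error:
  assumes V: "finite V" "V \<noteq> {}" and G: "finite G" "G \<noteq> {}"
    and U: "\<forall>i\<in>G. \<forall>j\<in>G. \<bar>U i j\<bar> \<le> M" and M: "0 \<le> M"
  shows "E (Pi_pmf V d (\<lambda>_. pmf_of_set G)) (cut_sampling_error V G q U)
    \<le> 4 * M\<^sup>2 * (sqrt (card V) + 1) / card V + 2 * (2 ^ q * (4 * M * (sqrt (card V) + q + 1) / card V))"
proof -
  let ?P = "Pi_pmf V d (\<lambda>_. pmf_of_set G)"
  have fP: "finite (set_pmf ?P)" using V G by (intro finite_set_Pi_pmf) auto
  have int: "integrable ?P f" for f :: "_ \<Rightarrow> real" by (rule integrable_measure_pmf_finite[OF fP])
  have U2: "\<forall>i\<in>G. \<forall>j\<in>G. \<bar>(U i j)\<^sup>2\<bar> \<le> M\<^sup>2"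
    using U M by (auto intro!: abs_le_square_iff[THEN iffD1])
  have Un: "\<forall>i\<in>G. \<forall>j\<in>G. \<bar>- U i j\<bar> \<le> M" using U by simp
  have 1: "E ?P (sampling_error V G (\<lambda>i j. (U i j)\<^sup>2) UNIV) \<le> 4 * M\<^sup>2 * (sqrt (card V) + 1) / card V"
    using expectation_sampling_error[OF V G U2, of "{}" "\<lambda>_. UNIV" d] by simp
  have 2: "E ?P (cut_sampling_error V G q U) = E ?P (sampling_error V G (\<lambda>i j. (U i j)\<^sup>2) UNIV)
      + E ?P (probing_error V G q U) + E ?P (probing_error V G q (\<lambda>i j. - U i j))"
    unfolding cut_sampling_error_def[abs_def] using int by simp
  show ?thesis unfolding 2
    by (rule order_trans[OF add_mono[OF add_mono[OF 1 expectation_probing_error[OF V G U M, of d q]]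
          expectation_probing_error[OF V G Un M, of d q]]]) (simp add: mult_ac)
qed

text \<open>Applying the one-sided estimate to \<open>U\<close> and to \<open>- U\<close> gives both
  signs of a rectangle sum. The mean square over the sample is at most \<open>1 + z\<close> by
  \<open>sampled_sum_le\<close> for the squares, with all rows and columns selected.\<close>

lemma sampled_cut_bounded:
  assumes V: "finite V" "V \<noteq> {}" and G: "finite G" "G \<noteq> {}" and q: "q > 0"
    and cb: "cut_bounded G G U (e * real (card G) ^ 2)"
    and L2: "(\<Sum>i\<in>G. \<Sum>j\<in>G. (U i j)\<^sup>2) \<le> real (card G) ^ 2"
    and Z: "cut_sampling_error V G q U X \<le> z"
  shows "cut_bounded V V (\<lambda>v w. U (X v) (X w)) ((e + sqrt ((1 + z) / q) + z) * real (card V) ^ 2)"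
proof -
  let ?n = "real (card V)" and ?N = "real (card G)"
  have n: "?n > 0" using V by (simp add: card_gt_0_iff)
  have N: "?N > 0" using G by (simp add: card_gt_0_iff)
  let ?Z1 = "sampling_error V G (\<lambda>i j. (U i j)\<^sup>2) UNIV X"
  have z: "?Z1 \<le> z" "probing_error V G q U X \<le> z" "probing_error V G q (\<lambda>i j. - U i j) X \<le> z"
    using Z sampling_error_nonneg[of V G "\<lambda>i j. (U i j)\<^sup>2" UNIV X]
      probing_error_nonneg[of V G q U X] probing_error_nonneg[of V G q "\<lambda>i j. - U i j" X]
    unfolding cut_sampling_error_def by linarith+
  have emp: "(\<Sum>v\<in>V. \<Sum>w\<in>V. (U (X v) (X w))\<^sup>2) / ?n ^ 2 \<le> 1 + z"
  proof -
    have rm: "row_mean G (\<lambda>i j. (U i j)\<^sup>2) UNIV l = (\<Sum>j\<in>G. (U j l)\<^sup>2) / ?N" for l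
      by (simp add: row_mean_def expectation_pmf_of_set[OF G])
    have "E (pmf_of_set G) (\<lambda>l. max 0 (row_mean G (\<lambda>i j. (U i j)\<^sup>2) UNIV l))
        = (\<Sum>l\<in>G. \<Sum>j\<in>G. (U j l)\<^sup>2) / ?N / ?N"
      unfolding expectation_pmf_of_set[OF G] rm by (simp add: sum_nonneg sum_divide_distrib)
    also have "(\<Sum>l\<in>G. \<Sum>j\<in>G. (U j l)\<^sup>2) \<le> ?N ^ 2" using L2 by (subst sum.swap)
    finally have m: "E (pmf_of_set G) (\<lambda>l. max 0 (row_mean G (\<lambda>i j. (U i j)\<^sup>2) UNIV l)) \<le> 1"
      using N by (simp add: divide_right_mono power2_eq_square)
    have "(\<Sum>w\<in>V. \<Sum>v\<in>V. if X v \<in> UNIV then (U (X v) (X w))\<^sup>2 else 0)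
        \<le> ?n ^ 2 * (?Z1 + E (pmf_of_set G) (\<lambda>l. max 0 (row_mean G (\<lambda>i j. (U i j)\<^sup>2) UNIV l)))"
      by (rule sampled_sum_le[OF V order_refl])
    also have "\<dots> \<le> ?n ^ 2 * (z + 1)" by (intro mult_left_mono add_mono z m) simp
    finally have "(\<Sum>w\<in>V. \<Sum>v\<in>V. (U (X v) (X w))\<^sup>2) \<le> ?n ^ 2 * (z + 1)" by simp
    then have "(\<Sum>v\<in>V. \<Sum>w\<in>V. (U (X v) (X w))\<^sup>2) \<le> ?n ^ 2 * (z + 1)" by (subst sum.swap)
    then show ?thesis using n by (simp add: divide_le_eq algebra_simps)
  qed
  have one: "(\<Sum>v\<in>S. \<Sum>w\<in>T. Y (X v) (X w)) \<le> (e + sqrt ((1 + z) / q) + z) * ?n ^ 2"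
    if ST: "S \<subseteq> V" "T \<subseteq> V" and Y: "cut_bounded G G Y (e * ?N ^ 2)"
      and pe: "probing_error V G q Y X \<le> z" and sq: "\<And>i j. (Y i j)\<^sup>2 = (U i j)\<^sup>2" for S T Y
  proof -
    have "(\<Sum>v\<in>S. \<Sum>w\<in>T. Y (X v) (X w)) / ?n ^ 2
      \<le> e + sqrt ((\<Sum>v\<in>V. \<Sum>w\<in>V. (Y (X v) (X w))\<^sup>2) / ?n ^ 2 / q) + probing_error V G q Y X"
      unfolding probing_error_def by (rule sampled_cut_le[OF V G q Y ST])
    also have "\<dots> \<le> e + sqrt ((1 + z) / q) + z"
      unfolding sq using pe emp by (intro add_mono real_sqrt_le_mono divide_right_mono) auto
    finally show ?thesis using n by (simp add: divide_le_eq)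
  qed
  show ?thesis unfolding cut_bounded_def
  proof (intro allI impI)
    fix S T assume ST: "S \<subseteq> V" "T \<subseteq> V"
    have "(\<Sum>v\<in>S. \<Sum>w\<in>T. - U (X v) (X w)) \<le> (e + sqrt ((1 + z) / q) + z) * ?n ^ 2"
      using one[OF ST iffD2[OF cut_bounded_minus cb] z(3)] by simp
    with one[OF ST cb z(2)] show "\<bar>\<Sum>v\<in>S. \<Sum>w\<in>T. U (X v) (X w)\<bar> \<le> (e + sqrt ((1 + z) / q) + z) * ?n ^ 2"
      by (simp add: sum_negf abs_le_iff)
  qed
qed

section \<open>Frequencies of types in the sample\<close>

definition type_deviation :: "'v set \<Rightarrow> 'g set \<Rightarrow> 't set \<Rightarrow> ('g \<Rightarrow> 't) \<Rightarrow> ('v \<Rightarrow> 'g) \<Rightarrow> real" where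
  "type_deviation V G TT \<tau> X =
     (\<Sum>t\<in>TT. \<bar>real (card {j\<in>G. \<tau> j = t}) / card G - real (card {v\<in>V. \<tau> (X v) = t}) / card V\<bar>)"

lemma type_deviation_nonneg: "0 \<le> type_deviation V G TT \<tau> X"
  unfolding type_deviation_def by (rule sum_nonneg) simp

text \<open>Each frequency is off by at most 1 / sqrt n on average. Adding this up over the types is
  crude but affordable, as their number will be at most a constant times n^(1/8).\<close>

lemma expectation_type_deviation:
  assumes V: "finite V" "V \<noteq> {}" and G: "finite G" "G \<noteq> {}"
  shows "E (Pi_pmf V d (\<lambda>_. pmf_of_set G)) (type_deviation V G TT \<tau>) \<le> card TT / sqrt (card V)"
proof -
  let ?P = "Pi_pmf V d (\<lambda>_. pmf_of_set G)"
  let ?n = "real (card V)" and ?N = "real (card G)"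
  have n: "?n > 0" using V by (simp add: card_gt_0_iff)
  have N: "?N > 0" using G by (simp add: card_gt_0_iff)
  have fin: "\<forall>i\<in>V. finite (set_pmf (pmf_of_set G))" using G by simp
  have fP: "finite (set_pmf ?P)" by (rule finite_set_Pi_pmf[OF V(1) fin])
  have int: "integrable ?P f" for f :: "_ \<Rightarrow> real" by (rule integrable_measure_pmf_finite[OF fP])
  have intG: "integrable (pmf_of_set G) f" for f :: "_ \<Rightarrow> real"
    using G by (intro integrable_measure_pmf_finite) simp
  have one: "E ?P (\<lambda>X. \<bar>real (card {j\<in>G. \<tau> j = t}) / ?N - real (card {v\<in>V. \<tau> (X v) = t}) / ?n\<bar>) \<le> 1 / sqrt ?n" for t
  proof -
    define a where "a = real (card {j\<in>G. \<tau> j = t}) / ?N"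
    have aG: "E (pmf_of_set G) (\<lambda>y. if \<tau> y = t then 1 else 0) = a"
      using G by (simp add: expectation_pmf_of_set[OF G] a_def sum.inter_filter[symmetric])
    have a01: "0 \<le> a" "a \<le> 1"
      using N card_mono[of G "{j\<in>G. \<tau> j = t}"] G by (auto simp: a_def)
    have "E ?P (\<lambda>X. \<bar>\<Sum>v\<in>V. a - (if \<tau> (X v) = t then 1 else 0)\<bar>) \<le> 1 * (sqrt (card V) + card ({} :: 'a set))"
    proof (rule weak_law_orthogonal[OF V(1) fin V(1), where \<kappa> = "\<lambda>v. v"])
      fix v X
      have "E (pmf_of_set G) (\<lambda>y. a - (if \<tau> y = t then 1 else 0)) = 0"
        using aG by (subst Bochner_Integration.integral_diff) (simp_all add: intG)
      then show "E (pmf_of_set G) (\<lambda>y. a - (if \<tau> ((X(v := y)) v) = t then 1 else 0)) = 0" by simp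
    qed (use a01 in auto)
    moreover have "\<bar>a - real (card {v\<in>V. \<tau> (X v) = t}) / ?n\<bar> = \<bar>\<Sum>v\<in>V. a - (if \<tau> (X v) = t then 1 else 0)\<bar> / ?n" for X
    proof -
      have "(\<Sum>v\<in>V. a - (if \<tau> (X v) = t then 1 else 0)) = ?n * a - card {v\<in>V. \<tau> (X v) = t}"
        using V by (simp add: sum_subtractf sum.inter_filter[symmetric])
      moreover have "a - real (card {v\<in>V. \<tau> (X v) = t}) / ?n = (?n * a - card {v\<in>V. \<tau> (X v) = t}) / ?n"
        using n by (simp add: field_simps)
      ultimately show ?thesis by (simp add: abs_divide)
    qed
    ultimately have "E ?P (\<lambda>X. \<bar>a - real (card {v\<in>V. \<tau> (X v) = t}) / ?n\<bar>) \<le> sqrt ?n / ?n"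
      using n by (simp add: divide_right_mono)
    also have "\<dots> = 1 / sqrt ?n" using n by (simp add: real_div_sqrt field_simps)
    finally show ?thesis by (simp add: a_def)
  qed
  have "E ?P (type_deviation V G TT \<tau>)
      = (\<Sum>t\<in>TT. E ?P (\<lambda>X. \<bar>real (card {j\<in>G. \<tau> j = t}) / ?N - real (card {v\<in>V. \<tau> (X v) = t}) / ?n\<bar>))"
    unfolding type_deviation_def[abs_def] using int by simp
  also have "\<dots> \<le> (\<Sum>t\<in>TT. 1 / sqrt ?n)" by (intro sum_mono one)
  also have "\<dots> = card TT / sqrt ?n" by simp
  finally show ?thesis .
qed

section \<open>Comparison of a graphon system with a sampled graph system\<close>

lemma card_div_fibre_le:
  assumes m: "m > 0" and \<pi>: "bij_betw \<pi> {..<N} {..<N}"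
  shows "card {i\<in>{..<N}. \<pi> i div m + 1 = v} \<le> m"
proof -
  have "card {i\<in>{..<N}. \<pi> i div m + 1 = v} = card (\<pi> ` {i\<in>{..<N}. \<pi> i div m + 1 = v})"
    using \<pi> by (intro card_image[symmetric]) (auto simp: bij_betw_def inj_on_def)
  also have "\<pi> ` {i\<in>{..<N}. \<pi> i div m + 1 = v} \<subseteq> {(v - 1) * m ..< (v - 1) * m + m}"
  proof
    fix y assume "y \<in> \<pi> ` {i\<in>{..<N}. \<pi> i div m + 1 = v}"
    then have y: "v - 1 = y div m" by auto
    show "y \<in> {(v - 1) * m ..< (v - 1) * m + m}"
      unfolding y using dividend_less_times_div[OF m, of y] div_times_less_eq_dividend[of y m]
      by (simp add: mult.commute)
  qed
  then have "card (\<pi> ` {i\<in>{..<N}. \<pi> i div m + 1 = v}) \<le> card {(v - 1) * m ..< (v - 1) * m + m}"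
    by (intro card_mono) auto
  finally show ?thesis by simp
qed

text \<open>An entry changes only if its row or its column is mismatched. This concerns at most
  \<open>2 * z * N ^ 2\<close> entries, each changing by at most \<open>2 * c\<close>.\<close>

lemma cut_bounded_mismatch:
  fixes K :: "nat \<Rightarrow> nat \<Rightarrow> real"
  assumes K: "\<And>a b. \<bar>K a b\<bar> \<le> c" and bad: "real (card {i\<in>{..<N}. \<tau> i \<noteq> \<sigma> i}) \<le> z * N" and c: "c \<ge> 0"
  shows "cut_bounded {..<N} {..<N} (\<lambda>i j. K (\<tau> i) (\<tau> j) - K (\<sigma> i) (\<sigma> j)) (4 * c * z * real N ^ 2)"
proof (rule cut_bounded_sum_abs)
  let ?b = "\<lambda>i. if \<tau> i \<noteq> \<sigma> i then 1 else 0 :: real"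
  have sb: "(\<Sum>i<N. ?b i) \<le> z * N"
    using bad by (simp add: sum.inter_filter[symmetric])
  have "(\<Sum>i<N. \<Sum>j<N. \<bar>K (\<tau> i) (\<tau> j) - K (\<sigma> i) (\<sigma> j)\<bar>) \<le> (\<Sum>i<N. \<Sum>j<N. 2 * c * ?b i + 2 * c * ?b j)"
  proof (intro sum_mono)
    fix i j
    show "\<bar>K (\<tau> i) (\<tau> j) - K (\<sigma> i) (\<sigma> j)\<bar> \<le> 2 * c * ?b i + 2 * c * ?b j"
      using K[of "\<tau> i" "\<tau> j"] K[of "\<sigma> i" "\<sigma> j"] c by (auto simp: abs_le_iff)
  qed
  also have "\<dots> = (4 * c * N) * (\<Sum>i<N. ?b i)"
    by (simp add: sum.distrib sum_distrib_left[symmetric])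
  also have "\<dots> \<le> (4 * c * N) * (z * N)" using sb c by (intro mult_left_mono) auto
  finally show "(\<Sum>i<N. \<Sum>j<N. \<bar>K (\<tau> i) (\<tau> j) - K (\<sigma> i) (\<sigma> j)\<bar>) \<le> 4 * c * z * real N ^ 2"
    by (simp add: power2_eq_square mult_ac)
qed simp_all

text \<open>A telescoping sum: from \<open>A\<close> to its kernel of types, to the kernel at the
  types of the sample, back to \<open>A\<close> at the sample points, to \<open>W\<close> there, and
  to the random edges. The last three comparisons live on the vertices and are blown up by the
  factor \<open>m\<close>.\<close>

lemma cut_bounded_kernel_graph:
  fixes A K :: "nat \<Rightarrow> nat \<Rightarrow> real" and \<tau> :: "nat \<Rightarrow> nat"
  assumes n: "n > 0" and m: "m > 0" and N: "N = n * m" and \<pi>: "bij_betw \<pi> {..<N} {..<N}"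
    and A: "\<And>i j. A i j \<in> {0..1}" and K: "\<And>a b. \<bar>K a b\<bar> \<le> c" and c: "c \<ge> 0" and \<delta>: "\<delta> \<ge> 0"
    and bad: "real (card {i\<in>{..<N}. \<tau> i \<noteq> \<tau> (X (\<pi> i div m + 1))}) \<le> z * N"
    and cbU: "cut_bounded {..<N} {..<N} (\<lambda>i j. A i j - K (\<tau> i) (\<tau> j)) (e * real N ^ 2)"
    and cbX: "cut_bounded {1..n} {1..n} (\<lambda>v w. A (X v) (X w) - K (\<tau> (X v)) (\<tau> (X w))) (\<rho> * real n ^ 2)"
    and near: "\<And>v w. v \<in> {1..n} \<Longrightarrow> w \<in> {1..n} \<Longrightarrow> v \<noteq> w \<Longrightarrow> \<bar>W I (x v, x w) - A (X v) (X w)\<bar> \<le> \<delta>"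
    and noise: "cut_bounded {1..n} {1..n} (noise n W x I G) (\<xi> * real n ^ 2)"
  shows "cut_bounded {..<N} {..<N} (\<lambda>i j. A i j - adjacency G I (\<pi> i div m + 1) (\<pi> j div m + 1))
    ((e + 4 * c * z + \<rho> + 1 / n + \<delta> + \<xi>) * real N ^ 2)"
proof -
  let ?V = "{1..n}"
  define f where "f i = \<pi> i div m + 1" for i
  have f: "f \<in> {..<N} \<rightarrow> ?V"
  proof
    fix i assume "i \<in> {..<N}"
    then have "\<pi> i < n * m" using \<pi> N by (auto simp: bij_betw_def)
    then have "\<pi> i div m < n" using m by (simp add: less_mult_imp_div_less)
    then show "f i \<in> ?V" by (simp add: f_def)
  qed
  have fib: "\<And>v. v \<in> ?V \<Longrightarrow> card {i\<in>{..<N}. f i = v} \<le> m"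
    unfolding f_def by (rule card_div_fibre_le[OF m \<pi>])
  have N2: "real m ^ 2 * (t * real n ^ 2) = t * real N ^ 2" for t
    by (simp add: N power_mult_distrib)
  \<comment> \<open>The noise vanishes on the diagonal, so there \<open>D\<close> compares
    \<open>A\<close> with the adjacency directly; these entries account for the term
    \<open>1 / n\<close>.\<close>
  define D where "D v w = (if v = w then A (X v) (X w) - adjacency G I v w else A (X v) (X w) - W I (x v, x w))" for v w
  have cbD: "cut_bounded ?V ?V D ((1 / n + \<delta>) * real n ^ 2)"
  proof (rule cut_bounded_sum_abs)
    have "(\<Sum>v\<in>?V. \<Sum>w\<in>?V. \<bar>D v w\<bar>) \<le> (\<Sum>v\<in>?V. \<Sum>w\<in>?V. (if v = w then 1 else 0) + \<delta>)"
    proof (intro sum_mono)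
      fix v w assume vw: "v \<in> ?V" "w \<in> ?V"
      show "\<bar>D v w\<bar> \<le> (if v = w then 1 else 0) + \<delta>"
      proof (cases "v = w")
        case True
        then show ?thesis
          using A[of "X v" "X w"] adjacency_01[of G I v w] \<delta> by (simp add: D_def abs_le_iff)
      next
        case False
        then show ?thesis using near[OF vw False] by (simp add: D_def abs_minus_commute)
      qed
    qed
    also have "\<dots> = n + \<delta> * real n ^ 2"
      by (simp add: sum.distrib power2_eq_square distrib_left mult_ac)
    also have "\<dots> = (1 / n + \<delta>) * real n ^ 2"
      using n by (simp add: field_simps power2_eq_square)
    finally show "(\<Sum>v\<in>?V. \<Sum>w\<in>?V. \<bar>D v w\<bar>) \<le> (1 / n + \<delta>) * real n ^ 2" .
  qed simp_all
  have b3: "cut_bounded {..<N} {..<N} (\<lambda>i j. - (A (X (f i)) (X (f j)) - K (\<tau> (X (f i))) (\<tau> (X (f j))))) (\<rho> * real N ^ 2)"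
    using cut_bounded_blowup[OF _ _ f m fib iffD2[OF cut_bounded_minus cbX]] by (simp add: N2)
  have b4: "cut_bounded {..<N} {..<N} (\<lambda>i j. D (f i) (f j)) ((1 / n + \<delta>) * real N ^ 2)"
    using cut_bounded_blowup[OF _ _ f m fib cbD] by (simp only: N2 finite_atLeastAtMost finite_lessThan)
  have b5: "cut_bounded {..<N} {..<N} (\<lambda>i j. noise n W x I G (f i) (f j)) (\<xi> * real N ^ 2)"
    using cut_bounded_blowup[OF _ _ f m fib noise] by (simp only: N2 finite_atLeastAtMost finite_lessThan)
  have b2: "cut_bounded {..<N} {..<N} (\<lambda>i j. K (\<tau> i) (\<tau> j) - K (\<tau> (X (f i))) (\<tau> (X (f j)))) (4 * c * z * real N ^ 2)"
    using bad unfolding f_def by (rule cut_bounded_mismatch[OF K _ c])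
  have "cut_bounded {..<N} {..<N} (\<lambda>i j. A i j - adjacency G I (f i) (f j))
      (e * real N ^ 2 + 4 * c * z * real N ^ 2 + \<rho> * real N ^ 2 + (1 / n + \<delta>) * real N ^ 2 + \<xi> * real N ^ 2)"
    by (rule iffD1[OF cut_bounded_cong
          cut_bounded_add[OF cut_bounded_add[OF cut_bounded_add[OF cut_bounded_add[OF cbU b2] b3] b4] b5]])
      (simp add: D_def noise_def)
  then show ?thesis unfolding f_def by (rule cut_bounded_mono) (simp add: algebra_simps)
qed

lemma irregular_points_null_sets:
  assumes W: "graphon_system k W" and adm: "admissible k W"
  shows "{p\<in>unit_square. \<not> regular_point k W p} \<in> null_sets (lebesgue_on unit_square)"
proof -
  let ?M = "lebesgue_on unit_square"
  have sp: "space ?M = unit_square" by (simp add: space_restrict_space)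
  have "AE p in ?M. \<forall>I\<in>Pow {1..k}. 0 \<le> wbar k W I p"
    by (rule AE_finite_allI) (use adm in \<open>auto simp: admissible_def\<close>)
  moreover have "{p\<in>unit_square. \<not> regular_point k W p} = (\<Union>I\<in>Pow {1..k}. {p\<in>space ?M. wbar k W I p < 0})"
    unfolding sp regular_point_def by (auto simp: not_le)
  moreover have "(\<Union>I\<in>Pow {1..k}. {p\<in>space ?M. wbar k W I p < 0}) \<in> sets ?M"
  proof (intro sets.finite_UN)
    fix I assume "I \<in> Pow {1..k}"
    then have [measurable]: "wbar k W I \<in> borel_measurable ?M" using measurable_wbar[OF W] by auto
    show "{p\<in>space ?M. wbar k W I p < 0} \<in> sets ?M" by measurable
  qed simp
  ultimately have s: "{p\<in>unit_square. \<not> regular_point k W p} \<in> sets ?M"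
    and ae: "AE p in ?M. regular_point k W p"
    by (auto simp: regular_point_def elim!: eventually_mono)
  have s': "{p\<in>space ?M. \<not> regular_point k W p} \<in> sets ?M" unfolding sp by (rule s)
  show ?thesis using iffD1[OF AE_iff_null[OF s'] ae] unfolding sp .
qed

text \<open>The deterministic core: all randomness sits in the hypotheses on \<open>X\<close>,
  \<open>x\<close> and \<open>G\<close>. In the bound \<open>e\<close> occurs twice, for the
  remainder on the grid and for the sampled one; two of the three \<open>\<delta>\<close> come from
  integration and one from the sample points.\<close>

lemma cut_dist_of_good_sample:
  fixes \<tau> :: "nat set \<Rightarrow> nat \<Rightarrow> nat" and K :: "nat set \<Rightarrow> nat \<Rightarrow> nat \<Rightarrow> real"
  assumes W: "graphon_system k W" and n: "n > 0" and m: "m > 0" and N: "N = n * m"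
    and q: "q > 0" and e: "e \<ge> 0" and z: "z \<ge> 0" and \<delta>: "\<delta> \<ge> 0" and \<xi>: "\<xi> \<ge> 0"
    and Is: "Is = Pow {1..k} - {{}}"
    and A: "\<And>I i j. I \<in> Is \<Longrightarrow> A I i j \<in> {0..1 :: real}"
    and approx: "\<And>I. I \<in> Is \<Longrightarrow> measure (lebesgue_on unit_square)
      {p\<in>unit_square. \<bar>W I p - A I (cell N (fst p)) (cell N (snd p))\<bar> > \<delta>} \<le> \<delta>"
    and \<tau>: "\<And>I i. I \<in> Is \<Longrightarrow> \<tau> I i < T"
    and K: "\<And>I a b. I \<in> Is \<Longrightarrow> \<bar>K I a b\<bar> \<le> c" and c: "c \<ge> 0"
    and L2: "\<And>I. I \<in> Is \<Longrightarrow> (\<Sum>i<N. \<Sum>j<N. (A I i j - K I (\<tau> I i) (\<tau> I j))\<^sup>2) \<le> real N ^ 2"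
    and cb: "\<And>I. I \<in> Is \<Longrightarrow> cut_bounded {..<N} {..<N} (\<lambda>i j. A I i j - K I (\<tau> I i) (\<tau> I j)) (e * real N ^ 2)"
    and X: "\<And>v. v \<in> {1..n} \<Longrightarrow> X v < N"
    and Z1: "\<And>I. I \<in> Is \<Longrightarrow> cut_sampling_error {1..n} {..<N} q (\<lambda>i j. A I i j - K I (\<tau> I i) (\<tau> I j)) X \<le> z"
    and Z2: "type_deviation {1..n} {..<N} (PiE Is (\<lambda>_. {..<T})) (\<lambda>j. \<lambda>I\<in>Is. \<tau> I j) X \<le> z"
    and near: "\<And>I v w. I \<in> Is \<Longrightarrow> v \<in> {1..n} \<Longrightarrow> w \<in> {1..n} \<Longrightarrow> v \<noteq> w \<Longrightarrow> \<bar>W I (x v, x w) - A I (X v) (X w)\<bar> \<le> \<delta>"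
    and noise: "\<And>I. I \<in> Is \<Longrightarrow> cut_bounded {1..n} {1..n} (noise n W x I G) (\<xi> * real n ^ 2)"
  shows "cut_dist k W (system_graphons n G)
    \<le> 2 ^ k * (3 * \<delta> + 2 * e + 4 * c * z + sqrt ((1 + z) / q) + z + 1 / n + \<xi>)"
proof -
  let ?V = "{1..n}" and ?TT = "PiE Is (\<lambda>_. {..<T})"
  \<comment> \<open>The joint type over all index sets, since one permutation must work for all of
    them. This raises the number of types to the power \<open>card Is\<close>.\<close>
  define \<tau>' where "\<tau>' j = (\<lambda>I\<in>Is. \<tau> I j)" for j
  have finI: "finite Is" by (simp add: Is)
  have N0: "N > 0" using n m N by simp
  define f where "f i = i div m + 1" for i
  have f: "f i \<in> ?V" if "i < N" for i
  proof -
    have "i div m < n" using m that N by (simp add: less_mult_imp_div_less)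
    then show ?thesis by (simp add: f_def)
  qed
  have TT: "finite ?TT" "\<And>i. \<tau>' i \<in> ?TT" using finI \<tau> by (auto simp: \<tau>'_def intro!: finite_PiE)
  obtain \<pi> where \<pi>: "bij_betw \<pi> {..<N} {..<N}" and mis: "real (card {i\<in>{..<N}. \<tau>' i \<noteq> \<tau>' (X (f (\<pi> i)))})
      \<le> (\<Sum>t\<in>?TT. \<bar>real (card {i\<in>{..<N}. \<tau>' i = t}) - real (card {i\<in>{..<N}. \<tau>' (X (f i)) = t})\<bar>)"
    using type_matching_permutation[of ?TT N \<tau>' "\<lambda>i. \<tau>' (X (f i))"] TT by blast
  \<comment> \<open>Each vertex stands for exactly \<open>m\<close> cells, so the blown-up sample
    has the same type frequencies as the sample.\<close>
  have blow: "card {i\<in>{..<N}. \<tau>' (X (f i)) = t} = m * card {v\<in>?V. \<tau>' (X v) = t}" for t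
  proof -
    have fibre: "card {i\<in>{..<N}. f i = v} = m" if "v \<in> ?V" for v
    proof -
      have "{i\<in>{..<N}. f i = v} = {(v - 1) * m ..< (v - 1) * m + m}"
      proof (intro equalityI subsetI)
        fix i assume "i \<in> {i\<in>{..<N}. f i = v}"
        then have "v - 1 = i div m" by (auto simp: f_def)
        then show "i \<in> {(v - 1) * m ..< (v - 1) * m + m}"
          using dividend_less_times_div[OF m, of i] div_times_less_eq_dividend[of i m]
          by (simp add: mult.commute)
      next
        fix i assume i: "i \<in> {(v - 1) * m ..< (v - 1) * m + m}"
        have "i div m = v - 1" using i by (intro div_nat_eqI) (auto simp: mult.commute)
        moreover have "i < N"
        proof -
          have "(v - 1) * m + m = v * m" using that by (cases v) auto
          also have "\<dots> \<le> N" using that N by simp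
          finally show ?thesis using i by simp
        qed
        ultimately show "i \<in> {i\<in>{..<N}. f i = v}" using that by (simp add: f_def)
      qed
      then show ?thesis by simp
    qed
    have U: "{i\<in>{..<N}. \<tau>' (X (f i)) = t} = (\<Union>v\<in>{v\<in>?V. \<tau>' (X v) = t}. {i\<in>{..<N}. f i = v})"
      using f by auto
    have "card {i\<in>{..<N}. \<tau>' (X (f i)) = t} = (\<Sum>v\<in>{v\<in>?V. \<tau>' (X v) = t}. card {i\<in>{..<N}. f i = v})"
      unfolding U
    proof (rule card_UN_disjoint)
      show "finite {v\<in>?V. \<tau>' (X v) = t}" by simp
      show "\<forall>v\<in>{v\<in>?V. \<tau>' (X v) = t}. finite {i\<in>{..<N}. f i = v}" by simp
      show "\<forall>u\<in>{v\<in>?V. \<tau>' (X v) = t}. \<forall>v\<in>{v\<in>?V. \<tau>' (X v) = t}.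
          u \<noteq> v \<longrightarrow> {i\<in>{..<N}. f i = u} \<inter> {i\<in>{..<N}. f i = v} = {}" by blast
    qed
    also have "\<dots> = (\<Sum>v\<in>{v\<in>?V. \<tau>' (X v) = t}. m)"
    proof (rule sum.cong[OF refl])
      fix v assume "v \<in> {v\<in>?V. \<tau>' (X v) = t}"
      then have v: "v \<in> ?V" by blast
      show "card {i\<in>{..<N}. f i = v} = m" by (rule fibre[OF v])
    qed
    also have "\<dots> = m * card {v\<in>?V. \<tau>' (X v) = t}" by simp
    finally show ?thesis .
  qed
  have "(\<Sum>t\<in>?TT. \<bar>real (card {i\<in>{..<N}. \<tau>' i = t}) - real (card {i\<in>{..<N}. \<tau>' (X (f i)) = t})\<bar>)
      = N * type_deviation ?V {..<N} ?TT \<tau>' X"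
    unfolding type_deviation_def sum_distrib_left blow
  proof (intro sum.cong refl)
    fix t
    let ?a = "real (card {i\<in>{..<N}. \<tau>' i = t})" and ?b = "real (card {v\<in>?V. \<tau>' (X v) = t})"
    have "N * \<bar>?a / real (card {..<N}) - ?b / real (card ?V)\<bar> = \<bar>N * (?a / N - ?b / n)\<bar>"
      by (simp add: abs_mult)
    also have "N * (?a / N - ?b / n) = ?a - real (m * card {v\<in>?V. \<tau>' (X v) = t})"
      using N0 n m by (simp add: N field_simps)
    finally show "\<bar>?a - real (m * card {v\<in>?V. \<tau>' (X v) = t})\<bar> = N * \<bar>?a / real (card {..<N}) - ?b / real (card ?V)\<bar>" ..
  qed
  also have "\<dots> \<le> z * N"
    using mult_left_mono[OF Z2, of "real N"] unfolding \<tau>'_def[abs_def] by (simp add: mult.commute)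
  finally have mis': "real (card {i\<in>{..<N}. \<tau>' i \<noteq> \<tau>' (X (f (\<pi> i)))}) \<le> z * N" using mis by linarith
  define \<theta> where "\<theta> = e + 4 * c * z + (e + sqrt ((1 + z) / q) + z) + 1 / n + \<delta> + \<xi>"
  have "cut_dist k W (system_graphons n G) \<le> 2 ^ k * (2 * \<delta> + \<theta>)"
  proof (rule cut_dist_graphs_le[OF W n m N \<pi> \<delta>])
    show "0 \<le> \<theta>" unfolding \<theta>_def using e c z \<delta> \<xi> by (intro add_nonneg_nonneg) auto
    fix I assume "I \<in> Pow {1..k} - {{}}"
    then have I: "I \<in> Is" by (simp add: Is)
    show "A I i j \<in> {0..1}" for i j by (rule A[OF I])
    show "measure (lebesgue_on unit_square)
      {p\<in>unit_square. \<bar>W I p - A I (cell N (fst p)) (cell N (snd p))\<bar> > \<delta>} \<le> \<delta>" by (rule approx[OF I])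
    have "card {i\<in>{..<N}. \<tau> I i \<noteq> \<tau> I (X (f (\<pi> i)))} \<le> card {i\<in>{..<N}. \<tau>' i \<noteq> \<tau>' (X (f (\<pi> i)))}"
    proof (rule card_mono)
      show "{i\<in>{..<N}. \<tau> I i \<noteq> \<tau> I (X (f (\<pi> i)))} \<subseteq> {i\<in>{..<N}. \<tau>' i \<noteq> \<tau>' (X (f (\<pi> i)))}"
      proof
        fix i assume i: "i \<in> {i\<in>{..<N}. \<tau> I i \<noteq> \<tau> I (X (f (\<pi> i)))}"
        have \<tau>I: "\<tau>' j I = \<tau> I j" for j using I by (simp add: \<tau>'_def)
        have "\<tau>' i \<noteq> \<tau>' (X (f (\<pi> i)))"
        proof
          assume "\<tau>' i = \<tau>' (X (f (\<pi> i)))"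
          then have "\<tau> I i = \<tau> I (X (f (\<pi> i)))" by (simp only: \<tau>I[symmetric])
          with i show False by simp
        qed
        with i show "i \<in> {i\<in>{..<N}. \<tau>' i \<noteq> \<tau>' (X (f (\<pi> i)))}" by simp
      qed
    qed simp
    then have bad: "real (card {i\<in>{..<N}. \<tau> I i \<noteq> \<tau> I (X (\<pi> i div m + 1))}) \<le> z * N"
      using mis' unfolding f_def by linarith
    have V: "finite ?V" "?V \<noteq> {}" and G: "finite {..<N}" "{..<N} \<noteq> {}" using n N0 by auto
    have cbX: "cut_bounded ?V ?V (\<lambda>v w. A I (X v) (X w) - K I (\<tau> I (X v)) (\<tau> I (X w)))
        ((e + sqrt ((1 + z) / q) + z) * real n ^ 2)"
      using sampled_cut_bounded[OF V G q _ _ Z1[OF I], of e] cb[OF I] L2[OF I] by simp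
    show "cut_bounded {..<N} {..<N}
        (\<lambda>i j. A I i j - adjacency G I (\<pi> i div m + 1) (\<pi> j div m + 1)) (\<theta> * real N ^ 2)"
      unfolding \<theta>_def
      by (rule cut_bounded_kernel_graph[OF n m N \<pi> A[OF I] K[OF I] c \<delta> bad cb[OF I] cbX near[OF I] noise[OF I]])
  qed
  also have "2 * \<delta> + \<theta> = 3 * \<delta> + 2 * e + 4 * c * z + sqrt ((1 + z) / q) + z + 1 / n + \<xi>"
    unfolding \<theta>_def by simp
  finally show ?thesis .
qed

section \<open>A quantitative sampling bound\<close>

lemma subprob_space_random_graphs:
  assumes W: "graphon_system k W"
  shows "subprob_space (random_graphs k W n)"
proof -
  interpret prob_space "completion (sample_space n)"
    by (rule prob_space.prob_space_completion[OF prob_space_sample_space])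
  show ?thesis unfolding random_graphs_def
    by (rule subprob_space_bind[OF _ measurable_conditional_graphs[OF W]]) unfold_locales
qed

lemma sets_random_graphs:
  assumes W: "graphon_system k W"
  shows "sets (random_graphs k W n) = UNIV"
proof -
  interpret prob_space "completion (sample_space n)"
    by (rule prob_space.prob_space_completion[OF prob_space_sample_space])
  have "sets (random_graphs k W n) = sets (count_space UNIV)"
    unfolding random_graphs_def
    by (rule sets_bind) (use measurable_conditional_graphs[OF W, of n] not_empty in \<open>auto intro: sets_kernel\<close>)
  then show ?thesis by simp
qed

lemma prob_exceptional_sample:
  assumes D: "D \<in> sets (lebesgue_on unit_square)" and m: "measure (lebesgue_on unit_square) D \<le> d"
  shows "{x\<in>space (sample_space n). \<exists>v\<in>{1..n}. \<exists>w\<in>{1..n}. v \<noteq> w \<and> (x v, x w) \<in> D} \<in> sets (completion (sample_space n))"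
    and "measure (completion (sample_space n))
      {x\<in>space (sample_space n). \<exists>v\<in>{1..n}. \<exists>w\<in>{1..n}. v \<noteq> w \<and> (x v, x w) \<in> D} \<le> real n ^ 2 * d"
proof -
  let ?S = "completion (sample_space n)"
  interpret prob_space ?S
    by (rule prob_space.prob_space_completion[OF prob_space_sample_space])
  define P where "P = {(v, w). v \<in> {1..n} \<and> w \<in> {1..n} \<and> v \<noteq> w}"
  define F where "F = (\<lambda>(v, w). {x\<in>space (sample_space n). (x v, x w) \<in> D})"
  have P: "P \<subseteq> {1..n} \<times> {1..n}" by (auto simp: P_def)
  then have fP: "finite P" by (rule finite_subset) simp
  have F: "F e \<in> sets ?S" "measure ?S (F e) \<le> d" if "e \<in> P" for e
  proof -
    obtain v w where e: "e = (v, w)" and vw: "v \<in> {1..n}" "w \<in> {1..n}" "v \<noteq> w"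
      using \<open>e \<in> P\<close> unfolding P_def by blast
    show "F e \<in> sets ?S" unfolding e F_def prod.case by (rule prob_sample_pair_exceptional(1)[OF vw D])
    show "measure ?S (F e) \<le> d"
      unfolding e F_def prod.case prob_sample_pair_exceptional(2)[OF vw D] by (rule m)
  qed
  have eq: "{x\<in>space (sample_space n). \<exists>v\<in>{1..n}. \<exists>w\<in>{1..n}. v \<noteq> w \<and> (x v, x w) \<in> D} = (\<Union>e\<in>P. F e)"
  proof (intro set_eqI iffI)
    fix x assume "x \<in> {x\<in>space (sample_space n). \<exists>v\<in>{1..n}. \<exists>w\<in>{1..n}. v \<noteq> w \<and> (x v, x w) \<in> D}"
    then obtain v w where "x \<in> space (sample_space n)" "v \<in> {1..n}" "w \<in> {1..n}" "v \<noteq> w" "(x v, x w) \<in> D"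
      by blast
    then have "(v, w) \<in> P" "x \<in> F (v, w)" unfolding P_def F_def by blast+
    then show "x \<in> (\<Union>e\<in>P. F e)" by blast
  next
    fix x assume "x \<in> (\<Union>e\<in>P. F e)"
    then obtain v w where "(v, w) \<in> P" "x \<in> F (v, w)" by (metis UN_E surj_pair)
    then show "x \<in> {x\<in>space (sample_space n). \<exists>v\<in>{1..n}. \<exists>w\<in>{1..n}. v \<noteq> w \<and> (x v, x w) \<in> D}"
      unfolding P_def F_def by blast
  qed
  show "{x\<in>space (sample_space n). \<exists>v\<in>{1..n}. \<exists>w\<in>{1..n}. v \<noteq> w \<and> (x v, x w) \<in> D} \<in> sets ?S"
    unfolding eq using F fP by (intro sets.finite_UN) auto
  have d: "0 \<le> d" using m measure_nonneg[of "lebesgue_on unit_square" D] by linarith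
  have "measure ?S (\<Union>e\<in>P. F e) \<le> (\<Sum>e\<in>P. measure ?S (F e))"
    using F fP by (intro finite_measure_subadditive_finite) auto
  also have "\<dots> \<le> (\<Sum>e\<in>P. d)" by (intro sum_mono F)
  also have "\<dots> = card P * d" by simp
  also have "\<dots> \<le> real n ^ 2 * d"
  proof (rule mult_right_mono[OF _ d])
    have "card P \<le> card ({1..n} \<times> {1..n})" by (rule card_mono[OF _ P]) simp
    then have "card P \<le> n ^ 2" by (simp add: power2_eq_square)
    then have "real (card P) \<le> real (n ^ 2)" by (simp only: of_nat_le_iff)
    then show "real (card P) \<le> real n ^ 2" by simp
  qed
  finally show "measure ?S {x\<in>space (sample_space n). \<exists>v\<in>{1..n}. \<exists>w\<in>{1..n}. v \<noteq> w \<and> (x v, x w) \<in> D} \<le> real n ^ 2 * d"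
    unfolding eq .
qed

text \<open>Non-asymptotic, with the parameters still free. The subtracted terms belong to three
  events: a large noise matrix given the sample, a total sampling error above \<open>z\<close>, and
  a pair of sample points falling into the exceptional set.\<close>

lemma random_graphs_bound:
  fixes e z \<xi> \<delta> :: real and r q :: nat
  assumes W: "graphon_system k W" and adm: "admissible k W" and n: "n > 0" and q: "q > 0"
    and e: "e > 0" and r: "r * e\<^sup>2 > 1" and z: "z > 0" and \<xi>: "\<xi> > 0" and \<delta>: "\<delta> > 0"
    and M: "1 + r * e \<le> M"
  shows "measure (random_graphs k W n) {G. cut_dist k W (system_graphons n G)
      \<le> 2 ^ k * (3 * \<delta> + 2 * e + 4 * (r * e) * z + sqrt ((1 + z) / q) + z + 1 / n + \<xi>)}
    \<ge> 1 - 2 ^ k * ((sqrt n + 3) / (\<xi>\<^sup>2 * n))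
      - ((2 ^ k * (4 * M\<^sup>2 * (sqrt n + 1) / n + 2 * (2 ^ q * (4 * M * (sqrt n + q + 1) / n)))
            + (4 ^ r) ^ (2 ^ k) / sqrt n) / z
          + real n ^ 2 * (2 ^ k * \<delta>))"
proof -
  define Is where "Is = Pow {1..k} - {{}}"
  have finI: "finite Is" and cardI: "card Is \<le> 2 ^ k"
  proof -
    show "finite Is" by (simp add: Is_def)
    have "card Is \<le> card (Pow {1..k})" by (rule card_mono) (auto simp: Is_def)
    then show "card Is \<le> 2 ^ k" by (simp add: card_Pow)
  qed
  have "\<forall>I\<in>Is. \<exists>N0. \<forall>N\<ge>N0. N > 0 \<longrightarrow> (\<exists>A :: nat \<Rightarrow> nat \<Rightarrow> real. (\<forall>i j. A i j \<in> {0..1}) \<and>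
     measure (lebesgue_on unit_square) {p\<in>unit_square. \<bar>W I p - A (cell N (fst p)) (cell N (snd p))\<bar> > \<delta>} \<le> \<delta>)"
  proof
    fix I assume I: "I \<in> Is"
    then have I': "I \<subseteq> {1..k}" by (simp add: Is_def)
    then have g: "graphon (W I)" using W by (simp add: graphon_system_def)
    show "\<exists>N0. \<forall>N\<ge>N0. N > 0 \<longrightarrow> (\<exists>A :: nat \<Rightarrow> nat \<Rightarrow> real. (\<forall>i j. A i j \<in> {0..1}) \<and>
     measure (lebesgue_on unit_square) {p\<in>unit_square. \<bar>W I p - A (cell N (fst p)) (cell N (snd p))\<bar> > \<delta>} \<le> \<delta>)"
    proof (rule grid_approximation[of "W I" \<delta>])
      show "W I \<in> borel_measurable (lebesgue_on unit_square)" by (rule graphon_measurable[OF g])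
      show "W I p \<in> {0..1}" if "p \<in> unit_square" for p by (rule graphon_system_01[OF W I' that])
      show "0 < \<delta>" by (rule \<delta>)
    qed blast
  qed
  then obtain N0 where N0: "\<forall>I\<in>Is. \<forall>N\<ge>N0 I. N > 0 \<longrightarrow> (\<exists>A :: nat \<Rightarrow> nat \<Rightarrow> real. (\<forall>i j. A i j \<in> {0..1}) \<and>
     measure (lebesgue_on unit_square) {p\<in>unit_square. \<bar>W I p - A (cell N (fst p)) (cell N (snd p))\<bar> > \<delta>} \<le> \<delta>)"
    by (rule bchoice[THEN exE])
  \<comment> \<open>Any multiple of \<open>n\<close> beyond all \<open>N0 I\<close> would do. The
    sum dominates each \<open>N0 I\<close>, and \<open>Suc\<close> keeps \<open>m\<close>
    positive.\<close>
  define m where "m = Suc (\<Sum>I\<in>Is. N0 I)"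
  define N where "N = n * m"
  have m: "m > 0" and Npos: "N > 0" using n by (auto simp: m_def N_def)
  have NN0: "N \<ge> N0 I" if "I \<in> Is" for I
  proof -
    have "N0 I \<le> (\<Sum>I\<in>Is. N0 I)" using that finI by (intro member_le_sum) auto
    also have "\<dots> \<le> 1 * m" by (simp add: m_def)
    also have "\<dots> \<le> N" unfolding N_def using n by (intro mult_right_mono) auto
    finally show ?thesis .
  qed
  have "\<forall>I\<in>Is. \<exists>A :: nat \<Rightarrow> nat \<Rightarrow> real. (\<forall>i j. A i j \<in> {0..1}) \<and>
     measure (lebesgue_on unit_square) {p\<in>unit_square. \<bar>W I p - A (cell N (fst p)) (cell N (snd p))\<bar> > \<delta>} \<le> \<delta>"
    using N0 NN0 Npos by blast
  then obtain A :: "nat set \<Rightarrow> nat \<Rightarrow> nat \<Rightarrow> real" where A': "\<forall>I\<in>Is. (\<forall>i j. A I i j \<in> {0..1}) \<and>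
     measure (lebesgue_on unit_square) {p\<in>unit_square. \<bar>W I p - A I (cell N (fst p)) (cell N (snd p))\<bar> > \<delta>} \<le> \<delta>"
    by (rule bchoice[THEN exE])
  have A: "A I i j \<in> {0..1}" if "I \<in> Is" for I i j using A' that by blast
  have approx: "measure (lebesgue_on unit_square)
      {p\<in>unit_square. \<bar>W I p - A I (cell N (fst p)) (cell N (snd p))\<bar> > \<delta>} \<le> \<delta>" if "I \<in> Is" for I
    using A' that by blast
  have "\<forall>I\<in>Is. \<exists>\<tau>K :: (nat \<Rightarrow> nat) \<times> (nat \<Rightarrow> nat \<Rightarrow> real). (\<forall>i. fst \<tau>K i < 4 ^ r) \<and> (\<forall>a b. \<bar>snd \<tau>K a b\<bar> \<le> r * e) \<and>
     (\<Sum>i<N. \<Sum>j<N. (A I i j - snd \<tau>K (fst \<tau>K i) (fst \<tau>K j))\<^sup>2) \<le> real N ^ 2 \<and>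
     cut_bounded {..<N} {..<N} (\<lambda>i j. A I i j - snd \<tau>K (fst \<tau>K i) (fst \<tau>K j)) (e * real N ^ 2)"
  proof
    fix I assume I: "I \<in> Is"
    have A01: "\<forall>i<N. \<forall>j<N. A I i j \<in> {0..1}" using A[OF I] by simp
    show "\<exists>\<tau>K :: (nat \<Rightarrow> nat) \<times> (nat \<Rightarrow> nat \<Rightarrow> real). (\<forall>i. fst \<tau>K i < 4 ^ r) \<and> (\<forall>a b. \<bar>snd \<tau>K a b\<bar> \<le> r * e) \<and>
     (\<Sum>i<N. \<Sum>j<N. (A I i j - snd \<tau>K (fst \<tau>K i) (fst \<tau>K j))\<^sup>2) \<le> real N ^ 2 \<and>
     cut_bounded {..<N} {..<N} (\<lambda>i j. A I i j - snd \<tau>K (fst \<tau>K i) (fst \<tau>K j)) (e * real N ^ 2)"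
    proof (rule weak_regularity[OF A01 e Npos r])
      fix \<tau> :: "nat \<Rightarrow> nat" and K :: "nat \<Rightarrow> nat \<Rightarrow> real"
      assume 1: "\<And>i. \<tau> i < 4 ^ r" "\<And>i j. \<bar>K i j\<bar> \<le> r * e"
        "(\<Sum>i<N. \<Sum>j<N. (A I i j - K (\<tau> i) (\<tau> j))\<^sup>2) \<le> real N ^ 2"
        "cut_bounded {..<N} {..<N} (\<lambda>i j. A I i j - K (\<tau> i) (\<tau> j)) (e * real N ^ 2)"
      show ?thesis
        by (intro exI[of _ "(\<tau>, K)"] conjI allI; unfold prod.sel) (rule 1)+
    qed
  qed
  then obtain \<tau>K :: "nat set \<Rightarrow> (nat \<Rightarrow> nat) \<times> (nat \<Rightarrow> nat \<Rightarrow> real)" where \<tau>K: "\<forall>I\<in>Is. (\<forall>i. fst (\<tau>K I) i < 4 ^ r) \<and> (\<forall>a b. \<bar>snd (\<tau>K I) a b\<bar> \<le> r * e) \<and>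
     (\<Sum>i<N. \<Sum>j<N. (A I i j - snd (\<tau>K I) (fst (\<tau>K I) i) (fst (\<tau>K I) j))\<^sup>2) \<le> real N ^ 2 \<and>
     cut_bounded {..<N} {..<N} (\<lambda>i j. A I i j - snd (\<tau>K I) (fst (\<tau>K I) i) (fst (\<tau>K I) j)) (e * real N ^ 2)"
    by (rule bchoice[THEN exE])
  define \<tau> where "\<tau> I = fst (\<tau>K I)" for I
  define K where "K I = snd (\<tau>K I)" for I
  define U where "U I i j = A I i j - K I (\<tau> I i) (\<tau> I j)" for I i j
  have \<tau>: "\<tau> I i < 4 ^ r" if "I \<in> Is" for I i using \<tau>K that unfolding \<tau>_def by blast
  have K: "\<bar>K I a b\<bar> \<le> r * e" if "I \<in> Is" for I a b using \<tau>K that unfolding K_def by blast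
  have L2: "(\<Sum>i<N. \<Sum>j<N. (A I i j - K I (\<tau> I i) (\<tau> I j))\<^sup>2) \<le> real N ^ 2" if "I \<in> Is" for I
    using \<tau>K that unfolding K_def \<tau>_def by blast
  have cb: "cut_bounded {..<N} {..<N} (\<lambda>i j. A I i j - K I (\<tau> I i) (\<tau> I j)) (e * real N ^ 2)" if "I \<in> Is" for I
    using \<tau>K that unfolding K_def \<tau>_def by blast
  have re: "0 \<le> r * e" using e by simp
  have M0: "0 \<le> M" using M re by linarith
  have UM: "\<forall>i\<in>{..<N}. \<forall>j\<in>{..<N}. \<bar>U I i j\<bar> \<le> M" if I: "I \<in> Is" for I
  proof (intro ballI)
    fix i j
    have "\<bar>U I i j\<bar> \<le> 1 + r * e"
      using A[OF I, of i j] K[OF I, of "\<tau> I i" "\<tau> I j"] unfolding U_def by (simp add: abs_le_iff)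
    then show "\<bar>U I i j\<bar> \<le> M" using M by linarith
  qed
  let ?V = "{1..n}" and ?G = "{..<N}"
  let ?TT = "PiE Is (\<lambda>_. {..<(4::nat) ^ r})" and ?\<tau>' = "\<lambda>j. \<lambda>I\<in>Is. \<tau> I j"
  let ?P = "Pi_pmf ?V (0::nat) (\<lambda>_. pmf_of_set ?G)"
  have V: "finite ?V" "?V \<noteq> {}" and G: "finite ?G" "?G \<noteq> {}" using n Npos by auto
  have fP: "finite (set_pmf ?P)" using V G by (intro finite_set_Pi_pmf) auto
  have int: "integrable ?P f" for f :: "_ \<Rightarrow> real" by (rule integrable_measure_pmf_finite[OF fP])
  \<comment> \<open>All error terms are nonnegative, so a single application of Markov's inequality
    to their sum controls each of them.\<close>
  define Z where "Z X = (\<Sum>I\<in>Is. cut_sampling_error ?V ?G q (U I) X) + type_deviation ?V ?G ?TT ?\<tau>' X" for X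
  define cI where "cI = 4 * M\<^sup>2 * (sqrt n + 1) / n + 2 * (2 ^ q * (4 * M * (sqrt n + q + 1) / n))"
  have cI0: "0 \<le> cI" unfolding cI_def using M0 by (intro add_nonneg_nonneg) auto
  have EZ: "E ?P Z \<le> 2 ^ k * cI + (4 ^ r) ^ (2 ^ k) / sqrt n"
  proof -
    have "E ?P Z = (\<Sum>I\<in>Is. E ?P (cut_sampling_error ?V ?G q (U I))) + E ?P (type_deviation ?V ?G ?TT ?\<tau>')"
      unfolding Z_def[abs_def] using int by simp
    also have "\<dots> \<le> (\<Sum>I\<in>Is. cI) + card ?TT / sqrt (card ?V)"
    proof (intro add_mono sum_mono expectation_type_deviation[OF V G])
      fix I assume I: "I \<in> Is"
      show "E ?P (cut_sampling_error ?V ?G q (U I)) \<le> cI"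
        using expectation_cut_sampling_error[OF V G UM[OF I] M0, of 0 q] unfolding cI_def by simp
    qed
    also have "(\<Sum>I\<in>Is. cI) \<le> 2 ^ k * cI"
    proof -
      have "real (card Is) \<le> 2 ^ k" using cardI by (metis of_nat_le_iff of_nat_numeral of_nat_power)
      then show ?thesis using cI0 by (simp add: mult_right_mono)
    qed
    also have "card ?TT / sqrt (card ?V) \<le> (4 ^ r) ^ (2 ^ k) / sqrt n"
    proof -
      have "card ?TT = (4 ^ r) ^ card Is" using finI by (simp add: card_PiE)
      also have "\<dots> \<le> (4 ^ r) ^ (2 ^ k)" using cardI by (intro power_increasing) auto
      finally have "real (card ?TT) \<le> real ((4 ^ r) ^ (2 ^ k))" by (simp only: of_nat_le_iff)
      then show ?thesis by (simp add: divide_right_mono)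
    qed
    finally show ?thesis by simp
  qed
  let ?b = "(2 ^ k * cI + (4 ^ r) ^ (2 ^ k) / sqrt n) / z"
  have Zn: "0 \<le> Z X" for X unfolding Z_def
    by (intro add_nonneg_nonneg sum_nonneg cut_sampling_error_nonneg type_deviation_nonneg)
  have "measure ?P {X\<in>space ?P. Z X \<ge> z} \<le> E ?P Z / z"
    using z by (intro integral_Markov_inequality_measure[where A = "{}"] int) (auto intro!: AE_I2 Zn)
  also have "\<dots> \<le> ?b" using EZ z by (intro divide_right_mono) auto
  finally have "measure ?P {X. \<not> Z X \<le> z} \<le> ?b"
    using measure_pmf.finite_measure_mono[of "{X. \<not> Z X \<le> z}" "{X\<in>space ?P. Z X \<ge> z}" ?P] by force
  moreover have "measure ?P {X. Z X \<le> z} = 1 - measure ?P {X. \<not> Z X \<le> z}"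
    using measure_pmf.prob_compl[of "{X. \<not> Z X \<le> z}" ?P] by (simp add: set_diff_eq)
  ultimately have PZ: "measure ?P {X. Z X \<le> z} \<ge> 1 - ?b" by linarith
  let ?S = "completion (sample_space n)"
  interpret prob_space ?S
    by (rule prob_space.prob_space_completion[OF prob_space_sample_space])
  define X1 where "X1 = {x\<in>space (sample_space n). Z (grid_sample n N x) \<le> z}"
  have X1: "X1 \<in> sets (sample_space n)"
    unfolding X1_def by (rule measure_grid_sample(1)[OF Npos])
  have mX1: "measure ?S X1 \<ge> 1 - ?b"
  proof -
    have "measure ?S X1 = measure (sample_space n) X1" by (rule measure_completion[OF X1])
    also have "\<dots> = measure ?P {X. Z X \<le> z}"
      unfolding X1_def by (rule measure_grid_sample(2)[OF Npos])
    finally show ?thesis using PZ by simp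
  qed
  define DI where "DI I = {p\<in>unit_square. \<bar>W I p - A I (cell N (fst p)) (cell N (snd p))\<bar> > \<delta>}" for I
  \<comment> \<open>The points to be avoided: those where the label law falls back to a point mass,
    and those where some step function misses its graphon by more than
    \<open>\<delta>\<close>.\<close>
  define D where "D = {p\<in>unit_square. \<not> regular_point k W p} \<union> (\<Union>I\<in>Is. DI I)"
  have reg: "{p\<in>unit_square. \<not> regular_point k W p} \<in> null_sets (lebesgue_on unit_square)"
    by (rule irregular_points_null_sets[OF W adm])
  have DI: "DI I \<in> sets (lebesgue_on unit_square)" if I: "I \<in> Is" for I
  proof -
    have sp: "space (lebesgue_on unit_square) = unit_square" by (simp add: space_restrict_space)
    have "graphon (W I)" using W I by (auto simp: Is_def graphon_system_def)
    then have [measurable]: "W I \<in> borel_measurable (lebesgue_on unit_square)" by (rule graphon_measurable)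
    have [measurable]: "(\<lambda>p. A I (cell N (fst p)) (cell N (snd p))) \<in> borel_measurable (lebesgue_on unit_square)"
      by (intro measurable_restrict_space1 measurable_completion) simp
    have "{p\<in>space (lebesgue_on unit_square). \<bar>W I p - A I (cell N (fst p)) (cell N (snd p))\<bar> > \<delta>} \<in> sets (lebesgue_on unit_square)"
      by measurable
    then show ?thesis unfolding DI_def sp .
  qed
  have Dm: "D \<in> sets (lebesgue_on unit_square)"
    unfolding D_def using reg DI finI by (intro sets.Un sets.finite_UN) auto
  have mD: "measure (lebesgue_on unit_square) D \<le> 2 ^ k * \<delta>"
  proof -
    interpret U: prob_space "lebesgue_on unit_square" by (rule prob_space_unit_square)
    have "measure (lebesgue_on unit_square) D
        \<le> measure (lebesgue_on unit_square) {p\<in>unit_square. \<not> regular_point k W p} + measure (lebesgue_on unit_square) (\<Union>I\<in>Is. DI I)"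
      unfolding D_def using reg DI finI by (intro measure_Un_le sets.finite_UN) auto
    also have "measure (lebesgue_on unit_square) {p\<in>unit_square. \<not> regular_point k W p} = 0"
      by (rule measure_eq_0_null_sets[OF reg])
    also have "measure (lebesgue_on unit_square) (\<Union>I\<in>Is. DI I) \<le> (\<Sum>I\<in>Is. measure (lebesgue_on unit_square) (DI I))"
      using DI finI by (intro U.finite_measure_subadditive_finite) auto
    also have "\<dots> \<le> (\<Sum>I\<in>Is. \<delta>)"
      unfolding DI_def by (intro sum_mono approx)
    also have "\<dots> \<le> 2 ^ k * \<delta>"
    proof -
      have "real (card Is) \<le> 2 ^ k" using cardI by (metis of_nat_le_iff of_nat_numeral of_nat_power)
      then show ?thesis using \<delta> by (simp add: mult_right_mono)
    qed
    finally show ?thesis by simp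
  qed
  define X2 where "X2 = {x\<in>space (sample_space n). \<exists>v\<in>{1..n}. \<exists>w\<in>{1..n}. v \<noteq> w \<and> (x v, x w) \<in> D}"
  have X2: "X2 \<in> sets ?S" "measure ?S X2 \<le> real n ^ 2 * (2 ^ k * \<delta>)"
    unfolding X2_def by (rule prob_exceptional_sample[OF Dm mD])+
  have X1S: "X1 \<in> sets ?S" using X1 by (rule sets_completionI_sets)
  have "measure ?S X1 \<le> measure ?S ((X1 - X2) \<union> X2)"
    using X1S X2(1) by (intro finite_measure_mono) auto
  also have "\<dots> \<le> measure ?S (X1 - X2) + measure ?S X2"
    using X1S X2(1) by (intro measure_Un_le) auto
  finally have mX: "measure ?S (X1 - X2) \<ge> 1 - (?b + real n ^ 2 * (2 ^ k * \<delta>))"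
    using mX1 X2(2) by linarith
  have XS: "X1 - X2 \<in> sets ?S" using X1S X2(1) by (rule sets.Diff)
  let ?A = "{G. cut_dist k W (system_graphons n G)
      \<le> 2 ^ k * (3 * \<delta> + 2 * e + 4 * (r * e) * z + sqrt ((1 + z) / q) + z + 1 / n + \<xi>)}"
  have good: "1 - 2 ^ k * ((sqrt n + 3) / (\<xi>\<^sup>2 * n)) \<le> measure (measure_pmf (conditional_graphs k W n x)) ?A"
    if x: "x \<in> X1 - X2" for x
  proof -
    have xs: "x \<in> space (sample_space n)" and xZ: "Z (grid_sample n N x) \<le> z"
      using x by (auto simp: X1_def)
    have xD: "(x v, x w) \<notin> D" if "v \<in> {1..n}" "w \<in> {1..n}" "v \<noteq> w" for v w
      using x xs that unfolding X2_def by blast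
    have regx: "regular_point k W (x v, x w)" if vw: "v \<in> {1..n}" "w \<in> {1..n}" "v \<noteq> w" for v w
      using xD[OF vw] sample_pair_in_unit_square[OF xs vw(1,2)] unfolding D_def by blast
    let ?X = "grid_sample n N x"
    have near: "\<bar>W I (x v, x w) - A I (?X v) (?X w)\<bar> \<le> \<delta>"
      if I: "I \<in> Is" and vw: "v \<in> {1..n}" "w \<in> {1..n}" "v \<noteq> w" for I v w
    proof -
      have "(x v, x w) \<notin> DI I" using xD[OF vw] I unfolding D_def by blast
      then have "\<bar>W I (x v, x w) - A I (cell N (x v)) (cell N (x w))\<bar> \<le> \<delta>"
        using sample_pair_in_unit_square[OF xs vw(1,2)] by (simp add: DI_def)
      then show ?thesis using vw by (simp add: grid_sample_def)
    qed
    have XN: "?X v < N" for v using cell_less[OF Npos] Npos by (simp add: grid_sample_def)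
    have Z1: "cut_sampling_error ?V ?G q (\<lambda>i j. A I i j - K I (\<tau> I i) (\<tau> I j)) ?X \<le> z" if I: "I \<in> Is" for I
    proof -
      have "cut_sampling_error ?V ?G q (U I) ?X \<le> (\<Sum>I\<in>Is. cut_sampling_error ?V ?G q (U I) ?X)"
        using I finI by (intro member_le_sum cut_sampling_error_nonneg)
      also have "\<dots> \<le> Z ?X" unfolding Z_def using type_deviation_nonneg by simp
      finally show ?thesis using xZ unfolding U_def[abs_def] by linarith
    qed
    have Z2: "type_deviation ?V ?G ?TT ?\<tau>' ?X \<le> z"
    proof -
      have "0 \<le> (\<Sum>I\<in>Is. cut_sampling_error ?V ?G q (U I) ?X)"
        by (intro sum_nonneg cut_sampling_error_nonneg)
      then show ?thesis using xZ unfolding Z_def by linarith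
    qed
    have "1 - 2 ^ k * ((sqrt n + 3) / (\<xi>\<^sup>2 * n)) \<le> measure (measure_pmf (conditional_graphs k W n x))
      {G. \<forall>I\<in>Is. cut_bounded {1..n} {1..n} (noise n W x I G) (\<xi> * real n ^ 2)}"
      unfolding Is_def by (rule prob_noise[OF W xs n regx \<xi>])
    also have "\<dots> \<le> measure (measure_pmf (conditional_graphs k W n x)) ?A"
    proof (rule measure_pmf.finite_measure_mono)
      show "{G. \<forall>I\<in>Is. cut_bounded {1..n} {1..n} (noise n W x I G) (\<xi> * real n ^ 2)} \<subseteq> ?A"
      proof (intro subsetI CollectI)
        fix F assume "F \<in> {G. \<forall>I\<in>Is. cut_bounded {1..n} {1..n} (noise n W x I G) (\<xi> * real n ^ 2)}"
        then have noise: "\<And>I. I \<in> Is \<Longrightarrow> cut_bounded {1..n} {1..n} (noise n W x I F) (\<xi> * real n ^ 2)" by blast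
        show "cut_dist k W (system_graphons n F)
            \<le> 2 ^ k * (3 * \<delta> + 2 * e + 4 * (r * e) * z + sqrt ((1 + z) / q) + z + 1 / n + \<xi>)"
          by (rule cut_dist_of_good_sample[OF W n m N_def q less_imp_le[OF e] less_imp_le[OF z]
                less_imp_le[OF \<delta>] less_imp_le[OF \<xi>] Is_def A approx \<tau> K re L2 cb XN Z1 Z2 near noise])
      qed
    qed simp
    finally show ?thesis .
  qed
  have "0 \<le> 2 ^ k * ((sqrt n + 3) / (\<xi>\<^sup>2 * n))" by simp
  from measure_random_graphs_ge[OF W XS good mX this]
  show ?thesis unfolding cI_def .
qed

section \<open>Asymptotics\<close>

text \<open>All rests on \<open>ln b / 10 ^ 4 \<le> 1 / 8\<close>, for which
  \<open>b \<le> 4\<close> leaves ample room. The case \<open>b = 2\<close> counts subsets of probes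
  and \<open>b = 4\<close> joint types; \<open>d\<close> absorbs the rounding of the
  exponents.\<close>

lemma power_le_sample_size_powr:
  fixes L :: real
  assumes n: "n > 0" and L: "L = ln (real n)" and a: "real a \<le> L / 10 ^ 4 + d" and b: "1 \<le> b" "b \<le> 4" and L0: "L \<ge> 0"
  shows "b ^ a \<le> b powr d * real n powr (1 / 8)"
proof -
  have "ln b \<le> 1250"
  proof -
    have "ln b \<le> b - 1" using b by (intro ln_le_minus_one) auto
    then show ?thesis using b by linarith
  qed
  then have "ln b * (L / 10 ^ 4) \<le> 1250 * (L / 10 ^ 4)" using L0 by (intro mult_right_mono) auto
  then have *: "b powr (L / 10 ^ 4) \<le> real n powr (1 / 8)"
    using b n by (simp add: powr_def L mult.commute)
  have "b ^ a = b powr real a" using b by (simp add: powr_realpow)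
  also have "\<dots> \<le> b powr (L / 10 ^ 4 + d)" using a b by (intro powr_mono) auto
  also have "\<dots> = b powr d * b powr (L / 10 ^ 4)" by (simp add: powr_add)
  also have "\<dots> \<le> b powr d * real n powr (1 / 8)" using * by (intro mult_left_mono) auto
  finally show ?thesis .
qed

text \<open>The errors that decay like a power of n, up to logarithms. Together they receive the
  share \<open>100 / sqrt (ln n)\<close> of the final bound.\<close>

lemma eventually_distance_terms:
  "eventually (\<lambda>n::nat. 3 / real n ^ 3 + 4 * ln n * real n powr (-1/8) + real n powr (-1/8) + 1 / real n
     + real n powr (-1/8) \<le> 100 / sqrt (ln n)) sequentially"
  by real_asymp

text \<open>Up to logarithms the slowest terms are of order n^(-1/4): the noise gives n^(-1/2) /
  n^(-1/4), while the sampling and type errors give n^(1/8 - 1/2), divided by the threshold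
  n^(-1/8).\<close>

lemma probability_bound_tendsto:
  fixes c C :: real
  shows "(\<lambda>n::nat. 1 - c * ((sqrt n + 3) / ((real n powr (-1/8))\<^sup>2 * n))
      - ((c * (4 * (ln n)\<^sup>2 * (sqrt n + 1) / n + 2 * ((2 * real n powr (1/8)) * (4 * ln n * (sqrt n + ln n + 1) / n)))
            + C * real n powr (1/8) / sqrt n) / real n powr (-1/8)
          + real n ^ 2 * (c * (1 / real n ^ 3)))) \<longlonglongrightarrow> 1"
  by real_asymp

lemma eventually_parameters:
  fixes c :: real assumes "c > 0"
  shows "eventually (\<lambda>n::nat. 1 + (sqrt (ln n) / (100 * c) + 100 * c / sqrt (ln n)) \<le> ln n \<and>
    ln n / 10^4 + 1 \<le> ln n \<and> 2 \<le> n \<and> 1 \<le> ln n) sequentially"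
proof -
  have "eventually (\<lambda>n::nat. 1 + (sqrt (ln n) / (100 * c) + 100 * c / sqrt (ln n)) \<le> ln n) sequentially"
    using assms by real_asymp
  moreover have "eventually (\<lambda>n::nat. ln n / 10^4 + 1 \<le> ln n) sequentially" by real_asymp
  moreover have "eventually (\<lambda>n::nat. 1 \<le> ln n) sequentially" by real_asymp
  ultimately show ?thesis using eventually_ge_at_top[of "2::nat"] by eventually_elim auto
qed

lemma random_graphs_asymptotic_bound:
  fixes k n :: nat
  defines "c \<equiv> 2 ^ k :: real" and "L \<equiv> ln (real n)" and "z \<equiv> real n powr (-1/8)"
  assumes W: "graphon_system k W" and adm: "admissible k W"
    and p1: "1 + (sqrt L / (100 * c) + 100 * c / sqrt L) \<le> L" and p2: "L / 10 ^ 4 + 1 \<le> L"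
    and n2: "2 \<le> n" and L1: "1 \<le> L"
    and dist: "3 / real n ^ 3 + 4 * L * z + z + 1 / real n + z \<le> 100 / sqrt L"
  shows "1 - c * ((sqrt n + 3) / (z\<^sup>2 * n))
      - ((c * (4 * L\<^sup>2 * (sqrt n + 1) / n + 2 * ((2 * real n powr (1/8)) * (4 * L * (sqrt n + L + 1) / n)))
            + 4 powr c * real n powr (1/8) / sqrt n) / z
          + real n ^ 2 * (c * (1 / real n ^ 3)))
    \<le> measure (random_graphs k W n)
         {G. cut_dist k W (system_graphons n G) \<le> 10 ^ 3 * 8 ^ k / sqrt (ln (real n))}"
proof -
  \<comment> \<open>The factor \<open>c\<close> pays for the joint types: regularity takes about L /
    (10^4 c^2) steps, and after multiplication by \<open>c\<close>, the bound for the number of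
    index sets, the exponent of 4 is still at most L / 10^4 plus a constant.\<close>
  define e where "e = 100 * c / sqrt L"
  define r where "r = nat \<lfloor>1 / e\<^sup>2\<rfloor> + 1"
  \<comment> \<open>Enough probes for an estimation error of order 1 / sqrt L, yet few enough for
    \<open>2 ^ q\<close> to be at most \<open>2 * real n powr (1 / 8)\<close>.\<close>
  define q where "q = nat \<lceil>L / 10 ^ 4\<rceil>"
  \<comment> \<open>Small enough to beat the n^2 pairs in the union bound over the exceptional
    set.\<close>
  define \<delta> where "\<delta> = 1 / real n ^ 3"
  have c: "c \<ge> 1" by (simp add: c_def)
  have n: "n > 0" using n2 by simp
  have z: "z > 0" using n by (simp add: z_def)
  have z1: "z \<le> 1" unfolding z_def using n2 powr_mono[of "-1/8" 0 "real n"] by simp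
  have sL: "sqrt L > 0" "sqrt L * sqrt L = L" using L1 by auto
  have e: "e > 0" using c sL by (simp add: e_def)
  have inve: "1 / e\<^sup>2 = L / (10 ^ 4 * c\<^sup>2)"
    unfolding e_def using sL by (simp add: power_divide power_mult_distrib)
  have fl: "real (nat \<lfloor>1 / e\<^sup>2\<rfloor>) \<le> 1 / e\<^sup>2" "1 / e\<^sup>2 < real (nat \<lfloor>1 / e\<^sup>2\<rfloor>) + 1"
  proof -
    have "0 \<le> \<lfloor>1 / e\<^sup>2\<rfloor>" by simp
    then have "real (nat \<lfloor>1 / e\<^sup>2\<rfloor>) = of_int \<lfloor>1 / e\<^sup>2\<rfloor>" by simp
    then show "real (nat \<lfloor>1 / e\<^sup>2\<rfloor>) \<le> 1 / e\<^sup>2" "1 / e\<^sup>2 < real (nat \<lfloor>1 / e\<^sup>2\<rfloor>) + 1"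
      by linarith+
  qed
  have r_le: "real r \<le> 1 / e\<^sup>2 + 1" and r_gt: "1 / e\<^sup>2 < real r"
    using fl unfolding r_def by linarith+
  have r: "r * e\<^sup>2 > 1" using r_gt e by (simp add: divide_less_eq)
  have "r * e \<le> (1 / e\<^sup>2 + 1) * e" using r_le e by (intro mult_right_mono) auto
  also have "\<dots> = 1 / e + e" using e by (simp add: power2_eq_square field_simps)
  also have "1 / e = sqrt L / (100 * c)" by (simp add: e_def)
  finally have re: "1 + r * e \<le> L" using p1 unfolding e_def by linarith
  have q_le: "real q \<le> L / 10 ^ 4 + 1" and q_ge: "L / 10 ^ 4 \<le> real q"
  proof -
    have "0 \<le> \<lceil>L / 10 ^ 4\<rceil>" using L1 by simp
    then have "real q = of_int \<lceil>L / 10 ^ 4\<rceil>" by (simp add: q_def)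
    then show "real q \<le> L / 10 ^ 4 + 1" "L / 10 ^ 4 \<le> real q" by linarith+
  qed
  have q: "q > 0" using q_ge L1 by (cases q) auto
  have two_q: "2 ^ q \<le> 2 * real n powr (1 / 8)"
    using power_le_sample_size_powr[OF n meta_eq_to_obj_eq[OF L_def] q_le, of 2] L1 by simp
  have four_r: "(4 ^ r) ^ (2 ^ k) \<le> 4 powr c * real n powr (1 / 8)"
  proof -
    have "real (r * 2 ^ k) = real r * c" by (simp add: c_def)
    also have "\<dots> \<le> (L / (10 ^ 4 * c\<^sup>2) + 1) * c" using r_le c unfolding inve by (intro mult_right_mono) auto
    also have "\<dots> = L / 10 ^ 4 / c + c" using c by (simp add: power2_eq_square field_simps)
    also have "L / 10 ^ 4 / c \<le> L / 10 ^ 4"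
      using c L1 by (simp add: divide_le_eq mult_le_cancel_left1)
    finally have "real (r * 2 ^ k) \<le> L / 10 ^ 4 + c" by simp
    from power_le_sample_size_powr[OF n meta_eq_to_obj_eq[OF L_def] this, of 4] L1 show ?thesis by (simp add: power_mult)
  qed
  let ?d = "2 ^ k * (3 * \<delta> + 2 * e + 4 * (r * e) * z + sqrt ((1 + z) / q) + z + 1 / n + z)"
  have d: "?d \<le> 10 ^ 3 * 8 ^ k / sqrt (ln (real n))"
  proof -
    have c2: "c \<le> c\<^sup>2" using mult_left_mono[of 1 c c] c by (simp add: power2_eq_square)
    have "(1 + z) / q \<le> 2 / (L / 10 ^ 4)"
      using z1 z q_ge L1 by (intro frac_le) auto
    \<comment> \<open>142^2 = 20164 is the first square above 2 * 10^4.\<close>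
    also have "\<dots> \<le> 142\<^sup>2 / L" using L1 by (simp add: divide_right_mono)
    finally have "sqrt ((1 + z) / q) \<le> sqrt (142\<^sup>2 / L)" by (rule real_sqrt_le_mono)
    then have s: "sqrt ((1 + z) / q) \<le> 142 / sqrt L" by (simp add: real_sqrt_divide)
    have "4 * (r * e) * z \<le> 4 * L * z" using re z by (intro mult_right_mono) auto
    then have "3 * \<delta> + 2 * e + 4 * (r * e) * z + sqrt ((1 + z) / q) + z + 1 / n + z
        \<le> 100 / sqrt L + 2 * (100 * c / sqrt L) + 142 / sqrt L"
      using dist s unfolding \<delta>_def e_def by simp
    \<comment> \<open>100 is the share of the decaying terms, 142 that of the probes, and
      \<open>200 * c\<close> stems from the two occurrences of \<open>e\<close>. As
      \<open>c \<ge> 1\<close>, all this is below \<open>1000 * c ^ 2\<close>; the factor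
      \<open>c\<close> in front completes the cube \<open>8 ^ k\<close>.\<close>
    also have "\<dots> = (242 + 200 * c) / sqrt L" by (simp add: add_divide_distrib)
    also have "\<dots> \<le> (1000 * c\<^sup>2) / sqrt L"
      using c c2 sL by (intro divide_right_mono) auto
    finally have "?d \<le> c * ((1000 * c\<^sup>2) / sqrt L)"
      unfolding c_def by (intro mult_left_mono) auto
    also have "\<dots> = 10 ^ 3 * 8 ^ k / sqrt L"
    proof -
      have "(8::real) ^ k = (2 ^ k) ^ 3" by (simp add: power_mult[symmetric] mult.commute[of k 3]) (simp add: power_mult)
      then show ?thesis by (simp add: c_def power2_eq_square power3_eq_cube)
    qed
    finally show ?thesis by (simp add: L_def)
  qed
  have \<delta>: "\<delta> > 0" using n by (simp add: \<delta>_def)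
  interpret subprob_space "random_graphs k W n" by (rule subprob_space_random_graphs[OF W])
  have "1 - c * ((sqrt n + 3) / (z\<^sup>2 * n))
      - ((c * (4 * L\<^sup>2 * (sqrt n + 1) / n + 2 * ((2 * real n powr (1/8)) * (4 * L * (sqrt n + L + 1) / n)))
            + 4 powr c * real n powr (1/8) / sqrt n) / z
          + real n ^ 2 * (c * (1 / real n ^ 3)))
    \<le> 1 - 2 ^ k * ((sqrt n + 3) / (z\<^sup>2 * n))
      - ((2 ^ k * (4 * L\<^sup>2 * (sqrt n + 1) / n + 2 * (2 ^ q * (4 * L * (sqrt n + q + 1) / n)))
            + (4 ^ r) ^ (2 ^ k) / sqrt n) / z
          + real n ^ 2 * (2 ^ k * \<delta>))"
    unfolding c_def \<delta>_def using two_q four_r q_le p2 L1 z n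
    by (intro diff_mono add_mono divide_right_mono mult_left_mono mult_mono) (auto simp: c_def)
  also have "\<dots> \<le> measure (random_graphs k W n) {G. cut_dist k W (system_graphons n G) \<le> ?d}"
    by (rule random_graphs_bound[OF W adm n q e r z z \<delta> re])
  also have "\<dots> \<le> measure (random_graphs k W n)
      {G. cut_dist k W (system_graphons n G) \<le> 10 ^ 3 * 8 ^ k / sqrt (ln (real n))}"
    using d by (intro finite_measure_mono) (auto simp: sets_random_graphs[OF W] intro: order_trans)
  finally show ?thesis .
qed

theorem theorem3p3:
  fixes k :: nat and W :: "nat set \<Rightarrow> real \<times> real \<Rightarrow> real"
  assumes "k \<ge> 1"
    and "graphon_system k W"
    and "admissible k W"
  shows "(\<lambda>n. measure (random_graphs k W n)
            {G. cut_dist k W (system_graphons n G) \<le> 10 ^ 3 * 8 ^ k / sqrt (ln (real n))})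
         \<longlonglongrightarrow> 1"
proof (rule tendsto_sandwich[OF _ _ probability_bound_tendsto[of "2 ^ k" "4 powr 2 ^ k"] tendsto_const])
  have "(2::real) ^ k > 0" by simp
  from eventually_parameters[OF this] eventually_distance_terms
  show "eventually (\<lambda>n::nat. 1 - 2 ^ k * ((sqrt n + 3) / ((real n powr (-1/8))\<^sup>2 * n))
      - ((2 ^ k * (4 * (ln n)\<^sup>2 * (sqrt n + 1) / n + 2 * ((2 * real n powr (1/8)) * (4 * ln n * (sqrt n + ln n + 1) / n)))
            + 4 powr 2 ^ k * real n powr (1/8) / sqrt n) / real n powr (-1/8)
          + real n ^ 2 * (2 ^ k * (1 / real n ^ 3)))
    \<le> measure (random_graphs k W n)
         {G. cut_dist k W (system_graphons n G) \<le> 10 ^ 3 * 8 ^ k / sqrt (ln (real n))}) sequentially"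
  proof eventually_elim
    case (elim n)
    then show ?case by (intro random_graphs_asymptotic_bound assms(2,3)) auto
  qed
  show "eventually (\<lambda>n. measure (random_graphs k W n)
         {G. cut_dist k W (system_graphons n G) \<le> 10 ^ 3 * 8 ^ k / sqrt (ln (real n))} \<le> 1) sequentially"
    by (intro always_eventually allI subprob_space.subprob_measure_le_1 subprob_space_random_graphs assms(2))
qed

end
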